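(* Let $\mathbb{G}$ be a graded Lie group, let $\mathcal{R}$ be a positive Rockland operator on $\mathbb{G}$ of homogeneous degree $\nu$, and let $s>0$, $T>0$. Let $(u_0,u_1)\in H^{\frac{s\nu}{2}}(\mathbb{G})\times L^2(\mathbb{G})$ and let $m\in C_0(\mathbb{G})$, $m\ge0$. Let $m_\epsilon=m*\psi_\epsilon\ge 0$, $\epsilon\in(0,1]$, be a regularisation of $m$ with a non-negative Friedrichs mollifier $\psi\ge 0$. Let $u\in C([0,T];H^{\frac{s\nu}{2}}(\mathbb{G}))\cap C^1([0,T];L^2(\mathbb{G}))$ be the unique (classical) solution of $$u_{tt}+\mathcal{R}^su+mu=0\ \text{ on }[0,T]\times\mathbb{G},\qquad u(0,\cdot)=u_0,\ u_t(0,\cdot)=u_1,$$ and for each $\epsilon\in(0,1]$ let $u_\epsilon$, in the same space, be the solution of $$\partial_t^2u_\epsilon+\mathcal{R}^su_\epsilon+m_\epsilon u_\epsilon=0\ \text{ on }[0,T]\times\mathbb{G},\qquad u_\epsilon(0,\cdot)=u_0,\ \partial_tu_\epsilon(0,\cdot)=u_1.$$ Then, for every $t\in[0,T]$, $u_\epsilon(t,\cdot)\to u(t,\cdot)$ in $L^2(\mathbb{G})$ as $\epsilon\to0$.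
   Context: Graded Lie group: a connected, simply connected nilpotent Lie group $\mathbb{G}$ whose Lie algebra has a vector space decomposition $\mathfrak{g}=\bigoplus_{j\ge1}\mathfrak{g}_j$ (finitely many $\mathfrak{g}_j$ non-zero) with $[\mathfrak{g}_i,\mathfrak{g}_j]\subset\mathfrak{g}_{i+j}$. The exponential map identifies $\mathfrak{g}$ with $\mathbb{G}$; Lebesgue measure $dx$ is the bi-invariant Haar measure. Dilations $D_r$, $r>0$, act by $D_rX=r^jX$ for $X\in\mathfrak{g}_j$ and are transported to $\mathbb{G}$; $Q=\sum_j j\dim\mathfrak{g}_j$ is the homogeneous dimension. Rockland operator: a left-invariant hypoelliptic differential operator $\mathcal{R}$ on $\mathbb{G}$, homogeneous of a positive degree $\nu$ with respect to the dilations. Positive means $(\mathcal{R}f,f)_{L^2(\mathbb{G})}\ge0$ for all $f\in C_c^\infty(\mathbb{G})$. We also write $\mathcal{R}$ for its self-adjoint extension on $L^2(\mathbb{G})$; powers $\mathcal{R}^s$ are defined by the spectral theorem. Sobolev space: $H^{\frac{s\nu}{2}}(\mathbb{G})$ has norm $\|f\|_{H^{s\nu/2}(\mathbb{G})}=\|\mathcal{R}^{s/2}f\|_{L^2(\mathbb{G})}+\|f\|_{L^2(\mathbb{G})}$ (it is the domain of $\mathcal{R}^{s/2}$ in $L^2(\mathbb{G})$). $C_0(\mathbb{G})$ is the space of continuous functions on $\mathbb{G}$ vanishing at infinity: for every $\delta>0$ there is a compact set outside of which $|f|<\delta$. Solutions $u\in C([0,T];H^{s\nu/2})\cap C^1([0,T];L^2)$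 of an equation $u_{tt}+\mathcal{R}^su+mu=0$ with $m$ a function are understood in the weak sense: for all $\varphi\in H^{s\nu/2}(\mathbb{G})$, $\frac{d}{dt}(u_t,\varphi)_{L^2}+(\mathcal{R}^{s/2}u,\mathcal{R}^{s/2}\varphi)_{L^2}+(mu,\varphi)_{L^2}=0$ in the sense of distributions on $(0,T)$. Friedrichs mollifier: $\psi\in C_c^\infty(\mathbb{G})$ with $\int_{\mathbb{G}}\psi\,dx=1$; $\psi_\epsilon(x)=\epsilon^{-Q}\psi(D_{\epsilon^{-1}}x)$. Convolution: $(f*g)(x)=\int_{\mathbb{G}}f(y)g(y^{-1}x)\,dy$. *)

theory Defs
  imports "HOL-Analysis.Analysis"
begin

definition dir_deriv ::
    "'a::real_normed_vector \<Rightarrow> ('a \<Rightarrow> 'b::real_normed_vector) \<Rightarrow> 'a \<Rightarrow> 'b" where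
  "dir_deriv v f = (\<lambda>x. frechet_derivative f (at x) v)"

text \<open>Only meant for open \<open>S\<close>.\<close>

primrec Ck_on ::
    "nat \<Rightarrow> 'a::real_normed_vector set \<Rightarrow> ('a \<Rightarrow> 'b::real_normed_vector) \<Rightarrow> bool" where
  "Ck_on 0 S f \<longleftrightarrow> continuous_on S f"
| "Ck_on (Suc k) S f \<longleftrightarrow> f differentiable_on S \<and> (\<forall>v. Ck_on k S (dir_deriv v f))"

definition smooth_on ::
    "'a::real_normed_vector set \<Rightarrow> ('a \<Rightarrow> 'b::real_normed_vector) \<Rightarrow> bool" where
  "smooth_on S f \<longleftrightarrow> (\<forall>k. Ck_on k S f)"

definition test_functions ::
    "'a::real_normed_vector set \<Rightarrow> ('a \<Rightarrow> 'b::real_normed_vector) set" where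
  "test_functions S =
     {f. smooth_on UNIV f \<and> compact (closure {x. f x \<noteq> 0}) \<and> closure {x. f x \<noteq> 0} \<subseteq> S}"

text \<open>
  A connected, simply connected nilpotent Lie group is identified with its Lie algebra by the
  exponential map. So the underlying manifold is the vector space \<open>'a\<close> itself, the neutral element
  is \<open>0\<close>, and \<open>t \<mapsto> t *\<^sub>R X\<close> is the one-parameter subgroup generated by \<open>X\<close>; in particular the
  inverse of \<open>x\<close> is \<open>- x\<close>. The Lie bracket is the one of the group law, as the derivative of the
  adjoint representation. Lebesgue measure on \<open>'a\<close> is then a bi-invariant Haar measure.
\<close>

definition Ad :: "('a \<Rightarrow> 'a \<Rightarrow> 'a) \<Rightarrow> 'a \<Rightarrow> 'a \<Rightarrow> 'a::real_normed_vector" where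
  "Ad mul g Y = vector_derivative (\<lambda>t::real. mul (mul g (t *\<^sub>R Y)) (- g)) (at 0)"

definition lie_bracket :: "('a \<Rightarrow> 'a \<Rightarrow> 'a) \<Rightarrow> 'a \<Rightarrow> 'a \<Rightarrow> 'a::real_normed_vector" where
  "lie_bracket mul X Y = vector_derivative (\<lambda>s::real. Ad mul (s *\<^sub>R X) Y) (at 0)"

text \<open>The summands are indexed by \<open>j \<ge> 1\<close>; the index \<open>0\<close> is given the zero space.\<close>

definition gradation :: "(nat \<Rightarrow> 'a::euclidean_space set) \<Rightarrow> bool" where
  "gradation V \<longleftrightarrow>
     (\<forall>j. subspace (V j)) \<and> V 0 = {0} \<and> finite {j. V j \<noteq> {0}} \<and>
     (\<forall>x. \<exists>!c. (\<forall>j. c j \<in> V j) \<and> x = (\<Sum>j | V j \<noteq> {0}. c j))"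

definition component :: "(nat \<Rightarrow> 'a::euclidean_space set) \<Rightarrow> 'a \<Rightarrow> nat \<Rightarrow> 'a" where
  "component V x = (THE c. (\<forall>j. c j \<in> V j) \<and> x = (\<Sum>j | V j \<noteq> {0}. c j))"

text \<open>
  Nilpotency need not be stated separately: it follows from the bracket condition, since only
  finitely many summands are non-zero and all weights are positive.
\<close>

definition graded_lie_group ::
    "('a \<Rightarrow> 'a \<Rightarrow> 'a) \<Rightarrow> (nat \<Rightarrow> 'a::euclidean_space set) \<Rightarrow> bool" where
  "graded_lie_group mul V \<longleftrightarrow>
     Groups.group mul 0 uminus \<and>
     smooth_on UNIV (\<lambda>(x, y). mul x y) \<and>
     (\<forall>X s t. mul (s *\<^sub>R X) (t *\<^sub>R X) = (s + t) *\<^sub>R X) \<and>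
     gradation V \<and>
     (\<forall>i j. \<forall>X\<in>V i. \<forall>Y\<in>V j. lie_bracket mul X Y \<in> V (i + j))"

definition dilation :: "(nat \<Rightarrow> 'a::euclidean_space set) \<Rightarrow> real \<Rightarrow> 'a \<Rightarrow> 'a" where
  "dilation V r x = (\<Sum>j | V j \<noteq> {0}. r ^ j *\<^sub>R component V x j)"

definition hom_dim :: "(nat \<Rightarrow> 'a::euclidean_space set) \<Rightarrow> nat" where
  "hom_dim V = (\<Sum>j | V j \<noteq> {0}. j * dim (V j))"

definition convolution ::
    "('a \<Rightarrow> 'a \<Rightarrow> 'a) \<Rightarrow> ('a::euclidean_space \<Rightarrow> real) \<Rightarrow> ('a \<Rightarrow> real) \<Rightarrow> 'a \<Rightarrow> real" where
  "convolution mul f g x = (LINT y|lborel. f y * g (mul (- y) x))"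

definition mollify ::
    "(nat \<Rightarrow> 'a::euclidean_space set) \<Rightarrow> ('a \<Rightarrow> real) \<Rightarrow> real \<Rightarrow> 'a \<Rightarrow> real" where
  "mollify V \<psi> \<epsilon> x = (1 / \<epsilon>) ^ hom_dim V * \<psi> (dilation V (1 / \<epsilon>) x)"

definition vanishes_at_infinity :: "('a::topological_space \<Rightarrow> real) \<Rightarrow> bool" where
  "vanishes_at_infinity f \<longleftrightarrow> (\<forall>\<delta>>0. \<exists>K. compact K \<and> (\<forall>x. x \<notin> K \<longrightarrow> \<bar>f x\<bar> < \<delta>))"

text \<open>
  Elements are represented by Borel functions; two functions represent the same element iff they
  agree almost everywhere, equivalently iff \<open>l2_norm\<close> of the difference is \<open>0\<close>.
\<close>

definition L2 :: "('a::euclidean_space \<Rightarrow> complex) set" where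
  "L2 = {f \<in> borel_measurable lborel. integrable lborel (\<lambda>x. (cmod (f x))\<^sup>2)}"

definition l2_inner :: "('a::euclidean_space \<Rightarrow> complex) \<Rightarrow> ('a \<Rightarrow> complex) \<Rightarrow> complex" where
  "l2_inner f g = (LINT x|lborel. f x * cnj (g x))"

definition l2_norm :: "('a::euclidean_space \<Rightarrow> complex) \<Rightarrow> real" where
  "l2_norm f = sqrt (LINT x|lborel. (cmod (f x))\<^sup>2)"

text \<open>
  Unbounded operators are given by their graphs. The adjoint relation is the graph of an operator
  (modulo null sets) when the domain is dense.
\<close>

type_synonym 'a operator = "('a \<Rightarrow> complex) rel"

definition adjoint_operator :: "'a::euclidean_space operator \<Rightarrow> 'a operator" where
  "adjoint_operator A =
     {(g, h). g \<in> L2 \<and> h \<in> L2 \<and> (\<forall>(f, k)\<in>A. l2_inner k g = l2_inner f h)}"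

definition self_adjoint :: "'a::euclidean_space operator \<Rightarrow> bool" where
  "self_adjoint A \<longleftrightarrow>
     (\<forall>f\<in>L2. \<forall>e>0. \<exists>h\<in>Domain A. l2_norm (\<lambda>x. f x - h x) < e) \<and> adjoint_operator A = A"

definition op_apply :: "'a operator \<Rightarrow> ('a \<Rightarrow> complex) \<Rightarrow> 'a \<Rightarrow> complex" where
  "op_apply B f = (SOME g. (f, g) \<in> B)"

text \<open>
  \<open>E S\<close> is an orthogonal projection: it is symmetric (hence linear modulo null sets), and
  multiplicativity gives idempotency.
\<close>

definition projection_valued_measure ::
    "(real set \<Rightarrow> ('a::euclidean_space \<Rightarrow> complex) \<Rightarrow> 'a \<Rightarrow> complex) \<Rightarrow> bool" where
  "projection_valued_measure E \<longleftrightarrow>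
     (\<forall>S\<in>sets borel. \<forall>f\<in>L2. E S f \<in> L2) \<and>
     (\<forall>S\<in>sets borel. \<forall>f\<in>L2. \<forall>g\<in>L2. l2_inner (E S f) g = l2_inner f (E S g)) \<and>
     (\<forall>S\<in>sets borel. \<forall>S'\<in>sets borel. \<forall>f\<in>L2. AE x in lborel. E S (E S' f) x = E (S \<inter> S') f x) \<and>
     (\<forall>f\<in>L2. AE x in lborel. E UNIV f x = f x) \<and>
     (\<forall>S. range S \<subseteq> sets borel \<longrightarrow> disjoint_family S \<longrightarrow>
        (\<forall>f\<in>L2. (\<lambda>n. l2_inner (E (S n) f) f) sums l2_inner (E (\<Union>n::nat. S n) f) f))"

definition scalar_spectral_measure ::
    "(real set \<Rightarrow> ('a::euclidean_space \<Rightarrow> complex) \<Rightarrow> 'a \<Rightarrow> complex) \<Rightarrow>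
     ('a \<Rightarrow> complex) \<Rightarrow> real measure" where
  "scalar_spectral_measure E f =
     measure_of UNIV (sets borel) (\<lambda>S. ennreal (Re (l2_inner (E S f) f)))"

definition simple_spectral_integral ::
    "(real set \<Rightarrow> ('a \<Rightarrow> complex) \<Rightarrow> 'a \<Rightarrow> complex) \<Rightarrow>
     (real \<Rightarrow> real) \<Rightarrow> ('a \<Rightarrow> complex) \<Rightarrow> 'a \<Rightarrow> complex" where
  "simple_spectral_integral E \<sigma> f = (\<lambda>x. \<Sum>y\<in>range \<sigma>. complex_of_real y * E (\<sigma> -` {y}) f x)"

text \<open>
  The operator \<open>\<integral> \<phi> dE\<close>: its value at \<open>f\<close> is the \<open>L\<^sup>2\<close> limit of \<open>\<integral> \<sigma>\<^sub>n dE f\<close> for simple \<open>\<sigma>\<^sub>n\<close>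
  converging to \<open>\<phi>\<close> in \<open>L\<^sup>2\<close> of the finite measure \<open>S \<mapsto> (E S f, f)\<close>. The existence of such a
  sequence amounts to square integrability of \<open>\<phi>\<close>, so this gives the usual domain.
\<close>

definition spectral_integral ::
    "(real set \<Rightarrow> ('a::euclidean_space \<Rightarrow> complex) \<Rightarrow> 'a \<Rightarrow> complex) \<Rightarrow>
     (real \<Rightarrow> real) \<Rightarrow> 'a operator" where
  "spectral_integral E \<phi> =
     {(f, g). f \<in> L2 \<and> g \<in> L2 \<and>
        (\<exists>\<sigma>. (\<forall>n::nat. simple_function borel (\<sigma> n)) \<and>
             (\<lambda>n. \<integral>\<^sup>+ l. ennreal ((\<phi> l - \<sigma> n l)\<^sup>2) \<partial>scalar_spectral_measure E f) \<longlonglongrightarrow> 0 \<and>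
             (\<lambda>n. l2_norm (\<lambda>x. simple_spectral_integral E (\<sigma> n) f x - g x)) \<longlonglongrightarrow> 0)}"

definition spectral_resolution ::
    "'a::euclidean_space operator \<Rightarrow>
     (real set \<Rightarrow> ('a \<Rightarrow> complex) \<Rightarrow> 'a \<Rightarrow> complex) \<Rightarrow> bool" where
  "spectral_resolution A E \<longleftrightarrow>
     projection_valued_measure E \<and> A = spectral_integral E (\<lambda>l. l)"

text \<open>
  For \<open>s > 0\<close> and a non-negative operator with spectral resolution \<open>E\<close>. The spectrum is then
  contained in \<open>[0,\<infinity>)\<close>, so the values of \<open>powr\<close> at negative arguments are irrelevant.
\<close>

definition operator_power ::
    "(real set \<Rightarrow> ('a::euclidean_space \<Rightarrow> complex) \<Rightarrow> 'a \<Rightarrow> complex) \<Rightarrow>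
     real \<Rightarrow> 'a operator" where
  "operator_power E s = spectral_integral E (\<lambda>l. l powr s)"

definition differential_operator ::
    "(('a::euclidean_space \<Rightarrow> complex) \<Rightarrow> 'a \<Rightarrow> complex) \<Rightarrow> bool" where
  "differential_operator R \<longleftrightarrow>
     (\<exists>I a. finite I \<and> I \<subseteq> lists Basis \<and> (\<forall>\<alpha>\<in>I. smooth_on UNIV (a \<alpha>)) \<and>
        (\<forall>f. smooth_on UNIV f \<longrightarrow> R f = (\<lambda>x. \<Sum>\<alpha>\<in>I. a \<alpha> x * fold dir_deriv \<alpha> f x)))"

definition left_invariant ::
    "('a \<Rightarrow> 'a \<Rightarrow> 'a) \<Rightarrow> (('a::euclidean_space \<Rightarrow> complex) \<Rightarrow> 'a \<Rightarrow> complex) \<Rightarrow> bool" where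
  "left_invariant mul R \<longleftrightarrow>
     (\<forall>f g. smooth_on UNIV f \<longrightarrow> R (\<lambda>x. f (mul g x)) = (\<lambda>x. R f (mul g x)))"

definition homogeneous_of_degree ::
    "(nat \<Rightarrow> 'a::euclidean_space set) \<Rightarrow> real \<Rightarrow>
     (('a \<Rightarrow> complex) \<Rightarrow> 'a \<Rightarrow> complex) \<Rightarrow> bool" where
  "homogeneous_of_degree V \<nu> R \<longleftrightarrow>
     (\<forall>f. \<forall>r>0. smooth_on UNIV f \<longrightarrow>
        R (\<lambda>x. f (dilation V r x)) = (\<lambda>x. complex_of_real (r powr \<nu>) * R f (dilation V r x)))"

definition distribution ::
    "'a::euclidean_space set \<Rightarrow> (('a \<Rightarrow> complex) \<Rightarrow> complex) \<Rightarrow> bool" where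
  "distribution \<Omega> u \<longleftrightarrow>
     (\<forall>f\<in>test_functions \<Omega>. \<forall>g\<in>test_functions \<Omega>. u (\<lambda>x. f x + g x) = u f + u g) \<and>
     (\<forall>f\<in>test_functions \<Omega>. \<forall>c. u (\<lambda>x. c * f x) = c * u f) \<and>
     (\<forall>K. compact K \<longrightarrow> K \<subseteq> \<Omega> \<longrightarrow>
        (\<exists>C N. \<forall>f\<in>test_functions K.
           cmod (u f) \<le>
             C * (\<Sum>\<alpha> | set \<alpha> \<subseteq> Basis \<and> length \<alpha> \<le> N. SUP x. cmod (fold dir_deriv \<alpha> f x))))"

text \<open>The formal transpose, by which \<open>R\<close> acts on distributions: \<open>(R u)(f) = u (R\<^sup>t f)\<close>.\<close>

definition transpose_operator ::
    "(('a::euclidean_space \<Rightarrow> complex) \<Rightarrow> 'a \<Rightarrow> complex) \<Rightarrow> ('a \<Rightarrow> complex) \<Rightarrow> 'a \<Rightarrow> complex" where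
  "transpose_operator R f =
     (THE h. h \<in> test_functions UNIV \<and>
        (\<forall>g\<in>test_functions UNIV. (LINT x|lborel. R g x * f x) = (LINT x|lborel. g x * h x)))"

definition hypoelliptic ::
    "(('a::euclidean_space \<Rightarrow> complex) \<Rightarrow> 'a \<Rightarrow> complex) \<Rightarrow> bool" where
  "hypoelliptic R \<longleftrightarrow>
     (\<forall>\<Omega> u g. open \<Omega> \<longrightarrow> distribution \<Omega> u \<longrightarrow> smooth_on \<Omega> g \<longrightarrow>
        (\<forall>f\<in>test_functions \<Omega>. u (transpose_operator R f) = (LINT x|lborel. g x * f x)) \<longrightarrow>
        (\<exists>h. smooth_on \<Omega> h \<and> (\<forall>f\<in>test_functions \<Omega>. u f = (LINT x|lborel. h x * f x))))"

definition rockland_operator ::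
    "('a \<Rightarrow> 'a \<Rightarrow> 'a) \<Rightarrow> (nat \<Rightarrow> 'a::euclidean_space set) \<Rightarrow> real \<Rightarrow>
     (('a \<Rightarrow> complex) \<Rightarrow> 'a \<Rightarrow> complex) \<Rightarrow> bool" where
  "rockland_operator mul V \<nu> R \<longleftrightarrow>
     differential_operator R \<and> left_invariant mul R \<and> hypoelliptic R \<and>
     \<nu> > 0 \<and> homogeneous_of_degree V \<nu> R"

definition positive_operator ::
    "(('a::euclidean_space \<Rightarrow> complex) \<Rightarrow> 'a \<Rightarrow> complex) \<Rightarrow> bool" where
  "positive_operator R \<longleftrightarrow>
     (\<forall>f\<in>test_functions UNIV. Im (l2_inner (R f) f) = 0 \<and> Re (l2_inner (R f) f) \<ge> 0)"

definition self_adjoint_extension ::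
    "(('a::euclidean_space \<Rightarrow> complex) \<Rightarrow> 'a \<Rightarrow> complex) \<Rightarrow> 'a operator \<Rightarrow> bool" where
  "self_adjoint_extension R A \<longleftrightarrow>
     self_adjoint A \<and> (\<forall>f\<in>test_functions UNIV. (f, R f) \<in> A)"

text \<open>
  Below \<open>B\<close> stands for \<open>R\<^bsup>s/2\<^esup>\<close>, so that \<open>Domain B\<close> with \<open>sobolev_norm B\<close> is \<open>H\<^bsup>s\<nu>/2\<^esup>\<close>.
\<close>

definition sobolev_norm :: "'a::euclidean_space operator \<Rightarrow> ('a \<Rightarrow> complex) \<Rightarrow> real" where
  "sobolev_norm B f = l2_norm (op_apply B f) + l2_norm f"

definition continuous_wrt ::
    "(('a \<Rightarrow> complex) \<Rightarrow> real) \<Rightarrow> real set \<Rightarrow> (real \<Rightarrow> 'a \<Rightarrow> complex) \<Rightarrow> bool" where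
  "continuous_wrt N J u \<longleftrightarrow>
     (\<forall>t\<in>J. ((\<lambda>r. N (\<lambda>x. u r x - u t x)) \<longlongrightarrow> 0) (at t within J))"

definition has_l2_time_derivative ::
    "(real \<Rightarrow> 'a::euclidean_space \<Rightarrow> complex) \<Rightarrow> (real \<Rightarrow> 'a \<Rightarrow> complex) \<Rightarrow> real set \<Rightarrow> bool" where
  "has_l2_time_derivative u v J \<longleftrightarrow>
     (\<forall>t\<in>J. ((\<lambda>r. l2_norm (\<lambda>x. (u r x - u t x) / complex_of_real (r - t) - v t x)) \<longlongrightarrow> 0)
        (at t within J))"

text \<open>
  \<open>u \<in> C([0,T]; H\<^bsup>s\<nu>/2\<^esup>) \<inter> C\<^sup>1([0,T]; L\<^sup>2)\<close> with \<open>u\<^sub>t = v\<close>; the last clause is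
  \<open>d/dt (u\<^sub>t, \<phi>) + (B u, B \<phi>) + (m u, \<phi>) = 0\<close> tested against \<open>\<eta> \<in> C\<^sub>c\<^sup>\<infinity>(0,T)\<close>.
\<close>

definition weak_solution ::
    "'a::euclidean_space operator \<Rightarrow> real \<Rightarrow> ('a \<Rightarrow> real) \<Rightarrow> ('a \<Rightarrow> complex) \<Rightarrow>
     ('a \<Rightarrow> complex) \<Rightarrow> (real \<Rightarrow> 'a \<Rightarrow> complex) \<Rightarrow> bool" where
  "weak_solution B T m u0 u1 u \<longleftrightarrow>
     (\<forall>t\<in>{0..T}. u t \<in> Domain B) \<and> continuous_wrt (sobolev_norm B) {0..T} u \<and>
     (AE x in lborel. u 0 x = u0 x) \<and>
     (\<exists>v. (\<forall>t\<in>{0..T}. v t \<in> L2) \<and> continuous_wrt l2_norm {0..T} v \<and>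
          has_l2_time_derivative u v {0..T} \<and>
          (AE x in lborel. v 0 x = u1 x) \<and>
          (\<forall>\<phi>\<in>Domain B. \<forall>\<eta>\<in>test_functions {0<..<T}.
             integral {0..T} (\<lambda>t.
               - l2_inner (v t) \<phi> * vector_derivative \<eta> (at t) +
               (l2_inner (op_apply B (u t)) (op_apply B \<phi>) +
                l2_inner (\<lambda>x. complex_of_real (m x) * u t x) \<phi>) * \<eta> t) = 0))"

end

(*
Write w and z for the difference of u_eps and u and its time derivative, and B for the operator
R^(s/2). The proof is an energy estimate for w, whose right-hand side is small because m_eps tends
to m uniformly.

Since z need not lie in the domain of B, the weak equation is tested with P_n h only, where P_n is
the spectral projection of B onto |B| <= n. On the range of P_n everything is bounded, so that
|P_n z|^2 + |B P_n w|^2 is differentiable in time; its derivative is - 2 Re (F, P_n z) with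
F = m_eps u_eps - m u, and |F| <= M |w| + |m_eps - m| |u|. Letting n tend to infinity gives
|z(t)|^2 <= 2 int_0^t |F| |z|, and Gronwall's inequality concludes.

Uniform convergence of m_eps needs that Lebesgue measure is left invariant. In exponential
coordinates the cocycle identity
exp(-(s+h)X) exp((s+h)Y) = exp(-sX) (exp(-hX) exp(hY)) exp(sX) exp(-sX) exp(sY)
shows that the logarithmic derivative of exp at X is a mean of the unipotent maps Ad(exp(-iX/n)),
i < n, applied to the logarithmic derivative at X/n. So both have the same determinant, and the
latter tends to 1.
*)

theory Submission
  imports Defs
begin

section \<open>The semi-inner product space of square integrable functions\<close>

text \<open>\<open>L2\<close> is a set of functions with a seminorm, and \<open>E S\<close> is
  linear only up to null sets. Operator identities are therefore stated as equalities of inner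
  products with an arbitrary element, and \<open>l2_norm_leI\<close> recovers norm bounds from them.
  The values of B enter the weak equation through \<open>op_apply\<close>, an unspecified choice, so
  they are first replaced by bounded operators \<open>C n\<close>, the part of B on |B| <= n; the
  estimates then involve only \<open>P n\<close> and \<open>C n\<close>.

  The truncated equation only says that each scalar function (z, P_n h) has a weak time derivative.
  Two upgrades lead to the energy identity: a du Bois-Reymond argument makes this derivative
  classical, and an estimate uniform in h makes P_n z differentiable in the norm. The smooth bump in
  time needed by the first is the mollifier restricted to a line.

  Unipotent determinants are computed without triangular matrices: conjugation with dilations leaves
  the determinant unchanged and drives the map to the identity. Only absolute determinants
  occur.\<close>

lemma L2_borel [measurable_dest]: "f \<in> L2 \<Longrightarrow> f \<in> borel_measurable borel"
  by (simp add: L2_def)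

lemma borel_measurable_cnj [measurable]: "cnj \<in> borel_measurable borel"
  by (intro borel_measurable_continuous_onI continuous_intros)

lemma integrable_mult_cnj_L2:
  assumes "f \<in> L2" "g \<in> L2"
  shows "integrable lborel (\<lambda>x. f x * cnj (g x))"
proof (rule Bochner_Integration.integrable_bound)
  show "integrable lborel (\<lambda>x. (cmod (f x))\<^sup>2 + (cmod (g x))\<^sup>2)"
    using assms by (auto simp: L2_def)
  show "(\<lambda>x. f x * cnj (g x)) \<in> borel_measurable lborel"
    using assms[THEN L2_borel] by measurable
  have "a * b \<le> a\<^sup>2 + b\<^sup>2" for a b :: real
    using sum_squares_bound[of a b] zero_le_power2[of a] zero_le_power2[of b] by linarith
  then show "AE x in lborel. norm (f x * cnj (g x)) \<le> norm ((cmod (f x))\<^sup>2 + (cmod (g x))\<^sup>2)"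
    by (intro AE_I2) (auto simp: norm_mult)
qed

lemma L2_add:
  assumes "f \<in> L2" "g \<in> L2"
  shows "(\<lambda>x. f x + g x) \<in> L2"
proof -
  have "(cmod (f x + g x))\<^sup>2 \<le> 2 * (cmod (f x))\<^sup>2 + 2 * (cmod (g x))\<^sup>2" for x
  proof -
    have "(cmod (f x + g x))\<^sup>2 \<le> (cmod (f x) + cmod (g x))\<^sup>2"
      by (intro power_mono norm_triangle_ineq) auto
    also have "\<dots> \<le> 2 * (cmod (f x))\<^sup>2 + 2 * (cmod (g x))\<^sup>2"
      using sum_squares_bound[of "cmod (f x)" "cmod (g x)"] by (simp add: power2_sum)
    finally show ?thesis .
  qed
  moreover have "integrable lborel (\<lambda>x. 2 * (cmod (f x))\<^sup>2 + 2 * (cmod (g x))\<^sup>2)"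
    using assms by (auto simp: L2_def)
  ultimately have "integrable lborel (\<lambda>x. (cmod (f x + g x))\<^sup>2)"
    using assms[THEN L2_borel]
    by (intro Bochner_Integration.integrable_bound[OF \<open>integrable lborel (\<lambda>x. 2 * (cmod (f x))\<^sup>2 + 2 * (cmod (g x))\<^sup>2)\<close>]) auto
  then show ?thesis
    using assms by (auto simp: L2_def)
qed

lemma L2_cmult: "f \<in> L2 \<Longrightarrow> (\<lambda>x. c * f x) \<in> L2"
  by (auto simp: L2_def norm_mult power_mult_distrib)

lemma L2_divide: "f \<in> L2 \<Longrightarrow> (\<lambda>x. f x / c) \<in> L2"
  using L2_cmult[of f "1 / c"] by simp

lemma L2_diff: "f \<in> L2 \<Longrightarrow> g \<in> L2 \<Longrightarrow> (\<lambda>x. f x - g x) \<in> L2"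
  using L2_add[of f "\<lambda>x. (-1) * g x"] L2_cmult[of g "-1"] by simp

lemma L2_zero: "(\<lambda>x. 0) \<in> L2"
  by (simp add: L2_def)

lemma L2_sum: "finite I \<Longrightarrow> (\<And>i. i \<in> I \<Longrightarrow> f i \<in> L2) \<Longrightarrow> (\<lambda>x. \<Sum>i\<in>I. f i x) \<in> L2"
  by (induction I rule: finite_induct) (auto intro: L2_zero L2_add)

lemma L2_bounded_mult:
  fixes q :: "'a::euclidean_space \<Rightarrow> real"
  assumes f: "f \<in> L2" and q: "q \<in> borel_measurable borel" and b: "\<And>x. \<bar>q x\<bar> \<le> C"
  shows "(\<lambda>x. complex_of_real (q x) * f x) \<in> L2"
    and "l2_norm (\<lambda>x. complex_of_real (q x) * f x) \<le> C * l2_norm f"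
proof -
  have C: "0 \<le> C" using b[of 0] by linarith
  have le: "(cmod (complex_of_real (q x) * f x))\<^sup>2 \<le> C\<^sup>2 * (cmod (f x))\<^sup>2" for x
  proof -
    have "\<bar>q x\<bar>\<^sup>2 \<le> C\<^sup>2" by (intro power_mono b) simp
    then show ?thesis by (simp add: norm_mult power_mult_distrib mult_right_mono)
  qed
  have i: "integrable lborel (\<lambda>x. C\<^sup>2 * (cmod (f x))\<^sup>2)"
    using f by (auto simp: L2_def)
  have i': "integrable lborel (\<lambda>x. (cmod (complex_of_real (q x) * f x))\<^sup>2)"
  proof (rule Bochner_Integration.integrable_bound[OF i])
    show "(\<lambda>x. (cmod (complex_of_real (q x) * f x))\<^sup>2) \<in> borel_measurable lborel"
      using f[THEN L2_borel] q by measurable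
    show "AE x in lborel. norm ((cmod (complex_of_real (q x) * f x))\<^sup>2) \<le> norm (C\<^sup>2 * (cmod (f x))\<^sup>2)"
      using le by (intro AE_I2) auto
  qed
  show "(\<lambda>x. complex_of_real (q x) * f x) \<in> L2"
    using i' f[THEN L2_borel] q by (auto simp: L2_def)
  have "(LINT x|lborel. (cmod (complex_of_real (q x) * f x))\<^sup>2) \<le> (LINT x|lborel. C\<^sup>2 * (cmod (f x))\<^sup>2)"
    by (intro integral_mono i i' le)
  then show "l2_norm (\<lambda>x. complex_of_real (q x) * f x) \<le> C * l2_norm f"
    using C unfolding l2_norm_def by (intro real_le_lsqrt) (auto simp: power_mult_distrib)
qed

lemma l2_inner_add_left:
  "f \<in> L2 \<Longrightarrow> g \<in> L2 \<Longrightarrow> h \<in> L2 \<Longrightarrow> l2_inner (\<lambda>x. f x + g x) h = l2_inner f h + l2_inner g h"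
  by (simp add: l2_inner_def distrib_right integrable_mult_cnj_L2)

lemma l2_inner_diff_left:
  "f \<in> L2 \<Longrightarrow> g \<in> L2 \<Longrightarrow> h \<in> L2 \<Longrightarrow> l2_inner (\<lambda>x. f x - g x) h = l2_inner f h - l2_inner g h"
  by (simp add: l2_inner_def left_diff_distrib integrable_mult_cnj_L2)

lemma l2_inner_cmult_left: "l2_inner (\<lambda>x. c * f x) h = c * l2_inner f h"
  by (simp add: l2_inner_def mult.assoc)

lemma l2_inner_divide_left: "l2_inner (\<lambda>x. f x / c) h = l2_inner f h / c"
  using l2_inner_cmult_left[of "1 / c" f h] by simp

lemma l2_inner_commute: "l2_inner f g = cnj (l2_inner g f)"
  unfolding l2_inner_def by (subst Bochner_Integration.integral_cnj[symmetric]) (simp add: mult.commute)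

lemma l2_inner_add_right:
  "f \<in> L2 \<Longrightarrow> g \<in> L2 \<Longrightarrow> h \<in> L2 \<Longrightarrow> l2_inner h (\<lambda>x. f x + g x) = l2_inner h f + l2_inner h g"
  by (simp add: l2_inner_def distrib_left integrable_mult_cnj_L2)

lemma l2_inner_diff_right:
  "f \<in> L2 \<Longrightarrow> g \<in> L2 \<Longrightarrow> h \<in> L2 \<Longrightarrow> l2_inner h (\<lambda>x. f x - g x) = l2_inner h f - l2_inner h g"
  by (simp add: l2_inner_def right_diff_distrib integrable_mult_cnj_L2)

lemma l2_inner_cmult_right: "l2_inner h (\<lambda>x. c * f x) = cnj c * l2_inner h f"
  by (simp add: l2_inner_def mult.left_commute[of _ "cnj c"])

lemma l2_inner_sum_left:
  "finite I \<Longrightarrow> (\<And>i. i \<in> I \<Longrightarrow> f i \<in> L2) \<Longrightarrow> h \<in> L2 \<Longrightarrow>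
   l2_inner (\<lambda>x. \<Sum>i\<in>I. f i x) h = (\<Sum>i\<in>I. l2_inner (f i) h)"
  by (simp add: l2_inner_def sum_distrib_right integrable_mult_cnj_L2)

lemma l2_inner_sum_right:
  "finite I \<Longrightarrow> (\<And>i. i \<in> I \<Longrightarrow> f i \<in> L2) \<Longrightarrow> h \<in> L2 \<Longrightarrow>
   l2_inner h (\<lambda>x. \<Sum>i\<in>I. f i x) = (\<Sum>i\<in>I. l2_inner h (f i))"
  by (simp add: l2_inner_def sum_distrib_left integrable_mult_cnj_L2)

lemma l2_norm_nonneg: "0 \<le> l2_norm f"
  by (simp add: l2_norm_def)

lemma l2_inner_self: "l2_inner f f = complex_of_real ((l2_norm f)\<^sup>2)"
proof -
  have "f x * cnj (f x) = complex_of_real ((cmod (f x))\<^sup>2)" for x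
    by (simp only: complex_norm_square)
  then show ?thesis
    unfolding l2_inner_def l2_norm_def by (simp only: integral_complex_of_real) simp
qed

lemma l2_norm_square: "(l2_norm f)\<^sup>2 = Re (l2_inner f f)"
  by (simp add: l2_inner_self)

lemma l2_inner_cong_AE:
  assumes "AE x in lborel. f x = f' x" "AE x in lborel. g x = g' x"
    "f \<in> L2" "f' \<in> L2" "g \<in> L2" "g' \<in> L2"
  shows "l2_inner f g = l2_inner f' g'"
  unfolding l2_inner_def
  by (intro integral_cong_AE) (use assms assms(3-6)[THEN L2_borel] in \<open>auto intro!: borel_measurable_times\<close>)

lemma l2_norm_cong_AE:
  assumes "AE x in lborel. f x = f' x" "f \<in> L2" "f' \<in> L2"
  shows "l2_norm f = l2_norm f'"
  unfolding l2_norm_def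
  by (rule arg_cong[where f=sqrt], intro integral_cong_AE) (use assms assms(2-3)[THEN L2_borel] in auto)

lemma l2_norm_cmult: "l2_norm (\<lambda>x. c * f x) = cmod c * l2_norm f"
  by (simp add: l2_norm_def norm_mult power_mult_distrib real_sqrt_mult)

lemma l2_norm_divide: "l2_norm (\<lambda>x. f x / c) = l2_norm f / cmod c"
  using l2_norm_cmult[of "1/c" f] by (simp add: norm_divide)

lemma l2_norm_minus_commute: "l2_norm (\<lambda>x. f x - g x) = l2_norm (\<lambda>x. g x - f x)"
  by (simp add: l2_norm_def norm_minus_commute)

lemma l2_norm_zero: "l2_norm (\<lambda>x. 0) = 0"
  by (simp add: l2_norm_def)

lemma l2_norm_eq_0_iff:
  assumes "f \<in> L2"
  shows "l2_norm f = 0 \<longleftrightarrow> (AE x in lborel. f x = 0)"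
  unfolding l2_norm_def using assms
  by (subst real_sqrt_eq_0_iff, subst integral_nonneg_eq_0_iff_AE) (auto simp: L2_def)

lemma l2_Cauchy_Schwarz:
  assumes f: "f \<in> L2" and g: "g \<in> L2"
  shows "cmod (l2_inner f g) \<le> l2_norm f * l2_norm g"
proof (cases "l2_norm g = 0")
  case True
  then have "AE x in lborel. g x = 0" using l2_norm_eq_0_iff[OF g] by simp
  then have "l2_inner f g = l2_inner f (\<lambda>x. 0)"
    by (intro l2_inner_cong_AE f g L2_zero) auto
  then show ?thesis using True by (simp add: l2_inner_def)
next
  case False
  \<comment> \<open>\<open>c g\<close> is the orthogonal projection of \<open>f\<close> onto
    \<open>g\<close>; the squared norm of \<open>f - c g\<close> is the gap in the squared
    inequality, divided by the squared norm of \<open>g\<close>.\<close>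
  define c where "c = l2_inner f g / complex_of_real ((l2_norm g)\<^sup>2)"
  have cg: "(\<lambda>x. c * g x) \<in> L2" by (rule L2_cmult[OF g])
  have n: "c * complex_of_real ((l2_norm g)\<^sup>2) = l2_inner f g"
    using False by (simp add: c_def)
  have "l2_inner (\<lambda>x. f x - c * g x) (\<lambda>x. f x - c * g x)
      = l2_inner f f - c * l2_inner g f - cnj c * l2_inner f g + c * cnj c * l2_inner g g"
    using f g cg by (simp add: l2_inner_diff_left l2_inner_diff_right L2_diff l2_inner_cmult_left l2_inner_cmult_right algebra_simps)
  also have "\<dots> = l2_inner f f - cnj c * l2_inner f g"
    using n l2_inner_commute[of g f] by (simp add: l2_inner_self) (simp add: algebra_simps flip: n)
  also have "\<dots> = complex_of_real ((l2_norm f)\<^sup>2 - (cmod (l2_inner f g))\<^sup>2 / (l2_norm g)\<^sup>2)"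
    unfolding of_real_diff of_real_divide complex_norm_square by (simp add: l2_inner_self c_def mult.commute)
  finally have "0 \<le> (l2_norm f)\<^sup>2 - (cmod (l2_inner f g))\<^sup>2 / (l2_norm g)\<^sup>2"
    by (metis l2_inner_self of_real_eq_iff zero_le_power2)
  then have "(cmod (l2_inner f g))\<^sup>2 \<le> (l2_norm f * l2_norm g)\<^sup>2"
    using False by (simp add: field_simps power_mult_distrib)
  then show ?thesis
    by (rule power2_le_imp_le) (simp add: l2_norm_nonneg)
qed

lemma l2_norm_triangle:
  assumes f: "f \<in> L2" and g: "g \<in> L2"
  shows "l2_norm (\<lambda>x. f x + g x) \<le> l2_norm f + l2_norm g"
proof (rule power2_le_imp_le)
  have "(l2_norm (\<lambda>x. f x + g x))\<^sup>2 = (l2_norm f)\<^sup>2 + 2 * Re (l2_inner f g) + (l2_norm g)\<^sup>2"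
    using f g l2_inner_commute[of g f]
    by (simp add: l2_norm_square l2_inner_add_left l2_inner_add_right L2_add)
  also have "Re (l2_inner f g) \<le> l2_norm f * l2_norm g"
    using l2_Cauchy_Schwarz[OF f g] complex_Re_le_cmod order_trans by blast
  finally show "(l2_norm (\<lambda>x. f x + g x))\<^sup>2 \<le> (l2_norm f + l2_norm g)\<^sup>2"
    by (simp add: power2_sum)
qed (simp add: l2_norm_nonneg)

lemma l2_norm_diff_le:
  assumes "f \<in> L2" "g \<in> L2"
  shows "\<bar>l2_norm f - l2_norm g\<bar> \<le> l2_norm (\<lambda>x. f x - g x)"
proof -
  have "l2_norm (\<lambda>x. f x - g x + g x) \<le> l2_norm (\<lambda>x. f x - g x) + l2_norm g"
    by (intro l2_norm_triangle L2_diff assms)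
  moreover have "l2_norm (\<lambda>x. g x - f x + f x) \<le> l2_norm (\<lambda>x. g x - f x) + l2_norm f"
    by (intro l2_norm_triangle L2_diff assms)
  moreover have "l2_norm (\<lambda>x. g x - f x) = l2_norm (\<lambda>x. f x - g x)"
    by (rule l2_norm_minus_commute)
  ultimately show ?thesis by simp
qed

text \<open>Testing with \<open>h = q\<close> already suffices. For \<open>C n f\<close> and for the
  difference quotients in time, bounds are available only on inner products; this turns them into
  norm bounds.\<close>

lemma l2_norm_leI:
  assumes "q \<in> L2" "0 \<le> K" and "\<And>h. h \<in> L2 \<Longrightarrow> cmod (l2_inner q h) \<le> K * l2_norm h"
  shows "l2_norm q \<le> K"
proof (cases "l2_norm q = 0")
  case False
  have "(l2_norm q)\<^sup>2 \<le> K * l2_norm q"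
    using assms(3)[OF assms(1)] by (simp add: l2_inner_self norm_power)
  then show ?thesis
    using False l2_norm_nonneg[of q] by (simp add: power2_eq_square)
qed (use assms in simp)

text \<open>The difference is orthogonal to everything, itself included. This is the way back from
  identities of inner products to identities of functions.\<close>

lemma L2_weak_eq_AE:
  assumes "f \<in> L2" "g \<in> L2" and "\<And>h. h \<in> L2 \<Longrightarrow> l2_inner f h = l2_inner g h"
  shows "AE x in lborel. f x = g x"
proof -
  have "l2_norm (\<lambda>x. f x - g x) \<le> 0"
    by (rule l2_norm_leI) (use assms in \<open>auto simp: L2_diff l2_inner_diff_left\<close>)
  then have "l2_norm (\<lambda>x. f x - g x) = 0"
    by (intro antisym l2_norm_nonneg)
  then show ?thesis
    by (simp add: l2_norm_eq_0_iff[OF L2_diff[OF assms(1,2)]])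
qed

lemma tendsto_l2_inner_left:
  assumes f: "\<forall>\<^sub>F n in F. f n \<in> L2" and g: "g \<in> L2" and h: "h \<in> L2"
    and lim: "((\<lambda>n. l2_norm (\<lambda>x. f n x - g x)) \<longlongrightarrow> 0) F"
  shows "((\<lambda>n. l2_inner (f n) h) \<longlongrightarrow> l2_inner g h) F"
proof -
  have "((\<lambda>n. l2_norm (\<lambda>x. f n x - g x) * l2_norm h) \<longlongrightarrow> 0) F"
    using tendsto_mult_right[OF lim, of "l2_norm h"] by simp
  then have "((\<lambda>n. l2_inner (f n) h - l2_inner g h) \<longlongrightarrow> 0) F"
  proof (rule Lim_null_comparison[rotated])
    show "\<forall>\<^sub>F n in F. norm (l2_inner (f n) h - l2_inner g h) \<le> l2_norm (\<lambda>x. f n x - g x) * l2_norm h"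
      using f
    proof eventually_elim
      case (elim n)
      then show ?case
        using l2_Cauchy_Schwarz[OF L2_diff[OF elim g] h] by (simp add: l2_inner_diff_left g h)
    qed
  qed
  then show ?thesis by (simp add: LIM_zero_iff)
qed

lemma nn_integral_cmod_square:
  "f \<in> L2 \<Longrightarrow> (\<integral>\<^sup>+x. ennreal ((cmod (f x))\<^sup>2) \<partial>lborel) = ennreal ((l2_norm f)\<^sup>2)"
  by (subst nn_integral_eq_integral) (auto simp: L2_def l2_norm_def)

text \<open>A subsequence with \<open>\<parallel>f\<^sub>k\<^sub>+\<^sub>1 - f\<^sub>k\<parallel> \<le> 2\<^sup>-\<^sup>k\<close> converges almost everywhere, since
  \<open>\<Sum> 2\<^sup>k |f\<^sub>k\<^sub>+\<^sub>1 - f\<^sub>k|\<^sup>2\<close> is integrable; by Fatou's lemma its pointwise limit is the \<open>L\<^sup>2\<close> limit.\<close>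

lemma L2_complete:
  assumes f: "\<And>n::nat. f n \<in> L2"
    and cauchy: "\<And>e. 0 < e \<Longrightarrow> \<exists>N. \<forall>n\<ge>N. \<forall>m\<ge>N. l2_norm (\<lambda>x. f n x - f m x) < e"
  shows "\<exists>g\<in>L2. (\<lambda>n. l2_norm (\<lambda>x. f n x - g x)) \<longlonglongrightarrow> 0"
proof -
  have fm [measurable]: "f n \<in> borel_measurable borel" for n
    using f by (rule L2_borel)
  have "\<exists>N. \<forall>k. \<forall>n\<ge>N k. \<forall>m\<ge>N k. l2_norm (\<lambda>x. f n x - f m x) < (1/2)^k"
    by (intro choice allI cauchy) simp
  then obtain N where N: "\<And>k n m. n \<ge> N k \<Longrightarrow> m \<ge> N k \<Longrightarrow> l2_norm (\<lambda>x. f n x - f m x) < (1/2)^k"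
    by blast
  \<comment> \<open>The sum puts \<open>r k\<close> beyond \<open>N k\<close> and makes
    \<open>r\<close> monotone; the summand \<open>k\<close> makes it tend to infinity, which the
    bound on the limit superior below needs.\<close>
  define r where "r k = k + (\<Sum>i\<le>k. N i)" for k
  have rN: "N k \<le> r k" for k
    unfolding r_def by (rule trans_le_add2) (auto intro!: member_le_sum)
  have r1: "r k \<le> r (Suc k)" and rk: "k \<le> r k" for k
    unfolding r_def by auto
  define d where "d k x = f (r (Suc k)) x - f (r k) x" for k x
  have dm [measurable]: "d k \<in> borel_measurable borel" for k
    unfolding d_def by measurable
  have dL2: "d k \<in> L2" for k
    unfolding d_def by (intro L2_diff f)
  have dn: "l2_norm (d k) \<le> (1/2)^k" for k
    unfolding d_def using rN[of k] order_trans[OF rN[of k] r1[of k]] by (intro less_imp_le[OF N])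
  have term_le: "(\<integral>\<^sup>+x. ennreal (2^k * (cmod (d k x))\<^sup>2) \<partial>lborel) \<le> ennreal ((1/2)^k)" for k
  proof -
    have "(\<integral>\<^sup>+x. ennreal (2^k * (cmod (d k x))\<^sup>2) \<partial>lborel) = ennreal (2^k) * ennreal ((l2_norm (d k))\<^sup>2)"
      by (simp add: ennreal_mult nn_integral_cmult nn_integral_cmod_square[OF dL2])
    also have "\<dots> = ennreal (2^k * (l2_norm (d k))\<^sup>2)"
      by (simp add: ennreal_mult)
    also have "\<dots> \<le> ennreal (2^k * ((1/2)^k)\<^sup>2)"
      by (intro ennreal_leI mult_left_mono power_mono dn l2_norm_nonneg) auto
    also have "2^k * ((1/2)^k)\<^sup>2 = ((1/2)^k :: real)"
      by (simp add: power2_eq_square power_one_over field_simps)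
    finally show ?thesis .
  qed
  have "(\<integral>\<^sup>+x. (\<Sum>k. ennreal (2^k * (cmod (d k x))\<^sup>2)) \<partial>lborel)
      = (\<Sum>k. \<integral>\<^sup>+x. ennreal (2^k * (cmod (d k x))\<^sup>2) \<partial>lborel)"
    by (intro nn_integral_suminf) measurable
  also have "\<dots> \<le> (\<Sum>k. ennreal ((1/2)^k))"
    by (intro suminf_le term_le) auto
  also have "\<dots> = ennreal (\<Sum>k. (1/2)^k)"
    by (intro suminf_ennreal2) auto
  finally have "(\<integral>\<^sup>+x. (\<Sum>k. ennreal (2^k * (cmod (d k x))\<^sup>2)) \<partial>lborel) \<noteq> \<infinity>"
    by (auto simp: top_unique)
  then have "AE x in lborel. (\<Sum>k. ennreal (2^k * (cmod (d k x))\<^sup>2)) \<noteq> \<infinity>"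
    by (intro nn_integral_noteq_infinite) measurable
  moreover have "convergent (\<lambda>k. f (r k) x)" if fin: "(\<Sum>k. ennreal (2^k * (cmod (d k x))\<^sup>2)) \<noteq> \<infinity>" for x
  proof -
    have s: "summable (\<lambda>k. 2^k * (cmod (d k x))\<^sup>2)"
      by (rule summable_suminf_not_top) (use fin in auto)
    \<comment> \<open>Either the increment is at most 2^(-k), or \<open>2^k * cmod (d k x)\<close>
      is at least 1 and multiplying by it does not decrease the increment. Summability of the
      weighted squares thus gives absolute summability.\<close>
    have "cmod (d k x) \<le> (1/2)^k + 2^k * (cmod (d k x))\<^sup>2" for k
    proof (cases "cmod (d k x) \<le> (1/2)^k")
      case False
      then have "1 \<le> 2^k * cmod (d k x)"
        by (simp add: power_one_over field_simps)
      then have "cmod (d k x) * 1 \<le> cmod (d k x) * (2^k * cmod (d k x))"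
        by (intro mult_left_mono) auto
      then have "cmod (d k x) \<le> 2^k * (cmod (d k x))\<^sup>2"
        by (simp add: power2_eq_square mult_ac)
      moreover have "0 \<le> (1/2::real)^k" by simp
      ultimately show ?thesis by linarith
    qed (simp add: add_increasing2)
    moreover have "summable (\<lambda>k. (1/2)^k + 2^k * (cmod (d k x))\<^sup>2)"
      by (intro summable_add s summable_geometric) simp
    ultimately have "summable (\<lambda>k. d k x)"
      by (intro summable_comparison_test[of "\<lambda>k. d k x"]) auto
    then have "convergent (\<lambda>n. \<Sum>k<n. d k x)"
      by (rule summable_iff_convergent[THEN iffD1])
    moreover have "(\<Sum>k<n. d k x) = f (r n) x - f (r 0) x" for n
      unfolding d_def by (rule sum_lessThan_telescope)
    ultimately have "convergent (\<lambda>n. f (r n) x - f (r 0) x)" by simp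
    then show ?thesis
      using convergent_diff_const_right_iff by blast
  qed
  ultimately have conv: "AE x in lborel. (\<lambda>k. f (r k) x) \<longlonglongrightarrow> lim (\<lambda>k. f (r k) x)"
    by (auto simp: convergent_LIMSEQ_iff)
  \<comment> \<open>Where the subsequence diverges, \<open>lim\<close> is one fixed default value;
    this happens on a null set only and does not disturb measurability.\<close>
  define g where "g x = lim (\<lambda>k. f (r k) x)" for x
  have gm [measurable]: "g \<in> borel_measurable borel"
    unfolding g_def by measurable
  have key: "(\<lambda>x. f n x - g x) \<in> L2 \<and> l2_norm (\<lambda>x. f n x - g x) \<le> (1/2)^k" if nk: "n \<ge> N k" for n k
  proof -
    have "(\<integral>\<^sup>+x. ennreal ((cmod (f n x - g x))\<^sup>2) \<partial>lborel)
        = (\<integral>\<^sup>+x. liminf (\<lambda>j. ennreal ((cmod (f n x - f (r j) x))\<^sup>2)) \<partial>lborel)"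
    proof (rule nn_integral_cong_AE)
      show "AE x in lborel. ennreal ((cmod (f n x - g x))\<^sup>2) = liminf (\<lambda>j. ennreal ((cmod (f n x - f (r j) x))\<^sup>2))"
        using conv
      proof eventually_elim
        case (elim x)
        then have "(\<lambda>j. ennreal ((cmod (f n x - f (r j) x))\<^sup>2)) \<longlonglongrightarrow> ennreal ((cmod (f n x - g x))\<^sup>2)"
          unfolding g_def by (intro tendsto_intros tendsto_ennrealI)
        then show ?case
          by (intro lim_imp_Liminf[symmetric]) auto
      qed
    qed
    also have "\<dots> \<le> liminf (\<lambda>j. \<integral>\<^sup>+x. ennreal ((cmod (f n x - f (r j) x))\<^sup>2) \<partial>lborel)"
      by (intro nn_integral_liminf) measurable
    also have "\<dots> \<le> limsup (\<lambda>j. \<integral>\<^sup>+x. ennreal ((cmod (f n x - f (r j) x))\<^sup>2) \<partial>lborel)"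
      by (rule Liminf_le_Limsup) simp
    also have "\<dots> \<le> ennreal (((1/2)^k)\<^sup>2)"
    proof (rule Limsup_bounded)
      have "(\<integral>\<^sup>+x. ennreal ((cmod (f n x - f (r j) x))\<^sup>2) \<partial>lborel) \<le> ennreal (((1/2)^k)\<^sup>2)" if "j \<ge> N k" for j
        unfolding nn_integral_cmod_square[OF L2_diff[OF f f]]
        by (intro ennreal_leI power_mono less_imp_le[OF N] nk order_trans[OF that rk] l2_norm_nonneg)
      then show "\<forall>\<^sub>F j in sequentially. (\<integral>\<^sup>+x. ennreal ((cmod (f n x - f (r j) x))\<^sup>2) \<partial>lborel) \<le> ennreal (((1/2)^k)\<^sup>2)"
        by (auto simp: eventually_sequentially)
    qed
    finally have le: "(\<integral>\<^sup>+x. ennreal ((cmod (f n x - g x))\<^sup>2) \<partial>lborel) \<le> ennreal (((1/2)^k)\<^sup>2)" .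
    then have "integrable lborel (\<lambda>x. (cmod (f n x - g x))\<^sup>2)"
      by (intro integrableI_bounded) (auto simp: le_less_trans[OF _ ennreal_less_top])
    then have L: "(\<lambda>x. f n x - g x) \<in> L2"
      by (simp add: L2_def)
    have "(l2_norm (\<lambda>x. f n x - g x))\<^sup>2 \<le> ((1/2)^k)\<^sup>2"
      using le unfolding nn_integral_cmod_square[OF L] by (subst (asm) ennreal_le_iff) auto
    then have "l2_norm (\<lambda>x. f n x - g x) \<le> (1/2)^k"
      by (rule power2_le_imp_le) simp
    with L show ?thesis by blast
  qed
  have "g \<in> L2"
    using key[of 0 "N 0"] L2_diff[OF f[of "N 0"], of "\<lambda>x. f (N 0) x - g x"] by simp
  moreover have "(\<lambda>n. l2_norm (\<lambda>x. f n x - g x)) \<longlonglongrightarrow> 0"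
  proof (rule LIMSEQ_I)
    fix e :: real assume "0 < e"
    then obtain k where k: "(1/2::real)^k < e"
      using real_arch_pow_inv[of e "1/2"] by auto
    show "\<exists>no. \<forall>n\<ge>no. norm (l2_norm (\<lambda>x. f n x - g x) - 0) < e"
      using key[of k] k by (intro exI[of _ "N k"]) (auto simp: l2_norm_nonneg intro: le_less_trans)
  qed
  ultimately show ?thesis by blast
qed

section \<open>Spectral integrals\<close>

locale resolution_of_identity =
  fixes E :: "real set \<Rightarrow> ('a::euclidean_space \<Rightarrow> complex) \<Rightarrow> 'a \<Rightarrow> complex"
  assumes pvm: "projection_valued_measure E"
begin

lemma E_L2: "S \<in> sets borel \<Longrightarrow> f \<in> L2 \<Longrightarrow> E S f \<in> L2"
  using pvm by (simp add: projection_valued_measure_def)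

lemma E_sym: "S \<in> sets borel \<Longrightarrow> f \<in> L2 \<Longrightarrow> g \<in> L2 \<Longrightarrow> l2_inner (E S f) g = l2_inner f (E S g)"
  using pvm by (simp add: projection_valued_measure_def)

lemma E_mult: "S \<in> sets borel \<Longrightarrow> S' \<in> sets borel \<Longrightarrow> f \<in> L2 \<Longrightarrow> AE x in lborel. E S (E S' f) x = E (S \<inter> S') f x"
  using pvm by (simp add: projection_valued_measure_def)

lemma E_UNIV: "f \<in> L2 \<Longrightarrow> AE x in lborel. E UNIV f x = f x"
  using pvm by (simp add: projection_valued_measure_def)

lemma E_sums: "range S \<subseteq> sets borel \<Longrightarrow> disjoint_family S \<Longrightarrow> f \<in> L2 \<Longrightarrow>
   (\<lambda>n. l2_inner (E (S n) f) f) sums l2_inner (E (\<Union>n::nat. S n) f) f"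
  using pvm unfolding projection_valued_measure_def by blast

lemma E_E_inner:
  assumes "S \<in> sets borel" "S' \<in> sets borel" "f \<in> L2" "g \<in> L2"
  shows "l2_inner (E S (E S' f)) g = l2_inner (E (S \<inter> S') f) g"
  by (intro l2_inner_cong_AE E_mult) (use assms in \<open>auto intro: E_L2\<close>)

lemma E_inner_E:
  assumes "S \<in> sets borel" "S' \<in> sets borel" "f \<in> L2" "g \<in> L2"
  shows "l2_inner (E S f) (E S' g) = l2_inner (E (S \<inter> S') f) g"
  using E_sym[of S' "E S f" g] E_E_inner[of S' S f g] assms by (simp add: E_L2 Int_commute)

text \<open>\<open>E S\<close> is a symmetric idempotent. The set function in
  \<open>scalar_spectral_measure\<close> is built from real parts, and its positivity comes from
  here.\<close>

lemma E_inner_self: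
  assumes "S \<in> sets borel" "f \<in> L2"
  shows "l2_inner (E S f) f = complex_of_real ((l2_norm (E S f))\<^sup>2)"
  using E_inner_E[of S S f f] assms by (simp add: l2_inner_self)

lemma sets_scalar_spectral_measure [simp, measurable_cong]:
  "sets (scalar_spectral_measure E f) = sets borel"
  unfolding scalar_spectral_measure_def
  by (metis sets.sets_measure_of_eq space_borel)

lemma space_scalar_spectral_measure [simp]: "space (scalar_spectral_measure E f) = UNIV"
  using sets_eq_imp_space_eq[OF sets_scalar_spectral_measure] by simp

lemma emeasure_scalar_spectral_measure:
  assumes S: "S \<in> sets borel" and f: "f \<in> L2"
  shows "emeasure (scalar_spectral_measure E f) S = ennreal ((l2_norm (E S f))\<^sup>2)"
proof -
  have "emeasure (scalar_spectral_measure E f) S = ennreal (Re (l2_inner (E S f) f))"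
  proof (rule emeasure_measure_of[OF scalar_spectral_measure_def])
    \<comment> \<open>Countable additivity along the constant sequence of empty sets gives a
      convergent series with constant terms, so the term is 0.\<close>
    have "range (\<lambda>_::nat. {}::real set) \<subseteq> sets borel" by auto
    then have "(\<lambda>n::nat. l2_inner (E {} f) f) sums l2_inner (E {} f) f"
      using E_sums[OF _ _ f, of "\<lambda>_. {}"] by (simp add: disjoint_family_on_def)
    then have "summable (\<lambda>n::nat. l2_inner (E {} f) f)"
      by (rule sums_summable)
    then have "l2_inner (E {} f) f = 0"
      by (simp add: summable_const_iff)
    then show "positive (sets (scalar_spectral_measure E f)) (\<lambda>S. ennreal (Re (l2_inner (E S f) f)))"
      by (simp add: positive_def)
    show "countably_additive (sets (scalar_spectral_measure E f)) (\<lambda>S. ennreal (Re (l2_inner (E S f) f)))"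
    proof (rule countably_additiveI)
      fix A :: "nat \<Rightarrow> real set"
      assume A: "range A \<subseteq> sets (scalar_spectral_measure E f)" "disjoint_family A"
      have "(\<lambda>n. Re (l2_inner (E (A n) f) f)) sums Re (l2_inner (E (\<Union>n. A n) f) f)"
        by (intro sums_Re E_sums f) (use A in auto)
      moreover have "0 \<le> Re (l2_inner (E (A n) f) f)" for n
        using E_inner_self[OF _ f, of "A n"] A(1) by auto
      ultimately show "(\<Sum>i. ennreal (Re (l2_inner (E (A i) f) f))) = ennreal (Re (l2_inner (E (\<Union> (range A)) f) f))"
        by (intro suminf_ennreal_eq)
    qed
  qed (use S in auto)
  then show ?thesis
    by (simp add: E_inner_self[OF S f])
qed

lemma finite_measure_scalar_spectral_measure: "f \<in> L2 \<Longrightarrow> finite_measure (scalar_spectral_measure E f)"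
  by (rule finite_measureI) (simp add: emeasure_scalar_spectral_measure)

lemma measure_scalar_spectral_measure:
  "S \<in> sets borel \<Longrightarrow> f \<in> L2 \<Longrightarrow> measure (scalar_spectral_measure E f) S = (l2_norm (E S f))\<^sup>2"
  by (simp add: measure_def emeasure_scalar_spectral_measure)

lemma measure_scalar_spectral_measure_UNIV:
  assumes "f \<in> L2"
  shows "measure (scalar_spectral_measure E f) UNIV = (l2_norm f)\<^sup>2"
proof -
  have "l2_norm (E UNIV f) = l2_norm f"
    by (intro l2_norm_cong_AE E_UNIV E_L2 assms) simp
  then show ?thesis
    using assms by (simp add: measure_scalar_spectral_measure)
qed

text \<open>As \<open>E X (E S f)\<close> equals \<open>E (X \<inter> S) f\<close> almost
  everywhere, applying \<open>E S\<close> confines the spectral measure to \<open>S\<close>.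
  Integrals belonging to \<open>P n f\<close> can then be computed with the measure of
  \<open>f\<close>.\<close>

lemma scalar_spectral_measure_restrict:
  assumes S [measurable]: "S \<in> sets borel" and f: "f \<in> L2"
  shows "scalar_spectral_measure E (E S f) = density (scalar_spectral_measure E f) (indicator S)"
proof (rule measure_eqI)
  fix X assume "X \<in> sets (scalar_spectral_measure E (E S f))"
  then have X [measurable]: "X \<in> sets borel" by simp
  have Sf: "E S f \<in> L2" by (intro E_L2 S f)
  have "AE x in lborel. E X (E S f) x = E (X \<inter> S) f x"
    by (intro E_mult X S f)
  then have "l2_norm (E X (E S f)) = l2_norm (E (X \<inter> S) f)"
    by (rule l2_norm_cong_AE) (auto intro!: E_L2 f X S sets.Int)
  then have "emeasure (scalar_spectral_measure E (E S f)) X = emeasure (scalar_spectral_measure E f) (X \<inter> S)"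
    by (simp add: emeasure_scalar_spectral_measure Sf f)
  also have "\<dots> = (\<integral>\<^sup>+x. indicator (X \<inter> S) x \<partial>scalar_spectral_measure E f)"
    by (subst nn_integral_indicator) auto
  also have "\<dots> = (\<integral>\<^sup>+x. indicator S x * indicator X x \<partial>scalar_spectral_measure E f)"
    by (intro nn_integral_cong) (auto split: split_indicator)
  also have "\<dots> = emeasure (density (scalar_spectral_measure E f) (indicator S)) X"
    by (subst emeasure_density) auto
  finally show "emeasure (scalar_spectral_measure E (E S f)) X = emeasure (density (scalar_spectral_measure E f) (indicator S)) X" .
qed simp

abbreviation "SI \<equiv> simple_spectral_integral E"

lemma simple_function_vimage: "simple_function borel (\<sigma>::real \<Rightarrow> real) \<Longrightarrow> \<sigma> -` {y} \<in> sets borel"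
  using simple_functionD(2)[of borel \<sigma> "{y}"] by simp

lemma simple_function_range: "simple_function borel (\<sigma>::real \<Rightarrow> real) \<Longrightarrow> finite (range \<sigma>)"
  using simple_functionD(1)[of borel \<sigma>] by simp

lemma SI_L2: "simple_function borel \<sigma> \<Longrightarrow> f \<in> L2 \<Longrightarrow> SI \<sigma> f \<in> L2"
  unfolding simple_spectral_integral_def
  by (intro L2_sum L2_cmult E_L2 simple_function_range simple_function_vimage)

lemma SI_inner_left:
  assumes "simple_function borel \<sigma>" "f \<in> L2" "g \<in> L2"
  shows "l2_inner (SI \<sigma> f) g = (\<Sum>y\<in>range \<sigma>. complex_of_real y * l2_inner (E (\<sigma> -` {y}) f) g)"
  unfolding simple_spectral_integral_def
  by (subst l2_inner_sum_left)
     (auto simp: l2_inner_cmult_left assms intro!: simple_function_range L2_cmult E_L2 simple_function_vimage)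

lemma SI_inner_right:
  assumes "simple_function borel \<sigma>" "f \<in> L2" "g \<in> L2"
  shows "l2_inner f (SI \<sigma> g) = (\<Sum>y\<in>range \<sigma>. complex_of_real y * l2_inner f (E (\<sigma> -` {y}) g))"
  unfolding simple_spectral_integral_def
  by (subst l2_inner_sum_right)
     (auto simp: l2_inner_cmult_right assms intro!: simple_function_range L2_cmult E_L2 simple_function_vimage)

lemma SI_sym:
  assumes "simple_function borel \<sigma>" "f \<in> L2" "g \<in> L2"
  shows "l2_inner (SI \<sigma> f) g = l2_inner f (SI \<sigma> g)"
  unfolding SI_inner_left[OF assms] SI_inner_right[OF assms]
  using assms by (simp add: E_sym simple_function_vimage)

lemma simple_function_scalar:
  "simple_function borel \<sigma> \<Longrightarrow> simple_function (scalar_spectral_measure E f) \<sigma>"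
  by (subst simple_function_cong_algebra[where N=borel]) auto

lemma integrable_simple_function_scalar:
  assumes "simple_function borel (\<sigma>::real \<Rightarrow> real)" "f \<in> L2"
  shows "integrable (scalar_spectral_measure E f) \<sigma>"
proof -
  interpret finite_measure "scalar_spectral_measure E f"
    by (rule finite_measure_scalar_spectral_measure[OF assms(2)])
  show ?thesis
    by (intro integrable_simple_function simple_function_scalar assms) (simp add: emeasure_eq_measure)
qed

text \<open>The isometry of the functional calculus in polarised form. It rests on multiplicativity:
  \<open>E S f\<close> and \<open>E S' f\<close> have as inner product the spectral measure of the
  intersection of \<open>S\<close> and \<open>S'\<close>.\<close>

lemma SI_inner_SI:
  assumes s: "simple_function borel \<sigma>" and t: "simple_function borel \<tau>" and f: "f \<in> L2"
  shows "l2_inner (SI \<sigma> f) (SI \<tau> f) = complex_of_real (LINT l|scalar_spectral_measure E f. \<sigma> l * \<tau> l)"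
proof -
  interpret finite_measure "scalar_spectral_measure E f"
    by (rule finite_measure_scalar_spectral_measure[OF f])
  note fin = simple_function_range[OF s] simple_function_range[OF t]
  note [measurable] = simple_function_vimage[OF s] simple_function_vimage[OF t]
  define \<mu> where "\<mu> = measure (scalar_spectral_measure E f)"
  have "l2_inner (SI \<sigma> f) (SI \<tau> f)
      = (\<Sum>y\<in>range \<sigma>. \<Sum>z\<in>range \<tau>. complex_of_real y * (complex_of_real z * l2_inner (E (\<sigma> -` {y}) f) (E (\<tau> -` {z}) f)))"
    unfolding SI_inner_left[OF s f SI_L2[OF t f]]
    by (simp add: SI_inner_right[OF t _ f] f E_L2 sum_distrib_left)
  also have "\<dots> = (\<Sum>y\<in>range \<sigma>. \<Sum>z\<in>range \<tau>. complex_of_real (y * z * \<mu> (\<sigma> -` {y} \<inter> \<tau> -` {z})))"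
    by (simp add: E_inner_E f E_inner_self \<mu>_def measure_scalar_spectral_measure mult.assoc)
  also have "\<dots> = complex_of_real (\<Sum>y\<in>range \<sigma>. \<Sum>z\<in>range \<tau>. y * z * \<mu> (\<sigma> -` {y} \<inter> \<tau> -` {z}))"
    by simp
  also have "(\<Sum>y\<in>range \<sigma>. \<Sum>z\<in>range \<tau>. y * z * \<mu> (\<sigma> -` {y} \<inter> \<tau> -` {z}))
      = (LINT l|scalar_spectral_measure E f. (\<Sum>y\<in>range \<sigma>. \<Sum>z\<in>range \<tau>. y * z * indicator (\<sigma> -` {y} \<inter> \<tau> -` {z}) l))"
    by (simp add: \<mu>_def emeasure_eq_measure)
  also have "(\<lambda>l. \<Sum>y\<in>range \<sigma>. \<Sum>z\<in>range \<tau>. y * z * indicator (\<sigma> -` {y} \<inter> \<tau> -` {z}) l) = (\<lambda>l. \<sigma> l * \<tau> l)"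
  proof
    fix l
    \<comment> \<open>Exactly one pair of level sets contains \<open>l\<close>, so a single term of
      the double sum survives.\<close>
    have "(\<Sum>y\<in>range \<sigma>. \<Sum>z\<in>range \<tau>. y * z * indicator (\<sigma> -` {y} \<inter> \<tau> -` {z}) l)
        = (\<Sum>y\<in>range \<sigma>. if y = \<sigma> l then (\<Sum>z\<in>range \<tau>. if z = \<tau> l then y * z else 0) else 0)"
      by (intro sum.cong refl) (auto simp: indicator_def intro!: sum.cong sum.neutral)
    also have "\<dots> = \<sigma> l * \<tau> l"
      using fin by simp
    finally show "(\<Sum>y\<in>range \<sigma>. \<Sum>z\<in>range \<tau>. y * z * indicator (\<sigma> -` {y} \<inter> \<tau> -` {z}) l) = \<sigma> l * \<tau> l" .
  qed
  finally show ?thesis .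
qed

lemma SI_diff_norm:
  assumes s: "simple_function borel \<sigma>" and t: "simple_function borel \<tau>" and f: "f \<in> L2"
  shows "(l2_norm (\<lambda>x. SI \<sigma> f x - SI \<tau> f x))\<^sup>2 = (LINT l|scalar_spectral_measure E f. (\<sigma> l - \<tau> l)\<^sup>2)"
proof -
  have i: "integrable (scalar_spectral_measure E f) (\<lambda>l. \<sigma> l * \<sigma> l)"
    "integrable (scalar_spectral_measure E f) (\<lambda>l. \<sigma> l * \<tau> l)"
    "integrable (scalar_spectral_measure E f) (\<lambda>l. \<tau> l * \<tau> l)"
    by (intro integrable_simple_function_scalar simple_function_mult s t f)+
  have L: "SI \<sigma> f \<in> L2" "SI \<tau> f \<in> L2"
    by (intro SI_L2 s t f)+
  have "(l2_norm (\<lambda>x. SI \<sigma> f x - SI \<tau> f x))\<^sup>2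
     = Re (l2_inner (SI \<sigma> f) (SI \<sigma> f) - l2_inner (SI \<sigma> f) (SI \<tau> f) - (l2_inner (SI \<tau> f) (SI \<sigma> f) - l2_inner (SI \<tau> f) (SI \<tau> f)))"
    unfolding l2_norm_square using L by (simp add: l2_inner_diff_left l2_inner_diff_right L2_diff)
  also have "\<dots> = (LINT l|scalar_spectral_measure E f. \<sigma> l * \<sigma> l) - 2 * (LINT l|scalar_spectral_measure E f. \<sigma> l * \<tau> l)
      + (LINT l|scalar_spectral_measure E f. \<tau> l * \<tau> l)"
    by (simp add: SI_inner_SI s t f mult.commute)
  also have "\<dots> = (LINT l|scalar_spectral_measure E f. \<sigma> l * \<sigma> l - 2 * (\<sigma> l * \<tau> l) + \<tau> l * \<tau> l)"
    using i by simp
  also have "\<dots> = (LINT l|scalar_spectral_measure E f. (\<sigma> l - \<tau> l)\<^sup>2)"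
    by (intro Bochner_Integration.integral_cong refl) (simp add: power2_eq_square algebra_simps)
  finally show ?thesis .
qed

lemma SI_diff_norm_nn:
  assumes s: "simple_function borel \<sigma>" and t: "simple_function borel \<tau>" and f: "f \<in> L2"
  shows "ennreal ((l2_norm (\<lambda>x. SI \<sigma> f x - SI \<tau> f x))\<^sup>2) = (\<integral>\<^sup>+ l. ennreal ((\<sigma> l - \<tau> l)\<^sup>2) \<partial>scalar_spectral_measure E f)"
  unfolding SI_diff_norm[OF assms]
  by (subst nn_integral_eq_integral)
     (auto simp: power2_eq_square intro!: integrable_simple_function_scalar simple_function_mult simple_function_diff s t f)

text \<open>All projections of one resolution commute because intersection does. The identity stays
  inside an inner product since the functions agree only almost everywhere.\<close>

lemma SI_E_commute_inner:
  assumes s: "simple_function borel \<sigma>" and S: "S \<in> sets borel" and f: "f \<in> L2" and h: "h \<in> L2"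
  shows "l2_inner (SI \<sigma> f) (E S h) = l2_inner (SI \<sigma> (E S f)) h"
  using s S f h
  by (simp add: SI_inner_left E_L2 E_inner_E E_E_inner simple_function_vimage)

end

text \<open>A symmetric operator on all of \<open>L\<^sup>2\<close> is linear up to null sets.\<close>

lemma symmetric_difference_quotient:
  assumes L: "\<And>f. f \<in> L2 \<Longrightarrow> S f \<in> L2"
    and sym: "\<And>f g. f \<in> L2 \<Longrightarrow> g \<in> L2 \<Longrightarrow> l2_inner (S f) g = l2_inner f (S g)"
    and "f \<in> L2" "g \<in> L2" "h \<in> L2"
  shows "AE x in lborel. S (\<lambda>x. (f x - g x) / c - h x) x = (S f x - S g x) / c - S h x"
  by (rule L2_weak_eq_AE)
     (use assms in \<open>simp_all add: L2_diff L2_divide l2_inner_diff_left l2_inner_divide_left\<close>)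

section \<open>Bounded truncations of a spectral integral\<close>

locale spectral_truncation = resolution_of_identity E
  for E :: "real set \<Rightarrow> ('a::euclidean_space \<Rightarrow> complex) \<Rightarrow> 'a \<Rightarrow> complex" +
  fixes \<phi> :: "real \<Rightarrow> real"
  assumes phi_borel [measurable]: "\<phi> \<in> borel_measurable borel"
begin

definition cut :: "nat \<Rightarrow> real set" where
  "cut n = {l. \<bar>\<phi> l\<bar> \<le> real n}"

definition P :: "nat \<Rightarrow> ('a \<Rightarrow> complex) \<Rightarrow> 'a \<Rightarrow> complex" where
  "P n = E (cut n)"

text \<open>Rounds \<phi> down to the grid of mesh 1/(j+1) on the cut. Since \<phi> is bounded
  there, the error is uniform and only finitely many values occur. \<open>Suc j\<close> keeps the
  mesh defined at j = 0.\<close>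

definition step :: "nat \<Rightarrow> nat \<Rightarrow> real \<Rightarrow> real" where
  "step n j l = (if l \<in> cut n then real_of_int \<lfloor>real (Suc j) * \<phi> l\<rfloor> / real (Suc j) else 0)"

text \<open>The bounded operator \<open>\<integral>\<^bsub>|\<phi>| \<le> n\<^esub> \<phi> dE\<close>.\<close>

definition C :: "nat \<Rightarrow> ('a \<Rightarrow> complex) \<Rightarrow> 'a \<Rightarrow> complex" where
  "C n f = (SOME g. g \<in> L2 \<and> (\<lambda>j. l2_norm (\<lambda>x. SI (step n j) f x - g x)) \<longlonglongrightarrow> 0)"

lemma cut_borel [measurable]: "cut n \<in> sets borel"
  unfolding cut_def by measurable

lemma step_error: "l \<in> cut n \<Longrightarrow> \<bar>\<phi> l - step n j l\<bar> \<le> 1 / real (Suc j)"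
proof -
  assume l: "l \<in> cut n"
  have "\<phi> l - step n j l = (real (Suc j) * \<phi> l - real_of_int \<lfloor>real (Suc j) * \<phi> l\<rfloor>) / real (Suc j)"
    using l by (simp add: step_def field_simps)
  moreover have "\<bar>real (Suc j) * \<phi> l - real_of_int \<lfloor>real (Suc j) * \<phi> l\<rfloor>\<bar> \<le> 1"
    by linarith
  ultimately show ?thesis
    by (simp only: abs_divide) (simp add: divide_right_mono)
qed

text \<open>\<open>n\<close> comes from the cut and 1 from the rounding error. This is the origin of
  the norm bound n + 1 for \<open>C n\<close>.\<close>

lemma step_bound: "\<bar>step n j l\<bar> \<le> real n + 1"
proof (cases "l \<in> cut n")
  case True
  have "1 / real (Suc j) \<le> 1" by simp
  then show ?thesis
    using step_error[OF True, of j] True unfolding cut_def mem_Collect_eq by linarith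
qed (simp add: step_def)

lemma step_simple: "simple_function borel (step n j)"
proof (rule simple_function_borel_measurable)
  show "step n j \<in> borel_measurable borel"
    unfolding step_def by measurable
  define K :: int where "K = (int n + 1) * int (Suc j)"
  have "range (step n j) \<subseteq> insert 0 ((\<lambda>k::int. real_of_int k / real (Suc j)) ` {-K..K})"
  proof
    fix y assume "y \<in> range (step n j)"
    then obtain l where l: "y = step n j l" by blast
    show "y \<in> insert 0 ((\<lambda>k::int. real_of_int k / real (Suc j)) ` {-K..K})"
    proof (cases "l \<in> cut n")
      case True
      define k where "k = \<lfloor>real (Suc j) * \<phi> l\<rfloor>"
      have y: "y = real_of_int k / real (Suc j)"
        using True l by (simp add: step_def k_def)
      have "\<bar>real_of_int k\<bar> / real (Suc j) \<le> real n + 1"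
        using step_bound[of n j l] unfolding l[symmetric] y by (simp add: abs_divide)
      then have "\<bar>real_of_int k\<bar> \<le> (real n + 1) * real (Suc j)"
        by (simp add: pos_divide_le_eq)
      also have "\<dots> = real_of_int K"
        by (simp add: K_def)
      finally have "k \<in> {-K..K}" by auto
      then show ?thesis using y by blast
    qed (use l in \<open>simp add: step_def\<close>)
  qed
  then show "finite (step n j ` space borel)"
    by (simp add: finite_subset)
qed

lemma P_L2: "f \<in> L2 \<Longrightarrow> P n f \<in> L2"
  unfolding P_def by (intro E_L2 cut_borel)

lemma P_sym: "f \<in> L2 \<Longrightarrow> g \<in> L2 \<Longrightarrow> l2_inner (P n f) g = l2_inner f (P n g)"
  unfolding P_def by (intro E_sym cut_borel)

lemma P_P_inner: "f \<in> L2 \<Longrightarrow> g \<in> L2 \<Longrightarrow> l2_inner (P n (P n f)) g = l2_inner (P n f) g"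
  unfolding P_def by (simp add: E_E_inner)

lemma P_norm_le:
  assumes f: "f \<in> L2"
  shows "l2_norm (P n f) \<le> l2_norm f"
proof -
  have "(l2_norm (P n f))\<^sup>2 = measure (scalar_spectral_measure E f) (cut n)"
    unfolding P_def by (simp add: measure_scalar_spectral_measure f)
  also have "\<dots> \<le> measure (scalar_spectral_measure E f) UNIV"
  proof -
    interpret finite_measure "scalar_spectral_measure E f"
      by (rule finite_measure_scalar_spectral_measure[OF f])
    show ?thesis by (intro finite_measure_mono) auto
  qed
  also have "\<dots> = (l2_norm f)\<^sup>2"
    by (rule measure_scalar_spectral_measure_UNIV[OF f])
  finally show ?thesis
    by (rule power2_le_imp_le) (rule l2_norm_nonneg)
qed

text \<open>The spectral measure of \<open>f\<close> is finite and the cuts increase to the whole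
  line, so this is continuity from below. It removes the truncation at the end of the energy
  estimate.\<close>

lemma P_norm_tendsto:
  assumes f: "f \<in> L2"
  shows "(\<lambda>n. (l2_norm (P n f))\<^sup>2) \<longlonglongrightarrow> (l2_norm f)\<^sup>2"
proof -
  interpret finite_measure "scalar_spectral_measure E f"
    by (rule finite_measure_scalar_spectral_measure[OF f])
  have "(\<lambda>n. measure (scalar_spectral_measure E f) (cut n)) \<longlonglongrightarrow> measure (scalar_spectral_measure E f) (\<Union>n. cut n)"
    by (rule finite_Lim_measure_incseq) (auto simp: cut_def incseq_def)
  moreover have "(\<Union>n. cut n) = UNIV"
    by (auto simp: cut_def intro: real_arch_simple)
  ultimately show ?thesis
    unfolding P_def using measure_scalar_spectral_measure_UNIV[OF f]
    by (simp only: measure_scalar_spectral_measure[OF cut_borel f])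
qed

lemma SI_step_norm_le:
  assumes f: "f \<in> L2"
  shows "l2_norm (SI (step n j) f) \<le> (real n + 1) * l2_norm f"
proof -
  interpret finite_measure "scalar_spectral_measure E f"
    by (rule finite_measure_scalar_spectral_measure[OF f])
  have "(l2_norm (SI (step n j) f))\<^sup>2 = (LINT l|scalar_spectral_measure E f. step n j l * step n j l)"
    unfolding l2_norm_square by (simp add: SI_inner_SI step_simple f)
  also have "\<dots> \<le> (LINT l|scalar_spectral_measure E f. (real n + 1)\<^sup>2)"
  proof (intro integral_mono)
    show "step n j l * step n j l \<le> (real n + 1)\<^sup>2" for l
      using power_mono[OF step_bound[of n j l] abs_ge_zero, of 2] by (simp add: power2_eq_square)
  qed (auto intro!: integrable_simple_function_scalar simple_function_mult step_simple f)
  also have "\<dots> = ((real n + 1) * l2_norm f)\<^sup>2"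
    by (simp add: measure_scalar_spectral_measure_UNIV f power_mult_distrib)
  finally show ?thesis
    by (rule power2_le_imp_le) (simp add: l2_norm_nonneg)
qed

lemma SI_step_diff_le:
  assumes f: "f \<in> L2"
  shows "l2_norm (\<lambda>x. SI (step n j) f x - SI (step n k) f x) \<le> (1 / real (Suc j) + 1 / real (Suc k)) * l2_norm f"
proof -
  interpret finite_measure "scalar_spectral_measure E f"
    by (rule finite_measure_scalar_spectral_measure[OF f])
  have "(l2_norm (\<lambda>x. SI (step n j) f x - SI (step n k) f x))\<^sup>2
      = (LINT l|scalar_spectral_measure E f. (step n j l - step n k l)\<^sup>2)"
    by (simp add: SI_diff_norm step_simple f)
  also have "\<dots> \<le> (LINT l|scalar_spectral_measure E f. (1 / real (Suc j) + 1 / real (Suc k))\<^sup>2)"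
  proof (intro integral_mono)
    show "(step n j l - step n k l)\<^sup>2 \<le> (1 / real (Suc j) + 1 / real (Suc k))\<^sup>2" for l
    proof -
      have "\<bar>step n j l - step n k l\<bar> \<le> 1 / real (Suc j) + 1 / real (Suc k)"
      proof (cases "l \<in> cut n")
        case True
        then show ?thesis
          using step_error[OF True, of j] step_error[OF True, of k] by linarith
      qed (simp add: step_def)
      from power_mono[OF this abs_ge_zero, of 2] show ?thesis by simp
    qed
    show "integrable (scalar_spectral_measure E f) (\<lambda>l. (step n j l - step n k l)\<^sup>2)"
      unfolding power2_eq_square
      by (intro integrable_simple_function_scalar simple_function_mult simple_function_diff step_simple f)
  qed auto
  also have "\<dots> = ((1 / real (Suc j) + 1 / real (Suc k)) * l2_norm f)\<^sup>2"
    by (simp add: measure_scalar_spectral_measure_UNIV f power_mult_distrib)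
  finally show ?thesis
    by (rule power2_le_imp_le) (simp add: l2_norm_nonneg)
qed

text \<open>The step functions are uniformly Cauchy, hence so are their spectral integrals at
  \<open>f\<close>, and \<open>L2_complete\<close> yields a limit. This justifies the choice in the
  definition of \<open>C\<close>; any two candidates differ on a null set only.\<close>

lemma C_limit:
  assumes f: "f \<in> L2"
  shows "C n f \<in> L2 \<and> (\<lambda>j. l2_norm (\<lambda>x. SI (step n j) f x - C n f x)) \<longlonglongrightarrow> 0"
proof -
  have "\<exists>g\<in>L2. (\<lambda>j. l2_norm (\<lambda>x. SI (step n j) f x - g x)) \<longlonglongrightarrow> 0"
  proof (rule L2_complete[of "\<lambda>j. SI (step n j) f"])
    show "SI (step n j) f \<in> L2" for j
      by (intro SI_L2 step_simple f)
    fix e :: real assume e: "0 < e"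
    have "(\<lambda>N. 2 / real (Suc N) * l2_norm f) \<longlonglongrightarrow> 2 * 0 * l2_norm f"
      using tendsto_mult[OF tendsto_mult[OF tendsto_const LIMSEQ_inverse_real_of_nat] tendsto_const, of 2 "l2_norm f"]
      by (simp add: divide_inverse)
    then have "\<forall>\<^sub>F N in sequentially. 2 / real (Suc N) * l2_norm f < e"
      by (rule order_tendstoD) (use e in simp)
    then obtain N where N: "2 / real (Suc N) * l2_norm f < e"
      unfolding eventually_sequentially by blast
    show "\<exists>N. \<forall>j\<ge>N. \<forall>k\<ge>N. l2_norm (\<lambda>x. SI (step n j) f x - SI (step n k) f x) < e"
    proof (intro exI[of _ N] allI impI)
      fix j k assume jk: "N \<le> j" "N \<le> k"
      have "1 / real (Suc j) \<le> 1 / real (Suc N)" "1 / real (Suc k) \<le> 1 / real (Suc N)"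
        using jk by (auto intro!: divide_left_mono)
      then have "1 / real (Suc j) + 1 / real (Suc k) \<le> 2 / real (Suc N)"
        by linarith
      then have "(1 / real (Suc j) + 1 / real (Suc k)) * l2_norm f \<le> 2 / real (Suc N) * l2_norm f"
        by (intro mult_right_mono l2_norm_nonneg)
      with SI_step_diff_le[OF f, of n j k] N
      show "l2_norm (\<lambda>x. SI (step n j) f x - SI (step n k) f x) < e" by linarith
    qed
  qed
  then have "\<exists>g. g \<in> L2 \<and> (\<lambda>j. l2_norm (\<lambda>x. SI (step n j) f x - g x)) \<longlonglongrightarrow> 0"
    by blast
  from someI_ex[OF this] show ?thesis
    unfolding C_def .
qed

lemma C_L2: "f \<in> L2 \<Longrightarrow> C n f \<in> L2"
  using C_limit by blast

lemma C_inner_limit: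
  assumes "f \<in> L2" "h \<in> L2"
  shows "(\<lambda>j. l2_inner (SI (step n j) f) h) \<longlonglongrightarrow> l2_inner (C n f) h"
  by (rule tendsto_l2_inner_left) (use assms C_limit in \<open>auto intro: always_eventually SI_L2 step_simple\<close>)

lemma C_sym:
  assumes f: "f \<in> L2" and g: "g \<in> L2"
  shows "l2_inner (C n f) g = l2_inner f (C n g)"
proof -
  have "(\<lambda>j. cnj (l2_inner (SI (step n j) g) f)) \<longlonglongrightarrow> cnj (l2_inner (C n g) f)"
    by (intro tendsto_cnj C_inner_limit f g)
  then have "(\<lambda>j. l2_inner (SI (step n j) f) g) \<longlonglongrightarrow> l2_inner f (C n g)"
    by (simp add: SI_sym step_simple f g flip: l2_inner_commute)
  then show ?thesis
    using C_inner_limit[OF f g] LIMSEQ_unique by blast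
qed

lemma C_norm_le:
  assumes f: "f \<in> L2"
  shows "l2_norm (C n f) \<le> (real n + 1) * l2_norm f"
proof (rule l2_norm_leI)
  fix h :: "'a \<Rightarrow> complex" assume h: "h \<in> L2"
  show "cmod (l2_inner (C n f) h) \<le> (real n + 1) * l2_norm f * l2_norm h"
  proof (rule tendsto_upperbound[OF tendsto_norm[OF C_inner_limit[OF f h]]])
    have "norm (l2_inner (SI (step n j) f) h) \<le> (real n + 1) * l2_norm f * l2_norm h" for j
      using l2_Cauchy_Schwarz[OF SI_L2[OF step_simple f] h, of n j]
        mult_right_mono[OF SI_step_norm_le[OF f, of n j] l2_norm_nonneg[of h]] by linarith
    then show "\<forall>\<^sub>F j in sequentially. norm (l2_inner (SI (step n j) f) h) \<le> (real n + 1) * l2_norm f * l2_norm h"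
      by simp
  qed simp
qed (auto simp: C_L2 f l2_norm_nonneg)

text \<open>A level set of \<open>step n j\<close> for a nonzero value lies inside the cut, so
  intersecting it with the cut changes nothing; the value 0 contributes nothing on either
  side.\<close>

lemma SI_step_P:
  assumes f: "f \<in> L2"
  shows "AE x in lborel. SI (step n j) (P n f) x = SI (step n j) f x"
proof -
  have "AE x in lborel. \<forall>y\<in>range (step n j). complex_of_real y * E (step n j -` {y}) (P n f) x
      = complex_of_real y * E (step n j -` {y}) f x"
  proof (rule AE_finite_allI[OF simple_function_range[OF step_simple]])
    fix y
    show "AE x in lborel. complex_of_real y * E (step n j -` {y}) (P n f) x
      = complex_of_real y * E (step n j -` {y}) f x"
    proof (cases "y = 0")
      case False
      then have "step n j -` {y} \<inter> cut n = step n j -` {y}"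
        by (auto simp: step_def split: if_splits)
      then show ?thesis
        using E_mult[OF simple_function_vimage[OF step_simple, of n j y] cut_borel f, of n]
        unfolding P_def by auto
    qed simp
  qed
  then show ?thesis
    unfolding simple_spectral_integral_def by eventually_elim (auto intro!: sum.cong)
qed

lemma C_P_inner:
  assumes f: "f \<in> L2" and h: "h \<in> L2"
  shows "l2_inner (C n (P n f)) h = l2_inner (C n f) h"
proof -
  have "l2_inner (SI (step n j) (P n f)) h = l2_inner (SI (step n j) f) h" for j
    by (intro l2_inner_cong_AE SI_step_P SI_L2 step_simple P_L2 f h) simp
  then have "(\<lambda>j. l2_inner (SI (step n j) f) h) \<longlonglongrightarrow> l2_inner (C n (P n f)) h"
    using C_inner_limit[OF P_L2[OF f] h, of n n] by simp
  then show ?thesis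
    using C_inner_limit[OF f h] LIMSEQ_unique by blast
qed

lemma P_C_inner:
  assumes f: "f \<in> L2" and h: "h \<in> L2"
  shows "l2_inner (P n (C n f)) h = l2_inner (C n f) h"
proof -
  have "l2_inner (P n (C n f)) h = l2_inner f (C n (P n h))"
    by (simp add: P_sym C_sym C_L2 P_L2 f h)
  also have "\<dots> = l2_inner f (C n h)"
    using C_P_inner[OF h f, of n] l2_inner_commute by metis
  finally show ?thesis
    by (simp add: C_sym f h)
qed

text \<open>On the range of \<open>P n\<close> the step functions converge to \<open>\<phi>\<close> uniformly with respect to \<open>E\<close>.\<close>

lemma nn_integral_truncated:
  assumes f: "f \<in> L2" and g [measurable]: "g \<in> borel_measurable borel"
  shows "(\<integral>\<^sup>+ l. g l \<partial>scalar_spectral_measure E (P n f)) = (\<integral>\<^sup>+ l. indicator (cut n) l * g l \<partial>scalar_spectral_measure E f)"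
  unfolding P_def scalar_spectral_measure_restrict[OF cut_borel f]
  by (subst nn_integral_density) auto

lemma nn_integral_step_error:
  assumes f: "f \<in> L2"
  shows "(\<integral>\<^sup>+ l. ennreal ((\<phi> l - step n j l)\<^sup>2) \<partial>scalar_spectral_measure E (P n f)) \<le> ennreal ((1 / real (Suc j))\<^sup>2 * (l2_norm f)\<^sup>2)"
proof -
  interpret finite_measure "scalar_spectral_measure E f"
    by (rule finite_measure_scalar_spectral_measure[OF f])
  have [measurable]: "step n j \<in> borel_measurable borel"
    using borel_measurable_simple_function[OF step_simple] .
  have "(\<integral>\<^sup>+ l. ennreal ((\<phi> l - step n j l)\<^sup>2) \<partial>scalar_spectral_measure E (P n f))
     = (\<integral>\<^sup>+ l. indicator (cut n) l * ennreal ((\<phi> l - step n j l)\<^sup>2) \<partial>scalar_spectral_measure E f)"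
    by (intro nn_integral_truncated f) measurable
  also have "\<dots> \<le> (\<integral>\<^sup>+ l. ennreal ((1 / real (Suc j))\<^sup>2) \<partial>scalar_spectral_measure E f)"
  proof (intro nn_integral_mono)
    fix l
    show "indicator (cut n) l * ennreal ((\<phi> l - step n j l)\<^sup>2) \<le> ennreal ((1 / real (Suc j))\<^sup>2)"
    proof (cases "l \<in> cut n")
      case True
      from power_mono[OF step_error[OF True, of j] abs_ge_zero, of 2]
      show ?thesis using True by (simp add: ennreal_leI)
    qed simp
  qed
  also have "\<dots> = ennreal ((1 / real (Suc j))\<^sup>2 * (l2_norm f)\<^sup>2)"
    by (simp add: emeasure_eq_measure measure_scalar_spectral_measure_UNIV f ennreal_mult)
  finally show ?thesis .
qed

lemma step_error_tendsto: "(\<lambda>j. ennreal (c * (1 / real (Suc j))\<^sup>2 * d)) \<longlonglongrightarrow> 0"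
proof -
  have "(\<lambda>j. c * (1 / real (Suc j))\<^sup>2 * d) \<longlonglongrightarrow> c * 0\<^sup>2 * d"
    unfolding divide_inverse mult_1
    by (intro tendsto_mult tendsto_const tendsto_power LIMSEQ_inverse_real_of_nat)
  from tendsto_ennrealI[OF this] show ?thesis by simp
qed

text \<open>The functions \<open>step n j\<close> themselves are the approximating sequence that
  \<open>spectral_integral\<close> asks for: off the cut, where they do not approximate \<phi>, the
  spectral measure of \<open>P n f\<close> has no mass.\<close>

lemma P_in_domain:
  assumes f: "f \<in> L2"
  shows "(P n f, C n f) \<in> spectral_integral E \<phi>"
proof -
  have "(\<lambda>j. \<integral>\<^sup>+ l. ennreal ((\<phi> l - step n j l)\<^sup>2) \<partial>scalar_spectral_measure E (P n f)) \<longlonglongrightarrow> 0"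
  proof (rule tendsto_sandwich[OF _ _ tendsto_const])
    show "(\<lambda>j. ennreal (1 * (1 / real (Suc j))\<^sup>2 * (l2_norm f)\<^sup>2)) \<longlonglongrightarrow> 0"
      by (rule step_error_tendsto)
  qed (use nn_integral_step_error[OF f, of n] in auto)
  moreover have "(\<lambda>j. l2_norm (\<lambda>x. SI (step n j) (P n f) x - C n f x)) \<longlonglongrightarrow> 0"
  proof -
    have "l2_norm (\<lambda>x. SI (step n j) (P n f) x - C n f x) = l2_norm (\<lambda>x. SI (step n j) f x - C n f x)" for j
    proof (rule l2_norm_cong_AE)
      show "AE x in lborel. SI (step n j) (P n f) x - C n f x = SI (step n j) f x - C n f x"
        using SI_step_P[OF f, of n j] by eventually_elim simp
    qed (intro L2_diff SI_L2 step_simple P_L2 C_L2 f)+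
    then show ?thesis
      using C_limit[OF f, of n] by simp
  qed
  ultimately show ?thesis
    unfolding spectral_integral_def using step_simple P_L2[OF f] C_L2[OF f] by blast
qed

text \<open>In operator terms P_n B = C_n on the domain of B. The simple functions that define B at
  \<open>f\<close> are arbitrary, so they have to be compared with the particular functions
  \<open>step n j\<close>.\<close>

lemma P_spectral_integral:
  assumes fg: "(f, g) \<in> spectral_integral E \<phi>" and h: "h \<in> L2"
  shows "l2_inner (P n g) h = l2_inner (C n f) h"
proof -
  from fg obtain \<sigma> where f: "f \<in> L2" and g: "g \<in> L2" and s: "\<And>j::nat. simple_function borel (\<sigma> j)"
    and lim: "(\<lambda>j. \<integral>\<^sup>+ l. ennreal ((\<phi> l - \<sigma> j l)\<^sup>2) \<partial>scalar_spectral_measure E f) \<longlonglongrightarrow> 0"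
    and Tlim: "(\<lambda>j. l2_norm (\<lambda>x. SI (\<sigma> j) f x - g x)) \<longlonglongrightarrow> 0"
    unfolding spectral_integral_def by blast
  note Pf = P_L2[OF f, of n]
  have [measurable]: "step n j \<in> borel_measurable borel" "\<sigma> j \<in> borel_measurable borel" for j
    using borel_measurable_simple_function[OF step_simple] borel_measurable_simple_function[OF s] .
  have "(\<lambda>j. l2_inner (SI (\<sigma> j) f) (P n h)) \<longlonglongrightarrow> l2_inner g (P n h)"
    by (rule tendsto_l2_inner_left) (use Tlim in \<open>auto intro: always_eventually SI_L2 s f g P_L2 h\<close>)
  then have 1: "(\<lambda>j. l2_inner (SI (\<sigma> j) (P n f)) h) \<longlonglongrightarrow> l2_inner (P n g) h"
    unfolding P_sym[OF g h] unfolding P_def SI_E_commute_inner[OF s cut_borel f h] .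
  have 2: "(\<lambda>j. l2_inner (SI (step n j) (P n f)) h) \<longlonglongrightarrow> l2_inner (C n f) h"
    using C_inner_limit[OF Pf h, of n] C_P_inner[OF f h, of n] by simp
  \<comment> \<open>Under the spectral measure of \<open>P n f\<close> both simple functions tend to
    \<phi> in mean square, so by the isometry the distance \<open>D\<close> tends to 0.\<close>
  define D where "D j = l2_norm (\<lambda>x. SI (\<sigma> j) (P n f) x - SI (step n j) (P n f) x)" for j
  have "ennreal ((D j)\<^sup>2) \<le> 2 * (\<integral>\<^sup>+ l. ennreal ((\<phi> l - \<sigma> j l)\<^sup>2) \<partial>scalar_spectral_measure E f)
      + ennreal (2 * (1 / real (Suc j))\<^sup>2 * (l2_norm f)\<^sup>2)" for j
  proof -
    have "ennreal ((D j)\<^sup>2) = (\<integral>\<^sup>+ l. ennreal ((\<sigma> j l - step n j l)\<^sup>2) \<partial>scalar_spectral_measure E (P n f))"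
      unfolding D_def by (rule SI_diff_norm_nn[OF s step_simple Pf])
    also have "\<dots> \<le> (\<integral>\<^sup>+ l. ennreal (2 * (\<phi> l - \<sigma> j l)\<^sup>2) + ennreal (2 * (\<phi> l - step n j l)\<^sup>2) \<partial>scalar_spectral_measure E (P n f))"
    proof (intro nn_integral_mono)
      fix l
      have "(\<sigma> j l - step n j l)\<^sup>2 \<le> 2 * (\<phi> l - \<sigma> j l)\<^sup>2 + 2 * (\<phi> l - step n j l)\<^sup>2"
        using zero_le_power2[of "(\<phi> l - \<sigma> j l) + (\<phi> l - step n j l)"]
        by (simp add: power2_eq_square algebra_simps)
      then show "ennreal ((\<sigma> j l - step n j l)\<^sup>2) \<le> ennreal (2 * (\<phi> l - \<sigma> j l)\<^sup>2) + ennreal (2 * (\<phi> l - step n j l)\<^sup>2)"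
        by (simp add: ennreal_leI flip: ennreal_plus)
    qed
    also have "\<dots> = (\<integral>\<^sup>+ l. ennreal (2 * (\<phi> l - \<sigma> j l)\<^sup>2) \<partial>scalar_spectral_measure E (P n f))
        + 2 * (\<integral>\<^sup>+ l. ennreal ((\<phi> l - step n j l)\<^sup>2) \<partial>scalar_spectral_measure E (P n f))"
      by (subst nn_integral_add) (auto simp: ennreal_mult nn_integral_cmult)
    also have "(\<integral>\<^sup>+ l. ennreal (2 * (\<phi> l - \<sigma> j l)\<^sup>2) \<partial>scalar_spectral_measure E (P n f))
        = (\<integral>\<^sup>+ l. indicator (cut n) l * ennreal (2 * (\<phi> l - \<sigma> j l)\<^sup>2) \<partial>scalar_spectral_measure E f)"
      by (intro nn_integral_truncated f) measurable
    also have "\<dots> \<le> (\<integral>\<^sup>+ l. 2 * ennreal ((\<phi> l - \<sigma> j l)\<^sup>2) \<partial>scalar_spectral_measure E f)"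
      by (intro nn_integral_mono) (auto split: split_indicator simp: ennreal_mult)
    also have "\<dots> = 2 * (\<integral>\<^sup>+ l. ennreal ((\<phi> l - \<sigma> j l)\<^sup>2) \<partial>scalar_spectral_measure E f)"
      by (rule nn_integral_cmult) measurable
    also have "2 * (\<integral>\<^sup>+ l. ennreal ((\<phi> l - step n j l)\<^sup>2) \<partial>scalar_spectral_measure E (P n f))
        \<le> 2 * ennreal ((1 / real (Suc j))\<^sup>2 * (l2_norm f)\<^sup>2)"
      by (intro mult_left_mono nn_integral_step_error f) simp
    also have "2 * ennreal ((1 / real (Suc j))\<^sup>2 * (l2_norm f)\<^sup>2) = ennreal (2 * (1 / real (Suc j))\<^sup>2 * (l2_norm f)\<^sup>2)"
      by (subst mult.assoc, subst ennreal_mult[of 2]) auto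
    finally show ?thesis by (simp add: add_mono)
  qed
  then have bound: "\<forall>\<^sub>F j in sequentially. ennreal ((D j)\<^sup>2) \<le> 2 * (\<integral>\<^sup>+ l. ennreal ((\<phi> l - \<sigma> j l)\<^sup>2) \<partial>scalar_spectral_measure E f)
      + ennreal (2 * (1 / real (Suc j))\<^sup>2 * (l2_norm f)\<^sup>2)"
    by simp
  have upper: "(\<lambda>j. 2 * (\<integral>\<^sup>+ l. ennreal ((\<phi> l - \<sigma> j l)\<^sup>2) \<partial>scalar_spectral_measure E f)
      + ennreal (2 * (1 / real (Suc j))\<^sup>2 * (l2_norm f)\<^sup>2)) \<longlonglongrightarrow> 0 + 0"
    using ennreal_tendsto_cmult[OF _ lim, of 2] by (intro tendsto_add step_error_tendsto) simp
  have "(\<lambda>j. ennreal ((D j)\<^sup>2)) \<longlonglongrightarrow> ennreal 0"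
    using tendsto_sandwich[OF _ bound tendsto_const upper] by simp
  then have "(\<lambda>j. (D j)\<^sup>2) \<longlonglongrightarrow> 0"
    by (rule tendsto_ennrealD) auto
  from tendsto_real_sqrt[OF this] have "D \<longlonglongrightarrow> 0"
    by (simp add: D_def[abs_def] l2_norm_nonneg)
  have "(\<lambda>j. l2_inner (SI (\<sigma> j) (P n f)) h - l2_inner (SI (step n j) (P n f)) h) \<longlonglongrightarrow> 0"
  proof (rule Lim_null_comparison)
    show "(\<lambda>j. D j * l2_norm h) \<longlonglongrightarrow> 0"
      using tendsto_mult_right[OF \<open>D \<longlonglongrightarrow> 0\<close>, of "l2_norm h"] by simp
    show "\<forall>\<^sub>F j in sequentially. norm (l2_inner (SI (\<sigma> j) (P n f)) h - l2_inner (SI (step n j) (P n f)) h) \<le> D j * l2_norm h"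
      unfolding D_def
      using l2_Cauchy_Schwarz[OF L2_diff[OF SI_L2[OF s Pf] SI_L2[OF step_simple Pf]] h]
      by (simp add: l2_inner_diff_left SI_L2 s step_simple Pf h)
  qed
  moreover have "(\<lambda>j. l2_inner (SI (\<sigma> j) (P n f)) h - l2_inner (SI (step n j) (P n f)) h)
      \<longlonglongrightarrow> l2_inner (P n g) h - l2_inner (C n f) h"
    by (rule tendsto_diff[OF 1 2])
  ultimately have "l2_inner (P n g) h - l2_inner (C n f) h = 0"
    using LIMSEQ_unique by blast
  then show ?thesis by simp
qed

text \<open>Needed because \<open>op_apply\<close> picks an unspecified value \<open>k\<close>.
  First \<open>k\<close> is shown to be fixed by \<open>P n\<close> in the weak sense, as a limit of
  vectors that are; the previous lemma then identifies it.\<close>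

lemma spectral_integral_P:
  assumes h: "h \<in> L2" and hk: "(P n h, k) \<in> spectral_integral E \<phi>" and q: "q \<in> L2"
  shows "l2_inner k q = l2_inner (C n h) q"
proof -
  from hk obtain \<sigma> where k: "k \<in> L2" and s: "\<And>j::nat. simple_function borel (\<sigma> j)"
    and Tlim: "(\<lambda>j. l2_norm (\<lambda>x. SI (\<sigma> j) (P n h) x - k x)) \<longlonglongrightarrow> 0"
    unfolding spectral_integral_def by blast
  note Ph = P_L2[OF h, of n]
  have lim: "(\<lambda>j. l2_inner (SI (\<sigma> j) (P n h)) w) \<longlonglongrightarrow> l2_inner k w" if "w \<in> L2" for w
    by (rule tendsto_l2_inner_left) (use Tlim that in \<open>auto intro: always_eventually SI_L2 s Ph k\<close>)
  have "l2_inner (SI (\<sigma> j) (P n h)) (P n q) = l2_inner (SI (\<sigma> j) (P n h)) q" for j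
  proof -
    have "l2_inner (SI (\<sigma> j) (P n h)) (P n q) = l2_inner (P n (P n h)) (SI (\<sigma> j) q)"
      unfolding P_def using SI_E_commute_inner[OF s cut_borel, of "E (cut n) h" q j n]
      by (simp add: SI_sym s E_L2 h q)
    also have "\<dots> = l2_inner (SI (\<sigma> j) (P n h)) q"
      by (simp add: P_P_inner h SI_L2 s q SI_sym Ph)
    finally show ?thesis .
  qed
  with lim[OF P_L2[OF q, of n]] have "(\<lambda>j. l2_inner (SI (\<sigma> j) (P n h)) q) \<longlonglongrightarrow> l2_inner (P n k) q"
    by (simp add: P_sym k q)
  then have "l2_inner k q = l2_inner (P n k) q"
    using lim[OF q] LIMSEQ_unique by blast
  also have "\<dots> = l2_inner (C n (P n h)) q"
    by (rule P_spectral_integral[OF hk q])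
  also have "\<dots> = l2_inner (C n h) q"
    by (rule C_P_inner[OF h q])
  finally show ?thesis .
qed

lemma op_apply_spectral_integral:
  assumes "f \<in> Domain (spectral_integral E \<phi>)"
  shows "(f, op_apply (spectral_integral E \<phi>) f) \<in> spectral_integral E \<phi>"
  using assms unfolding op_apply_def by (metis Domain.cases someI)

lemma P_Domain: "h \<in> L2 \<Longrightarrow> P n h \<in> Domain (spectral_integral E \<phi>)"
  using P_in_domain by blast

lemma Domain_L2: "f \<in> Domain (spectral_integral E \<phi>) \<Longrightarrow> f \<in> L2"
  by (auto simp: spectral_integral_def)

text \<open>The left side is the form (B u, B \<phi>) of the weak equation at a truncated test
  element. The right side is bounded in both arguments and free of the choice made by
  \<open>op_apply\<close>.\<close>

lemma op_apply_inner:
  assumes f: "f \<in> Domain (spectral_integral E \<phi>)" and h: "h \<in> L2"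
  shows "l2_inner (op_apply (spectral_integral E \<phi>) f) (op_apply (spectral_integral E \<phi>) (P n h))
    = l2_inner (C n f) (C n h)"
proof -
  define g where "g = op_apply (spectral_integral E \<phi>) f"
  define k where "k = op_apply (spectral_integral E \<phi>) (P n h)"
  have fg: "(f, g) \<in> spectral_integral E \<phi>"
    unfolding g_def by (rule op_apply_spectral_integral[OF f])
  then have g: "g \<in> L2"
    by (simp add: spectral_integral_def)
  have hk: "(P n h, k) \<in> spectral_integral E \<phi>"
    unfolding k_def by (rule op_apply_spectral_integral[OF P_Domain[OF h]])
  have "l2_inner g k = l2_inner g (C n h)"
    using spectral_integral_P[OF h hk g] l2_inner_commute by metis
  also have "\<dots> = l2_inner g (P n (C n h))"
    using P_C_inner[OF h g, of n] l2_inner_commute by metis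
  also have "\<dots> = l2_inner (P n g) (C n h)"
    by (simp add: P_sym g C_L2 h)
  also have "\<dots> = l2_inner (C n f) (C n h)"
    by (rule P_spectral_integral[OF fg C_L2[OF h]])
  finally show ?thesis
    unfolding g_def k_def .
qed

end

section \<open>Weak derivatives in time\<close>

lemma frechet_derivative_eqI: "(f has_derivative f') (at x) \<Longrightarrow> frechet_derivative f (at x) = f'"
  by (rule frechet_derivative_at[symmetric])

lemma Ck_on_SucI:
  assumes "\<And>x. (f has_derivative f' x) (at x)" and "\<And>v. Ck_on k UNIV (\<lambda>x. f' x v)"
  shows "Ck_on (Suc k) UNIV f"
proof -
  have "dir_deriv v f = (\<lambda>x. f' x v)" for v
    unfolding dir_deriv_def by (simp add: frechet_derivative_eqI[OF assms(1)])
  moreover have "f differentiable_on UNIV"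
    using assms(1) by (auto simp: differentiable_on_def differentiable_def)
  ultimately show ?thesis
    using assms(2) by simp
qed

lemma Ck_on_Suc_has_derivative:
  assumes "Ck_on (Suc k) UNIV f"
  shows "(f has_derivative (\<lambda>v. dir_deriv v f x)) (at x)"
proof -
  have "f differentiable (at x)"
    using assms by (auto simp: differentiable_on_def)
  then show ?thesis
    unfolding dir_deriv_def frechet_derivative_works[symmetric] .
qed

lemma Ck_on_Suc_dir_deriv: "Ck_on (Suc k) UNIV f \<Longrightarrow> Ck_on k UNIV (dir_deriv v f)"
  by simp

lemma Ck_on_compose_line:
  "Ck_on k UNIV f \<Longrightarrow> Ck_on k UNIV (\<lambda>t::real. f (x0 + t *\<^sub>R e))"
proof (induction k arbitrary: f)
  case 0
  then show ?case by (auto intro!: continuous_intros continuous_on_compose2[of UNIV f])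
next
  case (Suc k)
  show ?case
  proof (rule Ck_on_SucI)
    show "((\<lambda>t. f (x0 + t *\<^sub>R e)) has_derivative (\<lambda>v. dir_deriv (v *\<^sub>R e) f (x0 + t *\<^sub>R e))) (at t)" for t
      by (rule has_derivative_compose[OF _ Ck_on_Suc_has_derivative[OF Suc.prems]])
         (auto intro!: derivative_eq_intros)
    show "Ck_on k UNIV (\<lambda>t. dir_deriv (v *\<^sub>R e) f (x0 + t *\<^sub>R e))" for v
      by (intro Suc.IH Ck_on_Suc_dir_deriv Suc.prems)
  qed
qed

lemma Ck_on_bounded_linear:
  assumes "bounded_linear L"
  shows "Ck_on k UNIV f \<Longrightarrow> Ck_on k UNIV (\<lambda>x. L (f x))"
proof (induction k arbitrary: f)
  case 0
  then show ?case
    by (auto intro!: continuous_intros bounded_linear.continuous_on[OF assms])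
next
  case (Suc k)
  show ?case
  proof (rule Ck_on_SucI)
    show "((\<lambda>x. L (f x)) has_derivative (\<lambda>v. L (dir_deriv v f x))) (at x)" for x
      by (rule bounded_linear.has_derivative[OF assms Ck_on_Suc_has_derivative[OF Suc.prems]])
    show "Ck_on k UNIV (\<lambda>x. L (dir_deriv v f x))" for v
      by (intro Suc.IH Ck_on_Suc_dir_deriv Suc.prems)
  qed
qed

lemma Ck_on_diff:
  "Ck_on k UNIV f \<Longrightarrow> Ck_on k UNIV g \<Longrightarrow> Ck_on k UNIV (\<lambda>x. f x - g x)"
proof (induction k arbitrary: f g)
  case 0
  then show ?case by (auto intro!: continuous_intros)
next
  case (Suc k)
  show ?case
  proof (rule Ck_on_SucI)
    show "((\<lambda>x. f x - g x) has_derivative (\<lambda>v. dir_deriv v f x - dir_deriv v g x)) (at x)" for x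
      by (intro has_derivative_diff Ck_on_Suc_has_derivative[OF Suc.prems(1)] Ck_on_Suc_has_derivative[OF Suc.prems(2)])
    show "Ck_on k UNIV (\<lambda>x. dir_deriv v f x - dir_deriv v g x)" for v
      by (intro Suc.IH Ck_on_Suc_dir_deriv Suc.prems)
  qed
qed

lemma test_functions_zero_outside: "f \<in> test_functions S \<Longrightarrow> x \<notin> S \<Longrightarrow> f x = 0"
  using closure_subset[of "{x. f x \<noteq> 0}"] by (auto simp: test_functions_def)

lemma test_functions_bounded_support:
  assumes "f \<in> test_functions S"
  obtains K where "\<And>x. K < norm x \<Longrightarrow> f x = 0"
proof -
  have "bounded (closure {x. f x \<noteq> 0})"
    using assms by (simp add: test_functions_def compact_imp_bounded)
  then obtain K where K: "\<And>x. x \<in> closure {x. f x \<noteq> 0} \<Longrightarrow> norm x \<le> K"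
    unfolding bounded_iff by blast
  have "f x = 0" if "K < norm x" for x
  proof (rule ccontr)
    assume "f x \<noteq> 0"
    then have "x \<in> closure {x. f x \<noteq> 0}"
      using closure_subset[of "{x. f x \<noteq> 0}"] by auto
    from K[OF this] that show False by simp
  qed
  then show ?thesis using that by blast
qed

lemma test_functions_smooth: "f \<in> test_functions S \<Longrightarrow> Ck_on k UNIV f"
  by (simp add: test_functions_def smooth_on_def)

text \<open>A primitive of the restriction of a bump function to a line is a smooth step function.\<close>

lemma smooth_step_exists:
  fixes \<psi> :: "'a::euclidean_space \<Rightarrow> real"
  assumes psi: "\<psi> \<in> test_functions UNIV" and nn: "\<And>x. 0 \<le> \<psi> x" and nz: "\<psi> x0 \<noteq> 0"
  obtains b G :: "real \<Rightarrow> real" and K where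
    "0 < K" "continuous_on UNIV b" "\<And>t. 0 \<le> b t" "\<And>t. K < \<bar>t\<bar> \<Longrightarrow> b t = 0"
    "\<And>t. (G has_vector_derivative b t) (at t)" "\<And>k. Ck_on k UNIV G"
    "\<And>t. t < -K \<Longrightarrow> G t = 0" "\<And>t. K < t \<Longrightarrow> G t = 1"
proof -
  obtain e :: 'a where e: "e \<in> Basis" using nonempty_Basis by blast
  define b where "b t = \<psi> (x0 + t *\<^sub>R e)" for t
  have bC: "Ck_on k UNIV b" for k
    unfolding b_def by (rule Ck_on_compose_line[OF test_functions_smooth[OF psi]])
  have bc: "continuous_on UNIV b" using bC[of 0] by simp
  obtain R where R: "\<And>x. R < norm x \<Longrightarrow> \<psi> x = 0"
    using test_functions_bounded_support[OF psi] by blast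
  \<comment> \<open>For |t| > K the point \<open>x0 + t *\<^sub>R e\<close> has norm above
    \<open>R\<close>, so \<open>b\<close> vanishes; the summand 1 makes \<open>K\<close>
    positive.\<close>
  define K where "K = \<bar>R\<bar> + norm x0 + 1"
  have K: "0 < K" unfolding K_def by (smt (verit) norm_ge_zero)
  have b0: "b t = 0" if "K < \<bar>t\<bar>" for t
  proof -
    have "\<bar>t\<bar> = norm (t *\<^sub>R e)" using e by simp
    also have "\<dots> \<le> norm (x0 + t *\<^sub>R e) + norm x0"
      using norm_triangle_ineq4[of "x0 + t *\<^sub>R e" x0] by simp
    finally have "R < norm (x0 + t *\<^sub>R e)"
      using that unfolding K_def by linarith
    then show ?thesis unfolding b_def by (rule R)
  qed
  \<comment> \<open>The lower limit lies strictly to the left of the support of \<open>b\<close>, so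
    that -K and every point to its right is interior to an interval of integration. Points to the
    left of -K are treated separately.\<close>
  define G where "G t = integral {-K-1..t} b" for t
  have Gd: "(G has_vector_derivative b t) (at t)" for t
  proof (cases "t < -K")
    case True
    have "G s = 0" if "s < -K" for s
    proof -
      have "integral {-K-1..s} b = integral {-K-1..s} (\<lambda>_. 0)"
        by (rule integral_cong) (use that K in \<open>auto intro!: b0\<close>)
      then show ?thesis by (simp add: G_def)
    qed
    then have "(G has_vector_derivative 0) (at t)"
      by (intro has_vector_derivative_transform_within_open[of "\<lambda>_. 0" 0 t "{..< -K}" G]) (use True in auto)
    then show ?thesis using b0[of t] True K by simp
  next
    case False
    have "(G has_vector_derivative b t) (at t within {-K-1..t+1})"
      unfolding G_def
      by (rule integral_has_vector_derivative) (use False in \<open>auto intro: continuous_on_subset[OF bc]\<close>)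
    moreover have "t \<in> interior {-K-1..t+1}" using False by simp
    ultimately show ?thesis by (simp only: at_within_interior)
  qed
  have G0: "G t = 0" if "t < -K" for t
  proof -
    have "integral {-K-1..t} b = integral {-K-1..t} (\<lambda>_. 0)"
      by (rule integral_cong) (use that K in \<open>auto intro!: b0\<close>)
    then show ?thesis by (simp add: G_def)
  qed
  \<comment> \<open>The total mass of \<open>b\<close>, by which the step is normalised at the end.
    It is positive because \<open>b\<close> is continuous and nonnegative and \<open>b 0\<close> is
    the nonzero value \<open>\<psi> x0\<close>.\<close>
  define I where "I = G K"
  have GI: "G t = I" if "K < t" for t
  proof -
    have "integral {-K-1..K} b + integral {K..t} b = integral {-K-1..t} b"
      by (rule Henstock_Kurzweil_Integration.integral_combine)
         (use that K in \<open>auto intro!: integrable_continuous_interval continuous_on_subset[OF bc]\<close>)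
    moreover have "integral {K..t} b = integral {K..t} (\<lambda>_. 0)"
      by (rule integral_spike[of "{K}"]) (use K in \<open>auto intro!: b0\<close>)
    ultimately show ?thesis by (simp add: G_def I_def)
  qed
  have Ipos: "0 < I"
  proof -
    have "0 \<le> I" unfolding I_def G_def
      by (rule integral_nonneg)
         (auto intro!: integrable_continuous_interval continuous_on_subset[OF bc] simp: b_def nn)
    moreover have "I \<noteq> 0"
    proof
      assume "I = 0"
      then have "(b has_integral 0) (cbox (-K-1) K)"
        unfolding I_def G_def using integrable_integral[OF integrable_continuous_interval[OF continuous_on_subset[OF bc subset_UNIV]], of "-K-1" K]
        by simp
      moreover have "continuous_on (cbox (-K-1) K) b" "\<And>t. 0 \<le> b t"
        using continuous_on_subset[OF bc] by (auto simp: b_def nn)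
      ultimately have "b 0 = 0"
        by (intro has_integral_0_cbox_imp_0[of "-K-1" K b]) (use K in auto)
      then show False using nz by (simp add: b_def)
    qed
    ultimately show ?thesis by simp
  qed
  have GC: "Ck_on k UNIV G" for k
  proof (cases k)
    case 0
    have "continuous_on UNIV G"
      using Gd by (intro continuous_on_vector_derivative[of UNIV G b]) auto
    then show ?thesis using 0 by simp
  next
    case (Suc k')
    show ?thesis unfolding Suc
    proof (rule Ck_on_SucI)
      show "(G has_derivative (\<lambda>v. v * b t)) (at t)" for t
        using Gd[of t] unfolding has_vector_derivative_def by simp
      show "Ck_on k' UNIV (\<lambda>x. v * b x)" for v
        by (rule Ck_on_bounded_linear[OF bounded_linear_mult_right bC])
    qed
  qed
  show ?thesis
  proof (rule that[of K "\<lambda>t. b t / I" "\<lambda>t. G t / I"])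
    show "continuous_on UNIV (\<lambda>t. b t / I)"
      using bc Ipos by (intro continuous_intros) auto
    show "((\<lambda>t. G t / I) has_vector_derivative b t / I) (at t)" for t
      using bounded_linear.has_vector_derivative[OF bounded_linear_divide Gd] .
    show "Ck_on k UNIV (\<lambda>t. G t / I)" for k
      by (rule Ck_on_bounded_linear[OF bounded_linear_divide GC])
  qed (use K b0 G0 GI Ipos nn in \<open>auto simp: b_def\<close>)
qed

text \<open>Testing with \<open>G\<^sub>\<delta>(t - p) - G\<^sub>\<delta>(t - q)\<close> for a smooth step \<open>G\<^sub>\<delta>\<close> of width \<open>\<delta>\<close>.\<close>

lemma du_Bois_Reymond_const:
  fixes \<psi> :: "'a::euclidean_space \<Rightarrow> real" and h :: "real \<Rightarrow> complex"
  assumes psi: "\<psi> \<in> test_functions UNIV" and nn: "\<And>x. 0 \<le> \<psi> x" and nz: "\<psi> x0 \<noteq> 0"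
    and hc: "continuous_on {0..T} h"
    and test: "\<And>\<eta>. \<eta> \<in> test_functions {0<..<T} \<Longrightarrow> integral {0..T} (\<lambda>t. h t * vector_derivative \<eta> (at t)) = 0"
    and p: "p \<in> {0<..<T}" and q: "q \<in> {0<..<T}" and pq: "p \<le> q"
  shows "h p = h q"
proof -
  obtain b G :: "real \<Rightarrow> real" and K where K: "0 < K" and bc: "continuous_on UNIV b" and bnn: "\<And>t. 0 \<le> b t"
    and b0: "\<And>t. K < \<bar>t\<bar> \<Longrightarrow> b t = 0" and Gd: "\<And>t. (G has_vector_derivative b t) (at t)"
    and GC: "\<And>k. Ck_on k UNIV G" and G0: "\<And>t. t < -K \<Longrightarrow> G t = 0" and G1: "\<And>t. K < t \<Longrightarrow> G t = 1"
    using smooth_step_exists[OF psi nn nz] by metis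
  have "cmod (h p - h q) \<le> 2 * e" if e: "0 < e" for e
  proof -
    have "\<exists>r>0. \<forall>t\<in>{0..T}. dist t a < r \<longrightarrow> dist (h t) (h a) < e" if "a \<in> {0..T}" for a
      using hc e that unfolding continuous_on_iff by blast
    from this[of p] this[of q] obtain rp rq where r: "0 < rp" "0 < rq"
      "\<And>t. t \<in> {0..T} \<Longrightarrow> \<bar>t - p\<bar> < rp \<Longrightarrow> cmod (h t - h p) < e"
      "\<And>t. t \<in> {0..T} \<Longrightarrow> \<bar>t - q\<bar> < rq \<Longrightarrow> cmod (h t - h q) < e"
      using p q by (auto simp: dist_norm)
    \<comment> \<open>Within distance \<open>m\<close> of p or q, \<open>h\<close> differs from its
      value there by less than e, and these neighbourhoods stay in the time interval.\<close>
    define m where "m = Min {rp, rq, p, T - q}"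
    have m: "0 < m" "m \<le> rp" "m \<le> rq" "m \<le> p" "m \<le> T - q"
      unfolding m_def using r p q by auto
    \<comment> \<open>The bump rescaled by \<open>d\<close> around a point lives within K d = m/2 of
      it, inside the neighbourhood just chosen.\<close>
    define d where "d = m / (2 * K)"
    have d: "0 < d" "K * d < m" unfolding d_def using m K by auto
    define \<beta> where "\<beta> a t = b ((t - a) / d) / d" for a t
    define \<eta> where "\<eta> t = complex_of_real (G ((t - p) / d) - G ((t - q) / d))" for t
    have Gd': "((\<lambda>t. G ((t - a) / d)) has_vector_derivative \<beta> a t) (at t within S)" for a t S
    proof -
      have "((\<lambda>t. (t - a) / d) has_vector_derivative (1 / d)) (at t)"
        using d by (auto intro!: derivative_eq_intros simp: has_real_derivative_iff_has_vector_derivative[symmetric])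
      from vector_diff_chain_at[OF this Gd]
      show ?thesis
        by (auto simp: o_def \<beta>_def intro: has_vector_derivative_at_within)
    qed
    have \<eta>d: "(\<eta> has_vector_derivative complex_of_real (\<beta> p t - \<beta> q t)) (at t)" for t
      unfolding \<eta>_def
      by (intro bounded_linear.has_vector_derivative[OF bounded_linear_of_real] has_vector_derivative_diff Gd')
    have \<beta>c: "continuous_on S (\<beta> a)" for a S
      unfolding \<beta>_def using d by (intro continuous_intros continuous_on_compose2[OF bc]) auto
    have \<beta>0: "\<beta> a t = 0" if "K * d < \<bar>t - a\<bar>" for a t
      unfolding \<beta>_def using d that by (subst b0) (auto simp: field_simps)
    have \<beta>1: "integral {0..T} (\<beta> a) = 1" if a: "p \<le> a" "a \<le> q" for a
    proof -
      have "(\<beta> a has_integral G ((T - a) / d) - G ((0 - a) / d)) {0..T}"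
        by (rule fundamental_theorem_of_calculus) (use Gd' p q in auto)
      moreover have "G ((T - a) / d) = 1"
        by (rule G1) (use d m a in \<open>auto simp: field_simps\<close>)
      moreover have "G ((0 - a) / d) = 0"
        by (rule G0) (use d m a in \<open>auto simp: field_simps\<close>)
      ultimately show ?thesis by (simp add: integral_unique)
    qed
    have supp: "{t. \<eta> t \<noteq> 0} \<subseteq> {p - K * d..q + K * d}"
    proof (rule subsetI, rule ccontr)
      fix t assume t: "t \<in> {t. \<eta> t \<noteq> 0}" "t \<notin> {p - K * d..q + K * d}"
      then consider "t < p - K * d" | "q + K * d < t" by fastforce
      then have "\<eta> t = 0"
      proof cases
        case 1
        then have "(t - p) / d < -K" "(t - q) / d < -K"
          using d pq by (auto simp: field_simps)
        then show ?thesis by (simp add: \<eta>_def G0)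
      next
        case 2
        then have "K < (t - p) / d" "K < (t - q) / d"
          using d pq by (auto simp: field_simps)
        then show ?thesis by (simp add: \<eta>_def G1)
      qed
      then show False using t by simp
    qed
    have "\<eta> \<in> test_functions {0<..<T}"
      unfolding test_functions_def
    proof (intro CollectI conjI)
      have cl: "closure {t. \<eta> t \<noteq> 0} \<subseteq> {p - K * d..q + K * d}"
        by (rule closure_minimal[OF supp]) simp
      then show "closure {t. \<eta> t \<noteq> 0} \<subseteq> {0<..<T}"
        using m d by auto
      show "compact (closure {t. \<eta> t \<noteq> 0})"
        using cl by (metis bounded_closed_interval bounded_subset closed_closure compact_eq_bounded_closed)
      have "Ck_on k UNIV (\<lambda>t. G ((- a / d) + t *\<^sub>R (1 / d)))" for k a
        by (rule Ck_on_compose_line[OF GC])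
      then have "Ck_on k UNIV (\<lambda>t. G ((t - a) / d))" for k a
        by (simp add: diff_divide_distrib)
      then show "smooth_on UNIV \<eta>"
        unfolding smooth_on_def \<eta>_def
        by (intro allI Ck_on_bounded_linear[OF bounded_linear_of_real] Ck_on_diff)
    qed
    from test[OF this] have "integral {0..T} (\<lambda>t. h t * complex_of_real (\<beta> p t - \<beta> q t)) = 0"
      by (simp add: vector_derivative_at[OF \<eta>d])
    moreover have int: "(\<lambda>t. h t * complex_of_real (\<beta> a t)) integrable_on {0..T}" for a
      by (intro integrable_continuous_interval continuous_intros hc \<beta>c)
    ultimately have eq: "integral {0..T} (\<lambda>t. h t * complex_of_real (\<beta> p t)) = integral {0..T} (\<lambda>t. h t * complex_of_real (\<beta> q t))"
      by (simp add: right_diff_distrib integral_diff)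
    \<comment> \<open>\<open>\<beta> a\<close> is nonnegative with integral 1 and supported near
      \<open>a\<close>, so this integral is an average of values of \<open>h\<close> near
      \<open>a\<close>.\<close>
    have near: "cmod (integral {0..T} (\<lambda>t. h t * complex_of_real (\<beta> a t)) - h a) \<le> e"
      if a: "p \<le> a" "a \<le> q" and osc: "\<And>t. t \<in> {0..T} \<Longrightarrow> \<bar>t - a\<bar> < m \<Longrightarrow> cmod (h t - h a) < e" for a
    proof -
      have i1: "(\<lambda>t. h a * complex_of_real (\<beta> a t)) integrable_on {0..T}"
        by (intro integrable_continuous_interval continuous_intros \<beta>c)
      have "h a = integral {0..T} (\<lambda>t. h a * complex_of_real (\<beta> a t))"
      proof -
        have "(\<beta> a has_integral 1) {0..T}"
          using integrable_integral[OF integrable_continuous_interval[OF \<beta>c]] \<beta>1[OF a] by metis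
        from integral_unique[OF has_integral_mult_right[OF has_integral_of_real[OF this], of "h a"]] show ?thesis
          by (simp only: of_real_1 mult_1_right)
      qed
      then have "integral {0..T} (\<lambda>t. h t * complex_of_real (\<beta> a t)) - h a
          = integral {0..T} (\<lambda>t. h t * complex_of_real (\<beta> a t)) - integral {0..T} (\<lambda>t. h a * complex_of_real (\<beta> a t))"
        by simp
      also have "\<dots> = integral {0..T} (\<lambda>t. h t * complex_of_real (\<beta> a t) - h a * complex_of_real (\<beta> a t))"
        by (rule Henstock_Kurzweil_Integration.integral_diff[OF int i1, symmetric])
      also have "cmod \<dots> \<le> integral {0..T} (\<lambda>t. e * \<beta> a t)"
      proof (rule integral_norm_bound_integral)
        show "(\<lambda>t. h t * complex_of_real (\<beta> a t) - h a * complex_of_real (\<beta> a t)) integrable_on {0..T}"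
          by (intro integrable_diff int i1)
        show "(\<lambda>t. e * \<beta> a t) integrable_on {0..T}"
          by (intro integrable_continuous_interval continuous_intros \<beta>c)
        fix t assume t: "t \<in> {0..T}"
        have \<beta>nn: "0 \<le> \<beta> a t" using bnn d by (simp add: \<beta>_def)
        show "norm (h t * complex_of_real (\<beta> a t) - h a * complex_of_real (\<beta> a t)) \<le> e * \<beta> a t"
        proof (cases "\<bar>t - a\<bar> < m")
          case True
          have "h t * complex_of_real (\<beta> a t) - h a * complex_of_real (\<beta> a t) = (h t - h a) * complex_of_real (\<beta> a t)"
            by (simp add: algebra_simps)
          then show ?thesis
            using mult_right_mono[OF less_imp_le[OF osc[OF t True]] \<beta>nn] \<beta>nn by (simp add: norm_mult)
        next
          case False
          then show ?thesis using \<beta>0[of t a] d by simp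
        qed
      qed
      also have "\<dots> = e"
        using \<beta>1[OF a] by (simp add: integral_mult_right)
      finally show ?thesis .
    qed
    have "cmod (integral {0..T} (\<lambda>t. h t * complex_of_real (\<beta> p t)) - h p) \<le> e"
      by (rule near) (use pq r m in auto)
    moreover have "cmod (integral {0..T} (\<lambda>t. h t * complex_of_real (\<beta> q t)) - h q) \<le> e"
      by (rule near) (use pq r m in auto)
    ultimately show ?thesis
      unfolding eq using norm_triangle_ineq4[of "integral {0..T} (\<lambda>t. h t * complex_of_real (\<beta> q t)) - h q"
          "integral {0..T} (\<lambda>t. h t * complex_of_real (\<beta> q t)) - h p"] by simp
  qed
  \<comment> \<open>With a quarter of the distance as e, the bound 2e is half of the quantity it
    bounds, which must therefore vanish.\<close>
  from this[of "cmod (h p - h q) / 4"] show ?thesis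
    by (cases "h p = h q") auto
qed

text \<open>Adding a primitive \<open>L\<close> of \<open>k\<close> to \<open>g\<close> turns the
  hypothesis into the vanishing of the weak derivative of \<open>g + L\<close>. This sum is then
  constant in the open interval, by continuity also at the end points, and \<open>g\<close> is a
  constant minus \<open>L\<close>. The function \<open>\<psi>\<close> only supplies a bump.\<close>

lemma weak_derivative_imp_derivative:
  fixes \<psi> :: "'a::euclidean_space \<Rightarrow> real" and g k :: "real \<Rightarrow> complex"
  assumes psi: "\<psi> \<in> test_functions UNIV" and nn: "\<And>x. 0 \<le> \<psi> x" and nz: "\<psi> x0 \<noteq> 0"
    and T: "0 < T" and gc: "continuous_on {0..T} g" and kc: "continuous_on {0..T} k"
    and test: "\<And>\<eta>. \<eta> \<in> test_functions {0<..<T} \<Longrightarrow>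
       integral {0..T} (\<lambda>t. - g t * vector_derivative \<eta> (at t) + k t * \<eta> t) = 0"
    and t: "t \<in> {0..T}"
  shows "(g has_vector_derivative - k t) (at t within {0..T})"
proof -
  define L where "L t = integral {0..t} k" for t
  have Ld: "(L has_vector_derivative k t) (at t within {0..T})" if "t \<in> {0..T}" for t
    unfolding L_def by (rule integral_has_vector_derivative[OF kc that])
  have Lc: "continuous_on {0..T} L"
    using Ld by (rule continuous_on_vector_derivative)
  define h where "h t = g t + L t" for t
  have hc: "continuous_on {0..T} h"
    unfolding h_def by (intro continuous_intros gc Lc)
  have htest: "integral {0..T} (\<lambda>t. h t * vector_derivative \<eta> (at t)) = 0" if \<eta>: "\<eta> \<in> test_functions {0<..<T}" for \<eta>
  proof -
    have "Ck_on (Suc 0) UNIV \<eta>" by (rule test_functions_smooth[OF \<eta>])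
    then have "(\<eta> has_derivative (\<lambda>v. dir_deriv v \<eta> t)) (at t)" for t
      by (rule Ck_on_Suc_has_derivative)
    then have \<eta>d: "(\<eta> has_vector_derivative dir_deriv 1 \<eta> t) (at t)" for t
      by (metis differentiableI frechet_derivative_eqI dir_deriv_def vector_derivative_works has_vector_derivative_def scaleR_one)
    have \<eta>v: "vector_derivative \<eta> (at t) = dir_deriv 1 \<eta> t" for t
      by (rule vector_derivative_at[OF \<eta>d])
    have "Ck_on 0 UNIV (dir_deriv 1 \<eta>)"
      by (rule Ck_on_Suc_dir_deriv) (rule test_functions_smooth[OF \<eta>])
    then have dc: "continuous_on {0..T} (dir_deriv 1 \<eta>)"
      by (auto intro: continuous_on_subset)
    have \<eta>c: "continuous_on {0..T} \<eta>"
      using test_functions_smooth[OF \<eta>, of 0] by (auto intro: continuous_on_subset)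
    have parts: "((\<lambda>t. L t * dir_deriv 1 \<eta> t + k t * \<eta> t) has_integral L T * \<eta> T - L 0 * \<eta> 0) {0..T}"
    proof (rule fundamental_theorem_of_calculus)
      show "((\<lambda>t. L t * \<eta> t) has_vector_derivative L t * dir_deriv 1 \<eta> t + k t * \<eta> t) (at t within {0..T})"
        if "t \<in> {0..T}" for t
        by (intro has_vector_derivative_mult Ld that has_vector_derivative_at_within[OF \<eta>d])
    qed (use T in simp)
    have "\<eta> T = 0" "\<eta> 0 = 0"
      using test_functions_zero_outside[OF \<eta>] by auto
    then have 1: "integral {0..T} (\<lambda>t. L t * dir_deriv 1 \<eta> t + k t * \<eta> t) = 0"
      using parts by (simp add: integral_unique)
    have 2: "integral {0..T} (\<lambda>t. - g t * dir_deriv 1 \<eta> t + k t * \<eta> t) = 0"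
      using test[OF \<eta>] by (simp add: \<eta>v)
    have "integral {0..T} (\<lambda>t. h t * dir_deriv 1 \<eta> t)
       = integral {0..T} (\<lambda>t. (L t * dir_deriv 1 \<eta> t + k t * \<eta> t) - (- g t * dir_deriv 1 \<eta> t + k t * \<eta> t))"
      by (rule integral_cong) (simp add: h_def algebra_simps)
    also have "\<dots> = integral {0..T} (\<lambda>t. L t * dir_deriv 1 \<eta> t + k t * \<eta> t) - integral {0..T} (\<lambda>t. - g t * dir_deriv 1 \<eta> t + k t * \<eta> t)"
      by (intro Henstock_Kurzweil_Integration.integral_diff integrable_continuous_interval continuous_intros Lc dc kc \<eta>c gc)
    finally show ?thesis unfolding 1 2 by (simp add: \<eta>v)
  qed
  have const: "h p = h (T/2)" if "p \<in> {0<..<T}" for p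
    using du_Bois_Reymond_const[OF psi nn nz hc htest, of p "T/2"] du_Bois_Reymond_const[OF psi nn nz hc htest, of "T/2" p]
      that T by (cases "p \<le> T/2") auto
  have hconst: "h p = h (T/2)" if "p \<in> {0..T}" for p
  proof (rule continuous_constant_on_closure[of "{0<..<T}" h])
    show "continuous_on (closure {0<..<T}) h" using hc T by simp
    show "h x = h (T/2)" if "x \<in> {0<..<T}" for x by (rule const[OF that])
    show "p \<in> closure {0<..<T}" using that T by simp
  qed
  have g: "g p = h (T/2) - L p" if "p \<in> {0..T}" for p
  proof -
    have "g p = h p - L p" by (simp add: h_def)
    then show ?thesis by (simp only: hconst[OF that])
  qed
  have "((\<lambda>p. h (T/2) - L p) has_vector_derivative 0 - k t) (at t within {0..T})"
    by (intro has_vector_derivative_diff has_vector_derivative_const Ld t)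
  then show ?thesis
    using has_vector_derivative_transform[OF t g] by simp
qed

section \<open>Stability of weak solutions\<close>

lemma eventually_at_within_mem: "eventually (\<lambda>r. r \<in> J) (at t within J)"
  by (simp add: eventually_at_filter)

lemma tendsto_l2_norm:
  assumes f: "\<forall>\<^sub>F n in F. f n \<in> L2" and g: "g \<in> L2"
    and lim: "((\<lambda>n. l2_norm (\<lambda>x. f n x - g x)) \<longlongrightarrow> 0) F"
  shows "((\<lambda>n. l2_norm (f n)) \<longlongrightarrow> l2_norm g) F"
proof -
  have "((\<lambda>n. l2_norm (f n) - l2_norm g) \<longlongrightarrow> 0) F"
  proof (rule Lim_null_comparison[OF _ lim])
    show "\<forall>\<^sub>F n in F. norm (l2_norm (f n) - l2_norm g) \<le> l2_norm (\<lambda>x. f n x - g x)"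
      using f by eventually_elim (simp add: l2_norm_diff_le g)
  qed
  then show ?thesis by (simp add: LIM_zero_iff)
qed

lemma continuous_wrt_l2_inner:
  assumes "continuous_wrt l2_norm J u" and u: "\<And>t. t \<in> J \<Longrightarrow> u t \<in> L2" and h: "h \<in> L2"
  shows "continuous_on J (\<lambda>t. l2_inner (u t) h)"
  unfolding continuous_on
proof
  fix t assume t: "t \<in> J"
  have "\<forall>\<^sub>F r in at t within J. u r \<in> L2"
    using eventually_at_within_mem by eventually_elim (rule u)
  then show "((\<lambda>r. l2_inner (u r) h) \<longlongrightarrow> l2_inner (u t) h) (at t within J)"
    by (rule tendsto_l2_inner_left) (use assms t in \<open>auto simp: continuous_wrt_def\<close>)
qed

lemma continuous_wrt_l2_norm:
  assumes "continuous_wrt l2_norm J u" and u: "\<And>t. t \<in> J \<Longrightarrow> u t \<in> L2"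
  shows "continuous_on J (\<lambda>t. l2_norm (u t))"
  unfolding continuous_on
proof
  fix t assume t: "t \<in> J"
  have "\<forall>\<^sub>F r in at t within J. u r \<in> L2"
    using eventually_at_within_mem by eventually_elim (rule u)
  then show "((\<lambda>r. l2_norm (u r)) \<longlongrightarrow> l2_norm (u t)) (at t within J)"
    by (rule tendsto_l2_norm) (use assms t in \<open>auto simp: continuous_wrt_def\<close>)
qed

lemma has_l2_time_derivative_imp_continuous:
  assumes d: "has_l2_time_derivative u v J" and u: "\<And>t. t \<in> J \<Longrightarrow> u t \<in> L2" and v: "\<And>t. t \<in> J \<Longrightarrow> v t \<in> L2"
  shows "continuous_wrt l2_norm J u"
  unfolding continuous_wrt_def
proof
  fix t assume t: "t \<in> J"
  define q where "q r x = (u r x - u t x) / complex_of_real (r - t)" for r x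
  have lim: "((\<lambda>r. l2_norm (\<lambda>x. q r x - v t x)) \<longlongrightarrow> 0) (at t within J)"
    using d t by (auto simp: has_l2_time_derivative_def q_def)
  have "\<forall>\<^sub>F r in at t within J. q r \<in> L2"
    using eventually_at_within_mem
    by eventually_elim (auto simp: q_def[abs_def] intro!: L2_divide L2_diff u t)
  then have "((\<lambda>r. l2_norm (q r)) \<longlongrightarrow> l2_norm (v t)) (at t within J)"
    by (rule tendsto_l2_norm[OF _ v[OF t] lim])
  then have "((\<lambda>r. \<bar>r - t\<bar> * l2_norm (q r)) \<longlongrightarrow> \<bar>t - t\<bar> * l2_norm (v t)) (at t within J)"
    by (intro tendsto_intros)
  moreover have "\<bar>r - t\<bar> * l2_norm (q r) = l2_norm (\<lambda>x. u r x - u t x)" for r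
  proof (cases "r = t")
    case False
    then show ?thesis
      unfolding q_def[abs_def] l2_norm_divide norm_of_real by simp
  qed (simp add: l2_norm_zero)
  ultimately show "((\<lambda>r. l2_norm (\<lambda>x. u r x - u t x)) \<longlongrightarrow> 0) (at t within J)"
    by simp
qed

text \<open>With the difference quotient q one has a(r) = a(t) + (r - t) q. Expanding the square,
  the quotient of squared norms is 2 Re (q, a(t)) + (r - t) |q|^2, whose second term vanishes in the
  limit.\<close>

lemma has_l2_time_derivative_norm_square:
  assumes d: "has_l2_time_derivative a b J" and a: "\<And>t. t \<in> J \<Longrightarrow> a t \<in> L2" and b: "\<And>t. t \<in> J \<Longrightarrow> b t \<in> L2"
    and t: "t \<in> J"
  shows "((\<lambda>t. (l2_norm (a t))\<^sup>2) has_real_derivative 2 * Re (l2_inner (b t) (a t))) (at t within J)"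
proof -
  define q where "q r x = (a r x - a t x) / complex_of_real (r - t)" for r x
  have lim: "((\<lambda>r. l2_norm (\<lambda>x. q r x - b t x)) \<longlongrightarrow> 0) (at t within J)"
    using d t by (auto simp: has_l2_time_derivative_def q_def)
  have qL: "q r \<in> L2" if "r \<in> J" for r
    using that by (auto simp: q_def[abs_def] intro!: L2_divide L2_diff a t)
  have ev: "\<forall>\<^sub>F r in at t within J. q r \<in> L2"
    using eventually_at_within_mem by eventually_elim (rule qL)
  have "((\<lambda>r. 2 * Re (l2_inner (q r) (a t)) + (r - t) * (l2_norm (q r))\<^sup>2)
      \<longlongrightarrow> 2 * Re (l2_inner (b t) (a t)) + (t - t) * (l2_norm (b t))\<^sup>2) (at t within J)"
    by (intro tendsto_intros tendsto_l2_inner_left[OF ev] tendsto_l2_norm[OF ev] a b t lim)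
  then have "((\<lambda>r. 2 * Re (l2_inner (q r) (a t)) + (r - t) * (l2_norm (q r))\<^sup>2)
      \<longlongrightarrow> 2 * Re (l2_inner (b t) (a t))) (at t within J)"
    by simp
  moreover have "\<forall>\<^sub>F r in at t within J. 2 * Re (l2_inner (q r) (a t)) + (r - t) * (l2_norm (q r))\<^sup>2
      = ((l2_norm (a r))\<^sup>2 - (l2_norm (a t))\<^sup>2) / (r - t)"
    unfolding eventually_at_filter
  proof (intro always_eventually allI impI)
    fix r assume r: "r \<noteq> t" "r \<in> J"
    define c where "c = complex_of_real (r - t)"
    have c: "c \<noteq> 0" "cnj c = c" "a r = (\<lambda>x. a t x + c * q r x)"
      using r by (auto simp: c_def q_def)
    have cq: "(\<lambda>x. c * q r x) \<in> L2"
      by (intro L2_cmult qL r)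
    have cm: "l2_inner (a t) (q r) = cnj (l2_inner (q r) (a t))"
      by (rule l2_inner_commute)
    have "l2_inner (a r) (a r) = l2_inner (a t) (a t) + c * cnj (l2_inner (q r) (a t)) + c * l2_inner (q r) (a t) + c * c * l2_inner (q r) (q r)"
      unfolding c(3) using c(2) cq a[OF t] qL[OF r(2)]
      by (simp add: l2_inner_add_left l2_inner_add_right L2_add l2_inner_cmult_left l2_inner_cmult_right cm algebra_simps)
    then have "Re (l2_inner (a r) (a r)) = Re (l2_inner (a t) (a t)) + (r - t) * (2 * Re (l2_inner (q r) (a t)))
       + (r - t) * (r - t) * (l2_norm (q r))\<^sup>2"
      by (simp add: c_def l2_inner_self flip: of_real_mult)
    then show "2 * Re (l2_inner (q r) (a t)) + (r - t) * (l2_norm (q r))\<^sup>2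
      = ((l2_norm (a r))\<^sup>2 - (l2_norm (a t))\<^sup>2) / (r - t)"
      using r(1) by (simp add: l2_norm_square[symmetric] field_simps)
  qed
  ultimately show ?thesis
    unfolding has_field_derivative_iff by (rule Lim_transform_eventually)
qed

text \<open>Symmetry replaces linearity here: by \<open>symmetric_difference_quotient\<close> the
  difference quotient of \<open>S (a t)\<close> is, off a null set, \<open>S\<close> applied to that
  of \<open>a\<close>. It is used with \<open>S = C n\<close>.\<close>

lemma has_l2_time_derivative_map:
  assumes L: "\<And>f. f \<in> L2 \<Longrightarrow> S f \<in> L2"
    and sym: "\<And>f g. f \<in> L2 \<Longrightarrow> g \<in> L2 \<Longrightarrow> l2_inner (S f) g = l2_inner f (S g)"
    and bd: "\<And>f. f \<in> L2 \<Longrightarrow> l2_norm (S f) \<le> c * l2_norm f"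
    and d: "has_l2_time_derivative a b J" and a: "\<And>t. t \<in> J \<Longrightarrow> a t \<in> L2" and b: "\<And>t. t \<in> J \<Longrightarrow> b t \<in> L2"
  shows "has_l2_time_derivative (\<lambda>t. S (a t)) (\<lambda>t. S (b t)) J"
  unfolding has_l2_time_derivative_def
proof
  fix t assume t: "t \<in> J"
  define q where "q r x = (a r x - a t x) / complex_of_real (r - t) - b t x" for r x
  have lim: "((\<lambda>r. l2_norm (q r)) \<longlongrightarrow> 0) (at t within J)"
    using d t by (auto simp: has_l2_time_derivative_def q_def[abs_def])
  have "((\<lambda>r. c * l2_norm (q r)) \<longlongrightarrow> 0) (at t within J)"
    using tendsto_mult_left[OF lim, of c] by simp
  then show "((\<lambda>r. l2_norm (\<lambda>x. (S (a r) x - S (a t) x) / complex_of_real (r - t) - S (b t) x)) \<longlongrightarrow> 0) (at t within J)"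
  proof (rule Lim_null_comparison[rotated])
    show "\<forall>\<^sub>F r in at t within J. norm (l2_norm (\<lambda>x. (S (a r) x - S (a t) x) / complex_of_real (r - t) - S (b t) x)) \<le> c * l2_norm (q r)"
      using eventually_at_within_mem
    proof eventually_elim
      case (elim r)
      have qL: "q r \<in> L2"
        using elim t by (auto simp: q_def[abs_def] intro!: L2_divide L2_diff a b)
      have "l2_norm (S (q r)) = l2_norm (\<lambda>x. (S (a r) x - S (a t) x) / complex_of_real (r - t) - S (b t) x)"
      proof (rule l2_norm_cong_AE)
        show "AE x in lborel. S (q r) x = (S (a r) x - S (a t) x) / complex_of_real (r - t) - S (b t) x"
          unfolding q_def[abs_def]
          by (rule symmetric_difference_quotient) (use L sym a b elim t in auto)
      qed (use L qL a b elim t in \<open>auto intro!: L2_divide L2_diff\<close>)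
      with bd[OF qL] show ?case by (simp add: l2_norm_nonneg)
    qed
  qed
qed

lemma has_l2_time_derivative_diff:
  assumes d: "has_l2_time_derivative u v J" and d': "has_l2_time_derivative u' v' J"
    and L: "\<And>t. t \<in> J \<Longrightarrow> u t \<in> L2" "\<And>t. t \<in> J \<Longrightarrow> v t \<in> L2" "\<And>t. t \<in> J \<Longrightarrow> u' t \<in> L2" "\<And>t. t \<in> J \<Longrightarrow> v' t \<in> L2"
  shows "has_l2_time_derivative (\<lambda>t x. u t x - u' t x) (\<lambda>t x. v t x - v' t x) J"
  unfolding has_l2_time_derivative_def
proof
  fix t assume t: "t \<in> J"
  define q where "q r x = (u r x - u t x) / complex_of_real (r - t) - v t x" for r x
  define q' where "q' r x = (u' r x - u' t x) / complex_of_real (r - t) - v' t x" for r x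
  have "((\<lambda>r. l2_norm (q r) + l2_norm (q' r)) \<longlongrightarrow> 0 + 0) (at t within J)"
    using d d' t by (intro tendsto_add) (auto simp: has_l2_time_derivative_def q_def[abs_def] q'_def[abs_def])
  then have "((\<lambda>r. l2_norm (q r) + l2_norm (q' r)) \<longlongrightarrow> 0) (at t within J)"
    by simp
  then show "((\<lambda>r. l2_norm (\<lambda>x. ((u r x - u' r x) - (u t x - u' t x)) / complex_of_real (r - t) - (v t x - v' t x))) \<longlongrightarrow> 0) (at t within J)"
  proof (rule Lim_null_comparison[rotated])
    show "\<forall>\<^sub>F r in at t within J. norm (l2_norm (\<lambda>x. ((u r x - u' r x) - (u t x - u' t x)) / complex_of_real (r - t) - (v t x - v' t x)))
        \<le> l2_norm (q r) + l2_norm (q' r)"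
      using eventually_at_within_mem
    proof eventually_elim
      case (elim r)
      have qL: "q r \<in> L2" "q' r \<in> L2"
        using elim t by (auto simp: q_def[abs_def] q'_def[abs_def] intro!: L2_divide L2_diff L)
      have "(\<lambda>x. ((u r x - u' r x) - (u t x - u' t x)) / complex_of_real (r - t) - (v t x - v' t x)) = (\<lambda>x. q r x + (-1) * q' r x)"
        by (simp add: q_def q'_def fun_eq_iff diff_divide_distrib add_divide_distrib)
      then show ?case
        using l2_norm_triangle[OF qL(1) L2_cmult[OF qL(2), of "-1"]] l2_norm_cmult[of "-1" "q' r"]
        by (simp add: l2_norm_nonneg)
    qed
  qed
qed

lemma continuous_wrt_l2_norm_diff:
  assumes c: "continuous_wrt l2_norm J u" "continuous_wrt l2_norm J v"
    and L: "\<And>t. t \<in> J \<Longrightarrow> u t \<in> L2" "\<And>t. t \<in> J \<Longrightarrow> v t \<in> L2"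
  shows "continuous_wrt l2_norm J (\<lambda>t x. u t x - v t x)"
  unfolding continuous_wrt_def
proof
  fix t assume t: "t \<in> J"
  have "((\<lambda>r. l2_norm (\<lambda>x. u r x - u t x) + l2_norm (\<lambda>x. v r x - v t x)) \<longlongrightarrow> 0 + 0) (at t within J)"
    using c t by (intro tendsto_add) (auto simp: continuous_wrt_def)
  then have "((\<lambda>r. l2_norm (\<lambda>x. u r x - u t x) + l2_norm (\<lambda>x. v r x - v t x)) \<longlongrightarrow> 0) (at t within J)"
    by simp
  then show "((\<lambda>r. l2_norm (\<lambda>x. (u r x - v r x) - (u t x - v t x))) \<longlongrightarrow> 0) (at t within J)"
  proof (rule Lim_null_comparison[rotated])
    show "\<forall>\<^sub>F r in at t within J. norm (l2_norm (\<lambda>x. (u r x - v r x) - (u t x - v t x)))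
        \<le> l2_norm (\<lambda>x. u r x - u t x) + l2_norm (\<lambda>x. v r x - v t x)"
      using eventually_at_within_mem
    proof eventually_elim
      case (elim r)
      have "(\<lambda>x. (u r x - v r x) - (u t x - v t x)) = (\<lambda>x. (u r x - u t x) + (v t x - v r x))"
        by (simp add: fun_eq_iff)
      then show ?case
        using l2_norm_triangle[of "\<lambda>x. u r x - u t x" "\<lambda>x. v t x - v r x"] elim t L l2_norm_minus_commute[of "v t" "v r"]
        by (simp add: L2_diff l2_norm_nonneg)
    qed
  qed
qed

lemma continuous_wrt_l2_norm_bounded_mult:
  fixes q :: "'a::euclidean_space \<Rightarrow> real"
  assumes c: "continuous_wrt l2_norm J u" and L: "\<And>t. t \<in> J \<Longrightarrow> u t \<in> L2"
    and q: "q \<in> borel_measurable borel" "\<And>x. \<bar>q x\<bar> \<le> M"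
  shows "continuous_wrt l2_norm J (\<lambda>t x. complex_of_real (q x) * u t x)"
  unfolding continuous_wrt_def
proof
  fix t assume t: "t \<in> J"
  have "((\<lambda>r. M * l2_norm (\<lambda>x. u r x - u t x)) \<longlongrightarrow> M * 0) (at t within J)"
    using c t by (intro tendsto_mult tendsto_const) (auto simp: continuous_wrt_def)
  then have "((\<lambda>r. M * l2_norm (\<lambda>x. u r x - u t x)) \<longlongrightarrow> 0) (at t within J)"
    by simp
  then show "((\<lambda>r. l2_norm (\<lambda>x. complex_of_real (q x) * u r x - complex_of_real (q x) * u t x)) \<longlongrightarrow> 0) (at t within J)"
  proof (rule Lim_null_comparison[rotated])
    show "\<forall>\<^sub>F r in at t within J. norm (l2_norm (\<lambda>x. complex_of_real (q x) * u r x - complex_of_real (q x) * u t x))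
        \<le> M * l2_norm (\<lambda>x. u r x - u t x)"
      using eventually_at_within_mem
    proof eventually_elim
      case (elim r)
      then show ?case
        using L2_bounded_mult(2)[OF L2_diff[OF L L] q, of r t] t by (simp add: l2_norm_nonneg right_diff_distrib)
    qed
  qed
qed

lemma derivative_le_imp_le:
  fixes f g :: "real \<Rightarrow> real"
  assumes f: "\<And>t. t \<in> {0..T} \<Longrightarrow> (f has_real_derivative f' t) (at t within {0..T})"
    and g: "\<And>t. t \<in> {0..T} \<Longrightarrow> (g has_real_derivative g' t) (at t within {0..T})"
    and le: "\<And>t. t \<in> {0..T} \<Longrightarrow> f' t \<le> g' t" and 0: "f 0 \<le> g 0" and t: "t \<in> {0..T}"
  shows "f t \<le> g t"
proof -
  have d: "((\<lambda>t. g t - f t) has_real_derivative g' t - f' t) (at t within {0..T})" if "t \<in> {0..T}" for t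
    by (intro DERIV_diff f g that)
  have "g 0 - f 0 \<le> g t - f t"
  proof (rule DERIV_nonneg_imp_increasing_open[of 0 t "\<lambda>t. g t - f t"])
    show "0 \<le> t" using t by simp
    show "continuous_on {0..t} (\<lambda>t. g t - f t)"
      using t by (intro continuous_on_subset[OF DERIV_continuous_on[OF d]]) auto
    fix x assume x: "0 < x" "x < t"
    then have "((\<lambda>t. g t - f t) has_real_derivative g' x - f' x) (at x)"
      using d[of x] t at_within_interior[of x "{0..T}"] by simp
    then show "\<exists>y. ((\<lambda>t. g t - f t) has_real_derivative y) (at x) \<and> 0 \<le> y"
      using le[of x] x t by (intro exI[of _ "g' x - f' x"]) auto
  qed
  then show ?thesis using 0 by simp
qed

section \<open>Energy estimates for the truncated equation\<close>

context spectral_truncation begin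

text \<open>Moving \<open>C n\<close> to the side of \<open>h\<close> leaves a bound that depends on
  \<open>h\<close> through its norm only. This uniformity is what
  \<open>truncated_time_derivative\<close> lives on.\<close>

lemma C_norm_diff_inner:
  assumes "f \<in> L2" "g \<in> L2" "h \<in> L2"
  shows "cmod (l2_inner (C n f) (C n h) - l2_inner (C n g) (C n h)) \<le> (real n + 1)\<^sup>2 * l2_norm (\<lambda>x. f x - g x) * l2_norm h"
proof -
  have "l2_inner (C n f) (C n h) - l2_inner (C n g) (C n h) = l2_inner (\<lambda>x. f x - g x) (C n (C n h))"
    using assms by (simp add: C_sym C_L2 l2_inner_diff_left)
  also have "cmod \<dots> \<le> l2_norm (\<lambda>x. f x - g x) * l2_norm (C n (C n h))"
    by (intro l2_Cauchy_Schwarz L2_diff C_L2 assms)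
  also have "\<dots> \<le> l2_norm (\<lambda>x. f x - g x) * ((real n + 1) * ((real n + 1) * l2_norm h))"
    by (intro mult_left_mono order_trans[OF C_norm_le] C_norm_le C_L2 assms l2_norm_nonneg) auto
  finally show ?thesis by (simp add: power2_eq_square mult_ac)
qed

text \<open>The hypothesis differentiates one scalar function for each \<open>h\<close>. Those
  derivatives are continuous in time with a modulus proportional to the norm of \<open>h\<close>, so
  the mean value inequality controls the difference quotients uniformly in \<open>h\<close>, and
  \<open>l2_norm_leI\<close> gives differentiability in norm.\<close>

lemma truncated_time_derivative:
  assumes wL: "\<And>t. t \<in> J \<Longrightarrow> w t \<in> L2" and zL: "\<And>t. t \<in> J \<Longrightarrow> z t \<in> L2" and FL: "\<And>t. t \<in> J \<Longrightarrow> F t \<in> L2"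
    and wc: "continuous_wrt l2_norm J w" and Fc: "continuous_wrt l2_norm J F" and J: "convex J"
    and eq: "\<And>h t. h \<in> L2 \<Longrightarrow> t \<in> J \<Longrightarrow> ((\<lambda>t. l2_inner (z t) (P n h)) has_vector_derivative
      - (l2_inner (C n (w t)) (C n h) + l2_inner (F t) (P n h))) (at t within J)"
  shows "has_l2_time_derivative (\<lambda>t. P n (z t)) (\<lambda>t x. - C n (C n (w t)) x - P n (F t) x) J"
  unfolding has_l2_time_derivative_def
proof
  fix t assume t: "t \<in> J"
  define q where "q r x = (P n (z r) x - P n (z t) x) / complex_of_real (r - t) - (- C n (C n (w t)) x - P n (F t) x)" for r x
  \<comment> \<open>Multiplied by the norm of \<open>h\<close>, this bounds the change of the scalar
    derivative between \<open>t\<close> and \<open>r\<close>; the square stems from the two copies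
    of \<open>C n\<close>.\<close>
  define \<omega> where "\<omega> r = (real n + 1)\<^sup>2 * l2_norm (\<lambda>x. w r x - w t x) + l2_norm (\<lambda>x. F r x - F t x)" for r
  have "(\<omega> \<longlongrightarrow> (real n + 1)\<^sup>2 * 0 + 0) (at t within J)"
    unfolding \<omega>_def[abs_def] using wc Fc t
    by (intro tendsto_add tendsto_mult tendsto_const) (auto simp: continuous_wrt_def)
  then have \<omega>0: "(\<omega> \<longlongrightarrow> 0) (at t within J)" by simp
  have "((\<lambda>r. l2_norm (q r)) \<longlongrightarrow> 0) (at t within J)"
  proof (rule tendstoI)
    fix e :: real assume e: "0 < e"
    have "\<forall>\<^sub>F r in at t within J. \<omega> r < e / 2"
      using order_tendstoD(2)[OF \<omega>0, of "e / 2"] e by simp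
    then obtain d where d: "0 < d" and dom: "\<And>r. r \<in> J \<Longrightarrow> r \<noteq> t \<Longrightarrow> dist r t < d \<Longrightarrow> \<omega> r < e / 2"
      unfolding eventually_at by blast
    have \<omega>: "\<omega> r \<le> e / 2" if "r \<in> J \<inter> ball t d" for r
      using that dom[of r] e by (cases "r = t") (auto simp: \<omega>_def l2_norm_zero dist_commute)
    have half: "l2_norm (q r) \<le> e / 2" if r: "r \<in> J" "r \<noteq> t" "dist r t < d" for r
    proof (rule l2_norm_leI)
      show "q r \<in> L2"
        using L2_diff[OF L2_divide[OF L2_diff[OF P_L2 P_L2], of "z r" "z t" n n "complex_of_real (r - t)"]
          L2_diff[OF L2_cmult[OF C_L2[OF C_L2], of "w t" "-1" n n] P_L2, of "F t" n]] wL zL FL r t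
        by (simp add: q_def[abs_def])
      fix h :: "'a \<Rightarrow> complex" assume h: "h \<in> L2"
      define g where "g \<rho> = - (l2_inner (C n (w \<rho>)) (C n h) + l2_inner (F \<rho>) (P n h))" for \<rho>
      \<comment> \<open>The mean value inequality needs the segment from \<open>t\<close> to
        \<open>r\<close> to stay where \<omega> is small; hence a convex neighbourhood of
        \<open>t\<close> in \<open>J\<close>.\<close>
      define S where "S = J \<inter> ball t d"
      have tS: "t \<in> S" and rS: "r \<in> S" and cS: "convex S"
        using t r d J by (auto simp: S_def dist_commute intro: convex_Int)
      have B: "norm (g \<rho> - g t) \<le> e / 2 * l2_norm h" if \<rho>: "\<rho> \<in> S" for \<rho>
      proof -
        have \<rho>J: "\<rho> \<in> J" using \<rho> by (simp add: S_def)
        have "norm (g \<rho> - g t) \<le> cmod (l2_inner (C n (w \<rho>)) (C n h) - l2_inner (C n (w t)) (C n h))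
            + cmod (l2_inner (F \<rho>) (P n h) - l2_inner (F t) (P n h))"
          using norm_triangle_ineq4[of "- (l2_inner (C n (w \<rho>)) (C n h) - l2_inner (C n (w t)) (C n h))"
              "l2_inner (F \<rho>) (P n h) - l2_inner (F t) (P n h)"]
          by (simp add: g_def norm_minus_commute algebra_simps)
        also have "cmod (l2_inner (C n (w \<rho>)) (C n h) - l2_inner (C n (w t)) (C n h)) \<le> (real n + 1)\<^sup>2 * l2_norm (\<lambda>x. w \<rho> x - w t x) * l2_norm h"
          by (intro C_norm_diff_inner wL \<rho>J t h)
        also have "cmod (l2_inner (F \<rho>) (P n h) - l2_inner (F t) (P n h)) \<le> l2_norm (\<lambda>x. F \<rho> x - F t x) * l2_norm (P n h)"
          using l2_Cauchy_Schwarz[OF L2_diff[OF FL FL] P_L2[OF h], of \<rho> t n] \<rho>J t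
          by (simp add: l2_inner_diff_left FL P_L2 h)
        also have "l2_norm (\<lambda>x. F \<rho> x - F t x) * l2_norm (P n h) \<le> l2_norm (\<lambda>x. F \<rho> x - F t x) * l2_norm h"
          by (intro mult_left_mono P_norm_le h l2_norm_nonneg)
        finally have "norm (g \<rho> - g t) \<le> \<omega> \<rho> * l2_norm h"
          by (simp add: \<omega>_def algebra_simps)
        also have "\<dots> \<le> e / 2 * l2_norm h"
          using \<omega>[of \<rho>] \<rho> by (intro mult_right_mono l2_norm_nonneg) (simp add: S_def)
        finally show ?thesis .
      qed
      have "norm (l2_inner (z r) (P n h) - l2_inner (z t) (P n h) - (r - t) *\<^sub>R g t) \<le> norm (r - t) * (e / 2 * l2_norm h)"
      proof (rule vector_differentiable_bound_linearization[of S _ g t r t])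
        show "((\<lambda>t. l2_inner (z t) (P n h)) has_vector_derivative g \<rho>) (at \<rho> within S)" if "\<rho> \<in> S" for \<rho>
          unfolding g_def by (rule has_vector_derivative_within_subset[OF eq[OF h]]) (use that in \<open>auto simp: S_def\<close>)
        show "closed_segment t r \<subseteq> S"
          by (rule closed_segment_subset[OF tS rS cS])
      qed (use B tS in auto)
      moreover have "l2_inner (q r) h = (l2_inner (z r) (P n h) - l2_inner (z t) (P n h) - (r - t) *\<^sub>R g t) / complex_of_real (r - t)"
      proof -
        have "(\<lambda>x. - C n (C n (w t)) x - P n (F t) x) = (\<lambda>x. (-1) * C n (C n (w t)) x - P n (F t) x)" by simp
        moreover have "l2_inner (\<lambda>x. (-1) * C n (C n (w t)) x - P n (F t) x) h = g t"
          using wL[OF t] FL[OF t] h L2_cmult[OF C_L2[OF C_L2[OF wL[OF t]]], of "-1" n n]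
          by (simp add: g_def l2_inner_diff_left P_L2 C_L2 l2_inner_cmult_left[of "-1", simplified] C_sym P_sym del: mult_minus_left mult_1)
        ultimately have "l2_inner (\<lambda>x. - C n (C n (w t)) x - P n (F t) x) h = g t" by simp
        moreover have "(\<lambda>x. - C n (C n (w t)) x - P n (F t) x) \<in> L2"
          using L2_diff[OF L2_cmult[OF C_L2[OF C_L2[OF wL[OF t]]], of "-1" n n] P_L2[OF FL[OF t]], of n] by simp
        ultimately have "l2_inner (q r) h = l2_inner (\<lambda>x. P n (z r) x - P n (z t) x) h / complex_of_real (r - t) - g t"
          using zL[OF t] zL[OF r(1)] h
          unfolding q_def[abs_def] by (simp add: l2_inner_diff_left L2_diff L2_divide P_L2 l2_inner_divide_left)
        also have "\<dots> = (l2_inner (z r) (P n h) - l2_inner (z t) (P n h)) / complex_of_real (r - t) - g t"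
          using zL[OF t] zL[OF r(1)] h by (simp add: l2_inner_diff_left P_L2 P_sym)
        also have "\<dots> = (l2_inner (z r) (P n h) - l2_inner (z t) (P n h) - (r - t) *\<^sub>R g t) / complex_of_real (r - t)"
          using r(2) by (simp add: scaleR_conv_of_real diff_divide_distrib)
        finally show ?thesis .
      qed
      ultimately show "cmod (l2_inner (q r) h) \<le> e / 2 * l2_norm h"
        using r(2) by (simp add: norm_divide norm_of_real del: of_real_diff) (simp add: field_simps)
    qed (use e in simp)
    have "dist (l2_norm (q r)) 0 < e" if "r \<in> J" "r \<noteq> t" "dist r t < d" for r
      using half[OF that] e by (simp add: l2_norm_nonneg)
    then show "\<forall>\<^sub>F r in at t within J. dist (l2_norm (q r)) 0 < e"
      unfolding eventually_at using d by blast
  qed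
  then show "((\<lambda>r. l2_norm (\<lambda>x. (P n (z r) x - P n (z t) x) / complex_of_real (r - t) - (- C n (C n (w t)) x - P n (F t) x))) \<longlongrightarrow> 0) (at t within J)"
    unfolding q_def[abs_def] .
qed

lemma energy_inequality:
  assumes T: "0 < T"
    and wL: "\<And>t. t \<in> {0..T} \<Longrightarrow> w t \<in> L2" and zL: "\<And>t. t \<in> {0..T} \<Longrightarrow> z t \<in> L2" and FL: "\<And>t. t \<in> {0..T} \<Longrightarrow> F t \<in> L2"
    and wd: "has_l2_time_derivative w z {0..T}"
    and zc: "continuous_wrt l2_norm {0..T} z" and Fc: "continuous_wrt l2_norm {0..T} F"
    and w0: "l2_norm (w 0) = 0" and z0: "l2_norm (z 0) = 0"
    and eq: "\<And>n h t. h \<in> L2 \<Longrightarrow> t \<in> {0..T} \<Longrightarrow> ((\<lambda>t. l2_inner (z t) (P n h)) has_vector_derivative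
      - (l2_inner (C n (w t)) (C n h) + l2_inner (F t) (P n h))) (at t within {0..T})"
    and t: "t \<in> {0..T}"
  shows "(l2_norm (z t))\<^sup>2 \<le> integral {0..t} (\<lambda>r. 2 * l2_norm (F r) * l2_norm (z r))"
proof -
  have wc: "continuous_wrt l2_norm {0..T} w"
    by (rule has_l2_time_derivative_imp_continuous[OF wd wL zL])
  have cont: "continuous_on {0..T} (\<lambda>r. 2 * l2_norm (F r) * l2_norm (z r))"
    by (intro continuous_intros continuous_wrt_l2_norm zc Fc zL FL)
  have "(l2_norm (P n (z t)))\<^sup>2 \<le> integral {0..t} (\<lambda>r. 2 * l2_norm (F r) * l2_norm (z r))" for n
  proof -
    define G where "G t x = - C n (C n (w t)) x - P n (F t) x" for t x
    have GL: "G t \<in> L2" if "t \<in> {0..T}" for t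
      using L2_diff[OF L2_cmult[OF C_L2[OF C_L2[OF wL[OF that]]], of "-1" n n] P_L2[OF FL[OF that]], of n]
      by (simp add: G_def[abs_def])
    have Pz: "has_l2_time_derivative (\<lambda>t. P n (z t)) G {0..T}"
      unfolding G_def[abs_def] by (rule truncated_time_derivative[OF wL zL FL wc Fc _ eq]) auto
    have Cw: "has_l2_time_derivative (\<lambda>t. C n (w t)) (\<lambda>t. C n (z t)) {0..T}"
      by (rule has_l2_time_derivative_map[OF C_L2 C_sym C_norm_le wd wL zL])
    have e: "((\<lambda>t. (l2_norm (P n (z t)))\<^sup>2 + (l2_norm (C n (w t)))\<^sup>2) has_real_derivative
        2 * Re (l2_inner (G t) (P n (z t))) + 2 * Re (l2_inner (C n (z t)) (C n (w t)))) (at t within {0..T})"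
      if "t \<in> {0..T}" for t
      by (intro DERIV_add has_l2_time_derivative_norm_square[OF Pz] has_l2_time_derivative_norm_square[OF Cw] P_L2 C_L2 zL wL GL that)
    have I: "((\<lambda>t. integral {0..t} (\<lambda>r. 2 * l2_norm (F r) * l2_norm (z r))) has_real_derivative
        2 * l2_norm (F t) * l2_norm (z t)) (at t within {0..T})" if "t \<in> {0..T}" for t
      by (rule integral_has_real_derivative[OF cont that])
    have le: "2 * Re (l2_inner (G t) (P n (z t))) + 2 * Re (l2_inner (C n (z t)) (C n (w t)))
        \<le> 2 * l2_norm (F t) * l2_norm (z t)" if "t \<in> {0..T}" for t
    proof -
      note L = wL[OF that] zL[OF that] FL[OF that]
      have "l2_inner (G t) (P n (z t)) = (-1) * l2_inner (C n (C n (w t))) (P n (z t)) - l2_inner (P n (F t)) (P n (z t))"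
        using l2_inner_diff_left[OF L2_cmult[OF C_L2[OF C_L2[OF L(1)]], of "-1" n n] P_L2[OF L(3)] P_L2[OF L(2)], of n n]
        by (simp only: l2_inner_cmult_left) (simp add: G_def[abs_def])
      \<comment> \<open>\<open>C n\<close> is symmetric and absorbs \<open>P n\<close>. The result
        cancels against the derivative of the squared norm of \<open>C n (w t)\<close>.\<close>
      also have "l2_inner (C n (C n (w t))) (P n (z t)) = l2_inner (C n (w t)) (C n (z t))"
      proof -
        have "l2_inner (C n (C n (w t))) (P n (z t)) = l2_inner (C n (w t)) (C n (P n (z t)))"
          by (simp add: C_sym C_L2 P_L2 L)
        also have "\<dots> = l2_inner (C n (w t)) (C n (z t))"
          using C_P_inner[OF L(2) C_L2[OF L(1)], of n n] l2_inner_commute by metis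
        finally show ?thesis .
      qed
      also have "l2_inner (P n (F t)) (P n (z t)) = l2_inner (F t) (P n (z t))"
      proof -
        have "l2_inner (P n (F t)) (P n (z t)) = l2_inner (F t) (P n (P n (z t)))"
          by (simp add: P_sym P_L2 L)
        also have "\<dots> = l2_inner (F t) (P n (z t))"
          using P_P_inner[OF L(2) L(3), of n] l2_inner_commute by metis
        finally show ?thesis .
      qed
      finally have "Re (l2_inner (G t) (P n (z t))) = - Re (l2_inner (C n (w t)) (C n (z t))) - Re (l2_inner (F t) (P n (z t)))"
        by simp
      moreover have "Re (l2_inner (C n (w t)) (C n (z t))) = Re (l2_inner (C n (z t)) (C n (w t)))"
        using l2_inner_commute[of "C n (w t)" "C n (z t)"] by simp
      moreover have "- Re (l2_inner (F t) (P n (z t))) \<le> l2_norm (F t) * l2_norm (z t)"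
      proof -
        have "- Re (l2_inner (F t) (P n (z t))) \<le> cmod (l2_inner (F t) (P n (z t)))"
          using abs_Re_le_cmod[of "l2_inner (F t) (P n (z t))"] by linarith
        also have "\<dots> \<le> l2_norm (F t) * l2_norm (P n (z t))"
          by (intro l2_Cauchy_Schwarz P_L2 L)
        also have "\<dots> \<le> l2_norm (F t) * l2_norm (z t)"
          by (intro mult_left_mono P_norm_le L l2_norm_nonneg)
        finally show ?thesis .
      qed
      ultimately show ?thesis by simp
    qed
    have 00: "0 \<in> {0..T}" using T by simp
    have "l2_norm (P n (z 0)) = 0" "l2_norm (C n (w 0)) = 0"
      using P_norm_le[OF zL[OF 00], of n] C_norm_le[OF wL[OF 00], of n] l2_norm_nonneg[of "P n (z 0)"] l2_norm_nonneg[of "C n (w 0)"]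
      by (auto simp: w0 z0)
    then have "(l2_norm (P n (z t)))\<^sup>2 + (l2_norm (C n (w t)))\<^sup>2 \<le> integral {0..t} (\<lambda>r. 2 * l2_norm (F r) * l2_norm (z r))"
      by (intro derivative_le_imp_le[OF e I le _ t]) auto
    then show ?thesis
      using zero_le_power2[of "l2_norm (C n (w t))"] by linarith
  qed
  then show ?thesis
    by (intro LIMSEQ_le_const2[OF P_norm_tendsto[OF zL[OF t]]]) auto
qed

text \<open>Elements \<open>P n h\<close> are admissible in the weak equation for every
  \<open>h\<close>, by \<open>P_Domain\<close>. For them both the derivative and the potential terms
  are continuous in time, so the distributional equation holds pointwise up to the end points 0 and
  T.\<close>

lemma weak_solution_truncated:
  fixes \<psi> :: "'b::euclidean_space \<Rightarrow> real" and q :: "'a \<Rightarrow> real"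
  assumes psi: "\<psi> \<in> test_functions UNIV" "\<And>x. 0 \<le> \<psi> x" "\<psi> x0 \<noteq> 0"
    and T: "0 < T" and q: "q \<in> borel_measurable borel" "\<And>x. \<bar>q x\<bar> \<le> M"
    and sol: "weak_solution (spectral_integral E \<phi>) T q u0 u1 u"
  obtains v where "\<And>t. t \<in> {0..T} \<Longrightarrow> u t \<in> L2" "\<And>t. t \<in> {0..T} \<Longrightarrow> v t \<in> L2"
    "continuous_wrt l2_norm {0..T} v" "has_l2_time_derivative u v {0..T}"
    "AE x in lborel. u 0 x = u0 x" "AE x in lborel. v 0 x = u1 x"
    "\<And>n h t. h \<in> L2 \<Longrightarrow> t \<in> {0..T} \<Longrightarrow> ((\<lambda>t. l2_inner (v t) (P n h)) has_vector_derivative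
      - (l2_inner (C n (u t)) (C n h) + l2_inner (\<lambda>x. complex_of_real (q x) * u t x) (P n h))) (at t within {0..T})"
proof -
  let ?B = "spectral_integral E \<phi>"
  from sol obtain v where uD: "\<And>t. t \<in> {0..T} \<Longrightarrow> u t \<in> Domain ?B" and u0: "AE x in lborel. u 0 x = u0 x"
    and vL: "\<And>t. t \<in> {0..T} \<Longrightarrow> v t \<in> L2" and vc: "continuous_wrt l2_norm {0..T} v"
    and ud: "has_l2_time_derivative u v {0..T}" and v0: "AE x in lborel. v 0 x = u1 x"
    and weak: "\<And>\<phi> \<eta>. \<phi> \<in> Domain ?B \<Longrightarrow> \<eta> \<in> test_functions {0<..<T} \<Longrightarrow>
         integral {0..T} (\<lambda>t.
               - l2_inner (v t) \<phi> * vector_derivative \<eta> (at t) +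
               (l2_inner (op_apply ?B (u t)) (op_apply ?B \<phi>) +
                l2_inner (\<lambda>x. complex_of_real (q x) * u t x) \<phi>) * \<eta> t) = 0"
    unfolding weak_solution_def by blast
  have uL: "u t \<in> L2" if "t \<in> {0..T}" for t
    by (rule Domain_L2[OF uD[OF that]])
  have uc: "continuous_wrt l2_norm {0..T} u"
    by (rule has_l2_time_derivative_imp_continuous[OF ud uL vL])
  have qc: "continuous_wrt l2_norm {0..T} (\<lambda>t x. complex_of_real (q x) * u t x)"
    by (rule continuous_wrt_l2_norm_bounded_mult[OF uc uL q])
  have "((\<lambda>t. l2_inner (v t) (P n h)) has_vector_derivative
      - (l2_inner (C n (u t)) (C n h) + l2_inner (\<lambda>x. complex_of_real (q x) * u t x) (P n h))) (at t within {0..T})"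
    if h: "h \<in> L2" and t: "t \<in> {0..T}" for n h t
  proof (rule weak_derivative_imp_derivative[OF psi T _ _ _ t])
    show "continuous_on {0..T} (\<lambda>t. l2_inner (v t) (P n h))"
      by (intro continuous_wrt_l2_inner vc vL P_L2 h)
    \<comment> \<open>Both copies of \<open>C n\<close> are put on the fixed \<open>h\<close>, so
      that only norm continuity of \<open>u\<close> is used.\<close>
    have "continuous_on {0..T} (\<lambda>t. l2_inner (u t) (C n (C n h)) + l2_inner (\<lambda>x. complex_of_real (q x) * u t x) (P n h))"
      by (intro continuous_on_add continuous_wrt_l2_inner uc uL qc L2_bounded_mult(1)[OF _ q] P_L2 C_L2 h)
    also have "?this \<longleftrightarrow> continuous_on {0..T} (\<lambda>t. l2_inner (C n (u t)) (C n h) + l2_inner (\<lambda>x. complex_of_real (q x) * u t x) (P n h))"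
      by (intro continuous_on_cong refl) (simp add: C_sym uL C_L2 h)
    finally show "continuous_on {0..T} (\<lambda>t. l2_inner (C n (u t)) (C n h) + l2_inner (\<lambda>x. complex_of_real (q x) * u t x) (P n h))" .
    fix \<eta> :: "real \<Rightarrow> complex" assume \<eta>: "\<eta> \<in> test_functions {0<..<T}"
    have "integral {0..T} (\<lambda>t. - l2_inner (v t) (P n h) * vector_derivative \<eta> (at t) +
          (l2_inner (C n (u t)) (C n h) + l2_inner (\<lambda>x. complex_of_real (q x) * u t x) (P n h)) * \<eta> t)
        = integral {0..T} (\<lambda>t. - l2_inner (v t) (P n h) * vector_derivative \<eta> (at t) +
               (l2_inner (op_apply ?B (u t)) (op_apply ?B (P n h)) +
                l2_inner (\<lambda>x. complex_of_real (q x) * u t x) (P n h)) * \<eta> t)"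
      by (rule integral_cong) (simp only: op_apply_inner[OF uD h])
    also have "\<dots> = 0"
      by (rule weak[OF P_Domain[OF h] \<eta>])
    finally show "integral {0..T} (\<lambda>t. - l2_inner (v t) (P n h) * vector_derivative \<eta> (at t) +
          (l2_inner (C n (u t)) (C n h) + l2_inner (\<lambda>x. complex_of_real (q x) * u t x) (P n h)) * \<eta> t) = 0" .
  qed
  then show ?thesis
    using that[OF uL vL vc ud u0 v0] by blast
qed

text \<open>Gronwall's inequality for \<open>I(t) + \<parallel>w(t)\<parallel>\<^sup>2\<close>, where \<open>I(t) = \<integral>\<^sub>0\<^sup>t 2 \<parallel>F\<parallel> \<parallel>z\<parallel>\<close> dominates \<open>\<parallel>z(t)\<parallel>\<^sup>2\<close>.\<close>

lemma energy_gronwall: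
  assumes T: "0 < T" and M: "0 \<le> M"
    and wL: "\<And>t. t \<in> {0..T} \<Longrightarrow> w t \<in> L2" and zL: "\<And>t. t \<in> {0..T} \<Longrightarrow> z t \<in> L2" and FL: "\<And>t. t \<in> {0..T} \<Longrightarrow> F t \<in> L2"
    and wd: "has_l2_time_derivative w z {0..T}"
    and zc: "continuous_wrt l2_norm {0..T} z" and Fc: "continuous_wrt l2_norm {0..T} F"
    and w0: "l2_norm (w 0) = 0" and z0: "l2_norm (z 0) = 0"
    and eq: "\<And>n h t. h \<in> L2 \<Longrightarrow> t \<in> {0..T} \<Longrightarrow> ((\<lambda>t. l2_inner (z t) (P n h)) has_vector_derivative
      - (l2_inner (C n (w t)) (C n h) + l2_inner (F t) (P n h))) (at t within {0..T})"
    and F: "\<And>t. t \<in> {0..T} \<Longrightarrow> l2_norm (F t) \<le> M * l2_norm (w t) + d"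
    and t: "t \<in> {0..T}"
  shows "(l2_norm (w t))\<^sup>2 \<le> d\<^sup>2 / (M + 2) * exp ((M + 2) * T)"
proof -
  \<comment> \<open>Below, 2ab is split into a^2 + b^2 with weight M + 1 and 2db into d^2 + b^2, so
    b^2 collects the factor M + 2.\<close>
  define K where "K = M + 2"
  have K: "0 < K" using M by (simp add: K_def)
  define I where "I t = integral {0..t} (\<lambda>r. 2 * l2_norm (F r) * l2_norm (z r))" for t
  have cont: "continuous_on {0..T} (\<lambda>r. 2 * l2_norm (F r) * l2_norm (z r))"
    by (intro continuous_intros continuous_wrt_l2_norm zc Fc zL FL)
  have Id: "(I has_real_derivative 2 * l2_norm (F t) * l2_norm (z t)) (at t within {0..T})" if "t \<in> {0..T}" for t
    unfolding I_def[abs_def] by (rule integral_has_real_derivative[OF cont that])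
  have zI: "(l2_norm (z t))\<^sup>2 \<le> I t" if "t \<in> {0..T}" for t
    unfolding I_def using T by (intro energy_inequality[OF _ wL zL FL wd zc Fc w0 z0 eq that])
  define y where "y t = I t + (l2_norm (w t))\<^sup>2" for t
  define y' where "y' t = 2 * l2_norm (F t) * l2_norm (z t) + 2 * Re (l2_inner (z t) (w t))" for t
  have yd: "(y has_real_derivative y' t) (at t within {0..T})" if "t \<in> {0..T}" for t
    unfolding y_def[abs_def] y'_def
    by (intro DERIV_add Id has_l2_time_derivative_norm_square[OF wd] wL zL that)
  have y'_le: "y' t \<le> K * y t + d\<^sup>2" if t: "t \<in> {0..T}" for t
  proof -
    define a where "a = l2_norm (w t)"
    define b where "b = l2_norm (z t)"
    have nn: "0 \<le> a" "0 \<le> b" unfolding a_def b_def by (auto simp: l2_norm_nonneg)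
    have "Re (l2_inner (z t) (w t)) \<le> b * a"
      using l2_Cauchy_Schwarz[OF zL wL, OF t t] complex_Re_le_cmod[of "l2_inner (z t) (w t)"] by (simp add: a_def b_def)
    moreover have "l2_norm (F t) * b \<le> (M * a + d) * b"
      using F[OF t] nn by (intro mult_right_mono) (auto simp: a_def)
    ultimately have "y' t \<le> 2 * ((M * a + d) * b) + 2 * (b * a)"
      unfolding y'_def b_def[symmetric] by linarith
    also have "\<dots> = (M + 1) * (2 * a * b) + 2 * d * b"
      by (simp add: algebra_simps)
    also have "\<dots> \<le> (M + 1) * (a\<^sup>2 + b\<^sup>2) + (d\<^sup>2 + b\<^sup>2)"
      using M by (intro add_mono mult_left_mono sum_squares_bound) auto
    also have "\<dots> = (M + 1) * a\<^sup>2 + K * b\<^sup>2 + d\<^sup>2"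
      by (simp add: K_def algebra_simps)
    also have "\<dots> \<le> K * a\<^sup>2 + K * I t + d\<^sup>2"
      using zI[OF t] K by (intro add_mono mult_left_mono mult_right_mono) (auto simp: K_def b_def)
    also have "\<dots> = K * y t + d\<^sup>2"
      by (simp add: y_def a_def algebra_simps)
    finally show ?thesis .
  qed
  \<comment> \<open>Shifting \<open>y\<close> by d^2/K absorbs the inhomogeneous term: with the
    integrating factor the derivative is (y' - K y - d^2) exp(-Kt), which is nonpositive.\<close>
  have "(y t + d\<^sup>2 / K) * exp (- K * t) \<le> d\<^sup>2 / K"
  proof (rule derivative_le_imp_le[where f="\<lambda>t. (y t + d\<^sup>2 / K) * exp (- K * t)" and g="\<lambda>_. d\<^sup>2 / K" and T=T])
    show "((\<lambda>t. (y t + d\<^sup>2 / K) * exp (- K * t)) has_real_derivative (y' t - K * y t - d\<^sup>2) * exp (- K * t)) (at t within {0..T})"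
      if "t \<in> {0..T}" for t
      using K by (auto intro!: derivative_eq_intros yd that simp: field_simps)
    show "((\<lambda>_. d\<^sup>2 / K) has_real_derivative 0) (at t within {0..T})" for t
      by simp
    show "(y' t - K * y t - d\<^sup>2) * exp (- K * t) \<le> 0" if "t \<in> {0..T}" for t
      using y'_le[OF that] by (intro mult_nonpos_nonneg) auto
    show "(y 0 + d\<^sup>2 / K) * exp (- K * 0) \<le> d\<^sup>2 / K"
      by (simp add: y_def I_def w0)
  qed (rule t)
  then have "y t + d\<^sup>2 / K \<le> d\<^sup>2 / K * exp (K * t)"
    by (simp add: exp_minus field_simps)
  also have "\<dots> \<le> d\<^sup>2 / K * exp (K * T)"
    using t K by (intro mult_left_mono) auto
  finally have "y t + d\<^sup>2 / K \<le> d\<^sup>2 / K * exp (K * T)" .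
  moreover have "0 \<le> d\<^sup>2 / K" using K by simp
  moreover have "0 \<le> I t" using zI[OF t] zero_le_power2[of "l2_norm (z t)"] by linarith
  ultimately have "(l2_norm (w t))\<^sup>2 \<le> d\<^sup>2 / K * exp (K * T)"
    by (simp add: y_def)
  then show ?thesis by (simp add: K_def)
qed

text \<open>The forcing term is split as q'u' - qu = q'w + (q' - q)u. The small factor then
  multiplies the fixed solution \<open>u\<close>, so the bound \<open>U\<close> is asked of
  \<open>u\<close> alone and not of the solutions \<open>u'\<close> that vary with the
  regularisation.\<close>

lemma weak_solution_stability:
  fixes \<psi> :: "'b::euclidean_space \<Rightarrow> real" and q q' :: "'a \<Rightarrow> real"
  assumes psi: "\<psi> \<in> test_functions UNIV" "\<And>x. 0 \<le> \<psi> x" "\<psi> x0 \<noteq> 0"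
    and T: "0 < T"
    and q: "q \<in> borel_measurable borel" "\<And>x. \<bar>q x\<bar> \<le> M"
    and q': "q' \<in> borel_measurable borel" "\<And>x. \<bar>q' x\<bar> \<le> M"
    and qq': "\<And>x. \<bar>q' x - q x\<bar> \<le> \<delta>"
    and sol: "weak_solution (spectral_integral E \<phi>) T q u0 u1 u"
    and sol': "weak_solution (spectral_integral E \<phi>) T q' u0 u1 u'"
    and U: "\<And>t. t \<in> {0..T} \<Longrightarrow> l2_norm (u t) \<le> U"
    and t: "t \<in> {0..T}"
  shows "(l2_norm (\<lambda>x. u' t x - u t x))\<^sup>2 \<le> (\<delta> * U)\<^sup>2 / (M + 2) * exp ((M + 2) * T)"
proof -
  obtain v where uL: "\<And>t. t \<in> {0..T} \<Longrightarrow> u t \<in> L2" and vL: "\<And>t. t \<in> {0..T} \<Longrightarrow> v t \<in> L2"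
    and vc: "continuous_wrt l2_norm {0..T} v" and ud: "has_l2_time_derivative u v {0..T}"
    and u0: "AE x in lborel. u 0 x = u0 x" and v0: "AE x in lborel. v 0 x = u1 x"
    and eq: "\<And>n h t. h \<in> L2 \<Longrightarrow> t \<in> {0..T} \<Longrightarrow> ((\<lambda>t. l2_inner (v t) (P n h)) has_vector_derivative
      - (l2_inner (C n (u t)) (C n h) + l2_inner (\<lambda>x. complex_of_real (q x) * u t x) (P n h))) (at t within {0..T})"
    using weak_solution_truncated[OF psi T q sol] by blast
  obtain v' where uL': "\<And>t. t \<in> {0..T} \<Longrightarrow> u' t \<in> L2" and vL': "\<And>t. t \<in> {0..T} \<Longrightarrow> v' t \<in> L2"
    and vc': "continuous_wrt l2_norm {0..T} v'" and ud': "has_l2_time_derivative u' v' {0..T}"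
    and u0': "AE x in lborel. u' 0 x = u0 x" and v0': "AE x in lborel. v' 0 x = u1 x"
    and eq': "\<And>n h t. h \<in> L2 \<Longrightarrow> t \<in> {0..T} \<Longrightarrow> ((\<lambda>t. l2_inner (v' t) (P n h)) has_vector_derivative
      - (l2_inner (C n (u' t)) (C n h) + l2_inner (\<lambda>x. complex_of_real (q' x) * u' t x) (P n h))) (at t within {0..T})"
    using weak_solution_truncated[OF psi T q' sol'] by blast
  define w where "w t x = u' t x - u t x" for t x
  define z where "z t x = v' t x - v t x" for t x
  define F where "F t x = complex_of_real (q' x) * u' t x - complex_of_real (q x) * u t x" for t x
  have M: "0 \<le> M" using q(2)[of 0] by linarith
  have \<delta>: "0 \<le> \<delta>" using qq'[of 0] by linarith
  have wL: "w t \<in> L2" and zL: "z t \<in> L2" and FL: "F t \<in> L2" if "t \<in> {0..T}" for t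
    unfolding w_def z_def F_def by (intro L2_diff L2_bounded_mult(1)[OF _ q] L2_bounded_mult(1)[OF _ q'] uL uL' vL vL' that)+
  have uc: "continuous_wrt l2_norm {0..T} u" and uc': "continuous_wrt l2_norm {0..T} u'"
    by (rule has_l2_time_derivative_imp_continuous[OF ud uL vL], assumption+)
       (rule has_l2_time_derivative_imp_continuous[OF ud' uL' vL'], assumption+)
  have "(l2_norm (w t))\<^sup>2 \<le> (\<delta> * U)\<^sup>2 / (M + 2) * exp ((M + 2) * T)"
  proof (rule energy_gronwall[OF T M wL zL FL _ _ _ _ _ _ _ t])
    show "has_l2_time_derivative w z {0..T}"
      unfolding w_def[abs_def] z_def[abs_def] by (rule has_l2_time_derivative_diff[OF ud' ud uL' vL' uL vL])
    show "continuous_wrt l2_norm {0..T} z"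
      unfolding z_def[abs_def] by (rule continuous_wrt_l2_norm_diff[OF vc' vc vL' vL])
    show "continuous_wrt l2_norm {0..T} F"
      unfolding F_def[abs_def]
      by (intro continuous_wrt_l2_norm_diff continuous_wrt_l2_norm_bounded_mult[OF uc uL q]
          continuous_wrt_l2_norm_bounded_mult[OF uc' uL' q'] L2_bounded_mult(1)[OF _ q] L2_bounded_mult(1)[OF _ q'] uL uL')
    have 0: "0 \<in> {0..T}" using T by simp
    have "AE x in lborel. w 0 x = 0"
      using u0 u0' by eventually_elim (simp add: w_def)
    then show "l2_norm (w 0) = 0" using l2_norm_eq_0_iff[OF wL[OF 0]] by simp
    have "AE x in lborel. z 0 x = 0"
      using v0 v0' by eventually_elim (simp add: z_def)
    then show "l2_norm (z 0) = 0" using l2_norm_eq_0_iff[OF zL[OF 0]] by simp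
  next
    fix n :: nat and t and h :: "'a \<Rightarrow> complex" assume h: "h \<in> L2" and t: "t \<in> {0..T}"
    have d: "((\<lambda>t. l2_inner (v' t) (P n h) - l2_inner (v t) (P n h)) has_vector_derivative
      - (l2_inner (C n (u' t)) (C n h) + l2_inner (\<lambda>x. complex_of_real (q' x) * u' t x) (P n h))
      - - (l2_inner (C n (u t)) (C n h) + l2_inner (\<lambda>x. complex_of_real (q x) * u t x) (P n h))) (at t within {0..T})"
      by (intro has_vector_derivative_diff eq eq' h t)
    have zr: "l2_inner (z r) (P n h) = l2_inner (v' r) (P n h) - l2_inner (v r) (P n h)" if "r \<in> {0..T}" for r
      unfolding z_def by (intro l2_inner_diff_left vL vL' P_L2 h that)
    have cw: "l2_inner (C n (w t)) (C n h) = l2_inner (C n (u' t)) (C n h) - l2_inner (C n (u t)) (C n h)"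
    proof -
      have "l2_inner (C n (w t)) (C n h) = l2_inner (w t) (C n (C n h))"
        by (intro C_sym wL C_L2 h t)
      also have "\<dots> = l2_inner (u' t) (C n (C n h)) - l2_inner (u t) (C n (C n h))"
        unfolding w_def by (intro l2_inner_diff_left uL uL' C_L2 h t)
      finally show ?thesis
        by (simp only: C_sym[OF uL[OF t] C_L2[OF h]] C_sym[OF uL'[OF t] C_L2[OF h]])
    qed
    have ff: "l2_inner (F t) (P n h) = l2_inner (\<lambda>x. complex_of_real (q' x) * u' t x) (P n h) - l2_inner (\<lambda>x. complex_of_real (q x) * u t x) (P n h)"
      unfolding F_def by (intro l2_inner_diff_left L2_bounded_mult(1)[OF _ q] L2_bounded_mult(1)[OF _ q'] uL uL' P_L2 h t)
    have "- (l2_inner (C n (u' t)) (C n h) + l2_inner (\<lambda>x. complex_of_real (q' x) * u' t x) (P n h))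
      - - (l2_inner (C n (u t)) (C n h) + l2_inner (\<lambda>x. complex_of_real (q x) * u t x) (P n h))
      = - (l2_inner (C n (w t)) (C n h) + l2_inner (F t) (P n h))"
      unfolding cw ff by simp
    from has_vector_derivative_transform[OF t zr d[unfolded this]]
    show "((\<lambda>t. l2_inner (z t) (P n h)) has_vector_derivative
      - (l2_inner (C n (w t)) (C n h) + l2_inner (F t) (P n h))) (at t within {0..T})" .
  next
    fix t assume t: "t \<in> {0..T}"
    have "F t = (\<lambda>x. complex_of_real (q' x) * w t x + complex_of_real (q' x - q x) * u t x)"
      by (simp add: F_def w_def fun_eq_iff algebra_simps)
    then have "l2_norm (F t) \<le> l2_norm (\<lambda>x. complex_of_real (q' x) * w t x) + l2_norm (\<lambda>x. complex_of_real (q' x - q x) * u t x)"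
      using l2_norm_triangle[OF L2_bounded_mult(1)[OF wL[OF t] q'] L2_bounded_mult(1)[OF uL[OF t] _ qq']] q(1) q'(1) by simp
    also have "\<dots> \<le> M * l2_norm (w t) + \<delta> * l2_norm (u t)"
      using q(1) q'(1) by (intro add_mono L2_bounded_mult(2)[OF _ _ q'(2)] L2_bounded_mult(2)[OF _ _ qq'] wL uL t) auto
    also have "\<dots> \<le> M * l2_norm (w t) + \<delta> * U"
      using mult_left_mono[OF U[OF t] \<delta>] by simp
    finally show "l2_norm (F t) \<le> M * l2_norm (w t) + \<delta> * U" .
  qed
  then show ?thesis by (simp add: w_def[abs_def])
qed

end

section \<open>Left translations preserve Lebesgue measure\<close>

locale graded_space =
  fixes V :: "nat \<Rightarrow> 'a::euclidean_space set"
  assumes grad: "gradation V"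
begin

lemma V_subspace: "subspace (V j)"
  using grad by (simp add: gradation_def)

lemma V_0: "V 0 = {0}"
  using grad by (simp add: gradation_def)

lemma finite_weights: "finite {j. V j \<noteq> {0}}"
  using grad by (simp add: gradation_def)

lemma component_ex1: "\<exists>!c. (\<forall>j. c j \<in> V j) \<and> x = (\<Sum>j | V j \<noteq> {0}. c j)"
  using grad by (simp add: gradation_def)

lemma component_in: "component V x j \<in> V j"
  and component_sum: "x = (\<Sum>j | V j \<noteq> {0}. component V x j)"
  using theI'[OF component_ex1[of x]] unfolding component_def by auto

lemma component_unique:
  assumes "\<And>j. c j \<in> V j" "x = (\<Sum>j | V j \<noteq> {0}. c j)"
  shows "component V x = c"
  unfolding component_def by (rule the1_equality[OF component_ex1]) (use assms in auto)

lemma component_eq_0: "V j = {0} \<Longrightarrow> component V x j = 0"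
  using component_in[of x j] by simp

lemma linear_component: "linear (\<lambda>x. component V x j)"
proof (rule linearI)
  fix x y
  have "component V (x + y) = (\<lambda>j. component V x j + component V y j)"
    by (rule component_unique)
       (auto simp: sum.distrib component_sum[symmetric] intro: subspace_add V_subspace component_in)
  then show "component V (x + y) j = component V x j + component V y j"
    by simp
next
  fix c x
  have "component V (c *\<^sub>R x) = (\<lambda>j. c *\<^sub>R component V x j)"
    by (rule component_unique)
       (auto simp: scaleR_sum_right[symmetric] component_sum[symmetric] intro: subspace_scale V_subspace component_in)
  then show "component V (c *\<^sub>R x) j = c *\<^sub>R component V x j"
    by simp
qed

lemma component_of_V:
  assumes "y \<in> V i"
  shows "component V y = (\<lambda>j. if j = i then y else 0)"
proof (rule component_unique)
  show "y = (\<Sum>j | V j \<noteq> {0}. if j = i then y else 0)"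
    using assms finite_weights by (cases "V i = {0}") auto
qed (use assms subspace_0[OF V_subspace] in auto)

lemma linear_dilation: "linear (dilation V r)"
  unfolding dilation_def
  by (intro linear_compose_sum ballI linear_compose_scale_right linear_component)

lemma component_dilation: "component V (dilation V r x) j = r ^ j *\<^sub>R component V x j"
proof -
  have "component V (dilation V r x) = (\<lambda>j. r ^ j *\<^sub>R component V x j)"
    by (rule component_unique) (auto simp: dilation_def intro: subspace_scale V_subspace component_in)
  then show ?thesis by simp
qed

lemma component_eqI: "(\<And>j. component V x j = component V y j) \<Longrightarrow> x = y"
  using component_sum[of x] component_sum[of y] by simp

lemma dilation_dilation: "dilation V r (dilation V s x) = dilation V (r * s) x"
  by (rule component_eqI) (simp add: component_dilation power_mult_distrib)

lemma dilation_1: "dilation V 1 x = x"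
  by (rule component_eqI) (simp add: component_dilation)

lemma dilation_of_V: "y \<in> V i \<Longrightarrow> dilation V r y = r ^ i *\<^sub>R y"
  by (rule component_eqI) (auto simp: component_dilation component_of_V linear_scale[OF linear_component])

text \<open>The direct sum of all \<open>V j\<close> with j >= k. A map is unipotent here if
  subtracting the identity raises the index of this filtration by one.\<close>

definition filtration :: "nat \<Rightarrow> 'a set" where
  "filtration k = {x. \<forall>j<k. component V x j = 0}"

lemma subspace_filtration: "subspace (filtration k)"
  unfolding filtration_def subspace_def
  by (auto simp: linear_0[OF linear_component] linear_add[OF linear_component] linear_scale[OF linear_component])

lemma V_subset_filtration: "k \<le> i \<Longrightarrow> V i \<subseteq> filtration k"
  by (auto simp: filtration_def component_of_V)

lemma filtration_antimono: "k \<le> l \<Longrightarrow> filtration l \<subseteq> filtration k"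
  by (auto simp: filtration_def)

lemma filtration_trivial:
  obtains N where "\<And>k. N \<le> k \<Longrightarrow> filtration k = {0}"
proof -
  obtain N where N: "\<And>j. V j \<noteq> {0} \<Longrightarrow> j < N"
    using finite_weights unfolding finite_nat_set_iff_bounded by auto
  have "filtration k = {0}" if "N \<le> k" for k
  proof -
    have "x = 0" if x: "x \<in> filtration k" for x
    proof (rule component_eqI)
      fix j
      show "component V x j = component V 0 j"
        using x N[of j] \<open>N \<le> k\<close> by (cases "V j = {0}") (auto simp: filtration_def component_eq_0 linear_0[OF linear_component])
    qed
    then show ?thesis using subspace_0[OF subspace_filtration] by blast
  qed
  then show ?thesis using that by blast
qed

text \<open>Conjugation by a large dilation kills the strictly filtered part of a unipotent map.\<close>

lemma dilation_conj_tendsto: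
  assumes N: "linear N" and uni: "\<And>k y. y \<in> filtration k \<Longrightarrow> N y - y \<in> filtration (Suc k)"
  shows "((\<lambda>r. dilation V (1 / r) (N (dilation V r y))) \<longlongrightarrow> y) at_top"
proof -
  let ?J = "{j. V j \<noteq> {0}}"
  \<comment> \<open>The block of \<open>N\<close> from \<open>V j\<close> to \<open>V i\<close>,
    applied to the component of \<open>y\<close>. By hypothesis the blocks with i < j vanish and the
    diagonal ones are identities.\<close>
  define a where "a j i = component V (N (component V y j)) i" for j i
  have comp: "a j i = (if i = j then component V y j else 0)" if "i \<le> j" for i j
  proof -
    have "component V y j \<in> filtration j"
      using V_subset_filtration[of j j] component_in by auto
    from uni[OF this] that have "component V (N (component V y j) - component V y j) i = 0"
      by (simp add: filtration_def)
    then show ?thesis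
      by (simp add: a_def linear_diff[OF linear_component] component_of_V[OF component_in])
  qed
  have eq: "dilation V (1 / r) (N (dilation V r y)) = (\<Sum>i\<in>?J. \<Sum>j\<in>?J. (r ^ j / r ^ i) *\<^sub>R a j i)" for r
  proof -
    have "N (dilation V r y) = (\<Sum>j\<in>?J. r ^ j *\<^sub>R N (component V y j))"
      by (simp add: dilation_def linear_sum[OF N] linear_scale[OF N])
    then have "component V (N (dilation V r y)) i = (\<Sum>j\<in>?J. r ^ j *\<^sub>R a j i)" for i
      by (simp add: a_def linear_sum[OF linear_component] linear_scale[OF linear_component])
    then show ?thesis
      unfolding dilation_def[of V "1 / r"] by (simp add: scaleR_sum_right power_one_over field_simps)
  qed
  \<comment> \<open>Conjugation multiplies a block by r^(j-i), so the remaining blocks, those with i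
    > j, decay as r grows.\<close>
  have lim: "((\<lambda>r. (r ^ j / r ^ i) *\<^sub>R a j i) \<longlongrightarrow> (if i = j then component V y j else 0)) at_top" for i j
  proof (cases "i \<le> j")
    case True
    show ?thesis
    proof (cases "i = j")
      case i: True
      have "\<forall>\<^sub>F r::real in at_top. (r ^ j / r ^ i) *\<^sub>R a j i = component V y j"
        using eventually_gt_at_top[of 0] by eventually_elim (simp add: comp i)
      then show ?thesis using i by (simp add: tendsto_eventually)
    qed (use comp[OF True] in simp)
  next
    case False
    have "((\<lambda>r::real. r ^ j / r ^ i) \<longlongrightarrow> 0) at_top"
    proof -
      have "((\<lambda>r::real. inverse (r ^ (i - j))) \<longlongrightarrow> 0) at_top"
        using False by (intro tendsto_inverse_0_at_top filterlim_pow_at_top filterlim_ident) simp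
      moreover have "\<forall>\<^sub>F r::real in at_top. inverse (r ^ (i - j)) = r ^ j / r ^ i"
        using eventually_gt_at_top[of 0]
        by eventually_elim (use False in \<open>simp add: power_diff field_simps\<close>)
      ultimately show ?thesis by (rule Lim_transform_eventually)
    qed
    from tendsto_scaleR[OF this tendsto_const, of "a j i"] show ?thesis using False by simp
  qed
  have "((\<lambda>r. \<Sum>i\<in>?J. \<Sum>j\<in>?J. (r ^ j / r ^ i) *\<^sub>R a j i) \<longlongrightarrow> (\<Sum>i\<in>?J. \<Sum>j\<in>?J. if i = j then component V y j else 0)) at_top"
    by (intro tendsto_sum lim)
  moreover have "(\<Sum>i\<in>?J. \<Sum>j\<in>?J. if i = j then component V y j else 0) = y"
    using finite_weights component_sum[of y] by simp
  ultimately show ?thesis by (simp add: eq)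
qed

text \<open>All weights that occur are at least 1, and for r <= 1 this gives r^j <= r. The constant
  collects the norms of the projections onto the summands.\<close>

lemma dilation_small:
  obtains c where "0 \<le> c" "\<And>r x. 0 \<le> r \<Longrightarrow> r \<le> 1 \<Longrightarrow> norm (dilation V r x) \<le> r * c * norm x"
proof -
  let ?J = "{j. V j \<noteq> {0}}"
  have "\<exists>c. \<forall>x. norm (component V x j) \<le> norm x * c" for j
    using linear_conv_bounded_linear[THEN iffD1, OF linear_component[of j]]
    by (auto dest: bounded_linear.bounded)
  then obtain c where c: "\<And>j x. norm (component V x j) \<le> norm x * c j"
    by metis
  have c0: "norm (component V x j) \<le> norm x * \<bar>c j\<bar>" for j x
    using c[of x j] mult_left_mono[OF abs_ge_self[of "c j"] norm_ge_zero[of x]] by linarith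
  show ?thesis
  proof (rule that[of "\<Sum>j\<in>?J. \<bar>c j\<bar>"])
    fix r :: real and x assume r: "0 \<le> r" "r \<le> 1"
    have "norm (dilation V r x) \<le> (\<Sum>j\<in>?J. norm (r ^ j *\<^sub>R component V x j))"
      unfolding dilation_def by (rule norm_sum)
    also have "\<dots> \<le> (\<Sum>j\<in>?J. r * (norm x * \<bar>c j\<bar>))"
    proof (rule sum_mono)
      fix j assume "j \<in> ?J"
      then have "1 \<le> j" using V_0 by (cases j) auto
      then have "r ^ j \<le> r ^ 1" using r by (intro power_decreasing) auto
      then show "norm (r ^ j *\<^sub>R component V x j) \<le> r * (norm x * \<bar>c j\<bar>)"
        using r c0[of x j] by (simp add: mult_mono)
    qed
    also have "\<dots> = r * (\<Sum>j\<in>?J. \<bar>c j\<bar>) * norm x"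
      by (simp add: sum_distrib_left sum_distrib_right mult_ac)
    finally show "norm (dilation V r x) \<le> r * (\<Sum>j\<in>?J. \<bar>c j\<bar>) * norm x" .
  qed (simp add: sum_nonneg)
qed

end

section \<open>The adjoint action and the differential of the exponential map\<close>

locale graded_group = graded_space V for V :: "nat \<Rightarrow> 'a::euclidean_space set" +
  fixes mul :: "'a \<Rightarrow> 'a \<Rightarrow> 'a"
  assumes graded: "graded_lie_group mul V"
begin

sublocale G: Groups.group mul 0 uminus
  using graded by (simp add: graded_lie_group_def)

abbreviation "mulp \<equiv> (\<lambda>(x, y). mul x y)"

lemma Ck_mulp: "Ck_on k UNIV mulp"
  using graded by (simp add: graded_lie_group_def smooth_on_def)

lemma mul_line: "mul (s *\<^sub>R X) (t *\<^sub>R X) = (s + t) *\<^sub>R X"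
  using graded by (simp add: graded_lie_group_def)

lemma lie_bracket_grading: "X \<in> V i \<Longrightarrow> Y \<in> V j \<Longrightarrow> lie_bracket mul X Y \<in> V (i + j)"
  using graded by (auto simp: graded_lie_group_def)

definition dmul :: "'a \<Rightarrow> 'a \<Rightarrow> 'a \<times> 'a \<Rightarrow> 'a" where
  "dmul x y h = dir_deriv h mulp (x, y)"

lemma mulp_has_derivative: "(mulp has_derivative dmul x y) (at (x, y))"
  using Ck_on_Suc_has_derivative[OF Ck_mulp] unfolding dmul_def[abs_def] .

lemma linear_dmul: "linear (dmul x y)"
  using has_derivative_linear[OF mulp_has_derivative] .

lemma mul_has_derivative:
  assumes "(f has_derivative f') (at p)" "(g has_derivative g') (at p)"
  shows "((\<lambda>p. mul (f p) (g p)) has_derivative (\<lambda>h. dmul (f p) (g p) (f' h, g' h))) (at p)"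
proof -
  have "((\<lambda>p. mulp (f p, g p)) has_derivative (\<lambda>h. dmul (f p) (g p) (f' h, g' h))) (at p)"
    by (rule has_derivative_compose[OF has_derivative_Pair[OF assms] mulp_has_derivative])
  then show ?thesis by simp
qed

lemma mul_has_vector_derivative:
  assumes "(f has_vector_derivative f') (at p)" "(g has_vector_derivative g') (at p)"
  shows "((\<lambda>p. mul (f p) (g p)) has_vector_derivative dmul (f p) (g p) (f', g')) (at p)"
  using mul_has_derivative[OF assms[unfolded has_vector_derivative_def]]
  unfolding has_vector_derivative_def
  by (simp add: linear_scale[OF linear_dmul, symmetric] scaleR_Pair)

lemma dmul_differentiable:
  assumes "f differentiable (at p)" "g differentiable (at p)"
  shows "(\<lambda>p. dmul (f p) (g p) h) differentiable (at p)"
proof -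
  have "Ck_on (Suc 0) UNIV (dir_deriv h mulp)"
    by (rule Ck_on_Suc_dir_deriv[OF Ck_mulp])
  then have "(dir_deriv h mulp) differentiable (at (f p, g p))"
    using Ck_on_Suc_has_derivative differentiable_def by blast
  moreover have "(\<lambda>p. (f p, g p)) differentiable (at p)"
    using assms unfolding differentiable_def by (blast intro: has_derivative_Pair)
  ultimately show ?thesis
    unfolding dmul_def using differentiable_compose[of "dir_deriv h mulp" "\<lambda>p. (f p, g p)" p UNIV] by simp
qed

lemma continuous_dmul: "isCont (\<lambda>p. dmul (fst p) (snd p) h) p"
  by (rule differentiable_imp_continuous_within) (intro dmul_differentiable linear_imp_differentiable linear_fst linear_snd)

text \<open>The two unit laws determine the partial derivatives, and a linear map on a product is
  the sum of its two restrictions.\<close>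

lemma dmul_0_0: "dmul 0 0 (a, b) = a + b"
proof -
  have 1: "((\<lambda>p. mul p 0) has_derivative (\<lambda>h. dmul 0 0 (h, 0))) (at 0)"
    using mul_has_derivative[OF has_derivative_ident has_derivative_const, of 0 0] by simp
  have 2: "((\<lambda>p. mul 0 p) has_derivative (\<lambda>h. dmul 0 0 (0, h))) (at 0)"
    using mul_has_derivative[OF has_derivative_const has_derivative_ident, of 0 0] by simp
  have "(\<lambda>h. dmul 0 0 (h, 0)) = (\<lambda>h. h)"
    by (rule has_derivative_unique[OF 1]) (simp add: has_derivative_ident)
  moreover have "(\<lambda>h. dmul 0 0 (0, h)) = (\<lambda>h. h)"
    by (rule has_derivative_unique[OF 2]) (simp add: has_derivative_ident)
  moreover have "dmul 0 0 (a, b) = dmul 0 0 (a, 0) + dmul 0 0 (0, b)"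
    by (simp add: linear_add[OF linear_dmul, symmetric])
  ultimately show ?thesis by metis
qed

definition conj_by :: "'a \<Rightarrow> 'a \<Rightarrow> 'a" where
  "conj_by g p = mul (mul g p) (- g)"

text \<open>This is Ad(g), written out by the chain rule in terms of \<open>dmul\<close>, so that
  smooth dependence on \<open>g\<close> can be read off.\<close>

definition dconj :: "'a \<Rightarrow> 'a \<Rightarrow> 'a" where
  "dconj g Y = dmul g (- g) (dmul g 0 (0, Y), 0)"

lemma conj_by_has_derivative: "(conj_by g has_derivative dconj g) (at 0)"
proof -
  have "((\<lambda>p. mul g p) has_derivative (\<lambda>h. dmul g 0 (0, h))) (at 0)"
    by (rule mul_has_derivative[OF has_derivative_const[of g] has_derivative_ident])
  from mul_has_derivative[OF this has_derivative_const[of "- g"]] show ?thesis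
    by (simp add: conj_by_def[abs_def] dconj_def[abs_def])
qed

lemma conj_by_0 [simp]: "conj_by g 0 = 0"
  by (simp add: conj_by_def)

lemma linear_dconj: "linear (dconj g)"
  using has_derivative_linear[OF conj_by_has_derivative] .

lemma Ad_eq_dconj: "Ad mul g Y = dconj g Y"
proof -
  have "((\<lambda>t. conj_by g (t *\<^sub>R Y)) has_derivative (\<lambda>t. dconj g (t *\<^sub>R Y))) (at 0)"
    by (rule has_derivative_compose[of "\<lambda>t. t *\<^sub>R Y"]) (auto intro!: derivative_eq_intros conj_by_has_derivative)
  then have "((\<lambda>t. conj_by g (t *\<^sub>R Y)) has_vector_derivative dconj g Y) (at 0)"
    by (simp add: has_vector_derivative_def linear_scale[OF linear_dconj])
  from vector_derivative_at[OF this] show ?thesis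
    by (simp add: Ad_def conj_by_def)
qed

lemma dconj_0: "dconj 0 Y = Y"
proof -
  have "conj_by 0 = (\<lambda>p. p)"
    by (simp add: conj_by_def fun_eq_iff)
  then have "((\<lambda>p. p) has_derivative dconj 0) (at 0)"
    using conj_by_has_derivative[of 0] by simp
  then have "dconj 0 = (\<lambda>h. h)"
    by (rule has_derivative_unique) (simp add: has_derivative_ident)
  then show ?thesis by simp
qed

lemma dconj_mul: "dconj (mul g h) Y = dconj g (dconj h Y)"
proof -
  have "conj_by (mul g h) = (\<lambda>p. conj_by g (conj_by h p))"
    by (simp add: conj_by_def fun_eq_iff G.inverse_distrib_swap G.assoc)
  moreover have "((\<lambda>p. conj_by g (conj_by h p)) has_derivative (\<lambda>Y. dconj g (dconj h Y))) (at 0)"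
    by (rule has_derivative_compose[OF conj_by_has_derivative]) (simp add: conj_by_has_derivative)
  ultimately have "(conj_by (mul g h) has_derivative (\<lambda>Y. dconj g (dconj h Y))) (at 0)"
    by simp
  from has_derivative_unique[OF conj_by_has_derivative this] show ?thesis by metis
qed

text \<open>In \<open>dconj\<close> the base point and the vector fed to the outer
  \<open>dmul\<close> both move with \<open>g\<close>, whereas \<open>dmul_differentiable\<close> is
  for a fixed vector. Expanding the inner value in the standard basis separates the two.\<close>

lemma dconj_differentiable: "(\<lambda>g. dconj g Y) differentiable (at g)"
proof -
  have "dconj g Y = (\<Sum>b\<in>Basis. (dmul g 0 (0, Y) \<bullet> b) *\<^sub>R dmul g (- g) (b, 0))" for g
  proof -
    have "(dmul g 0 (0, Y), 0::'a) = (\<Sum>b\<in>Basis. (dmul g 0 (0, Y) \<bullet> b) *\<^sub>R (b, 0))"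
      by (simp add: scaleR_Pair sum_prod euclidean_representation)
    then show ?thesis
      unfolding dconj_def by (simp only: linear_sum[OF linear_dmul] linear_scale[OF linear_dmul])
  qed
  moreover have "(\<lambda>g. \<Sum>b\<in>Basis. (dmul g 0 (0, Y) \<bullet> b) *\<^sub>R dmul g (- g) (b, 0)) differentiable (at g)"
    by (intro differentiable_sum differentiable_scaleR differentiable_inner dmul_differentiable differentiable_minus
        differentiable_const differentiable_ident finite_Basis ballI)
  ultimately show ?thesis by simp
qed

text \<open>A Frechet derivative rather than a derivative along the line of \<open>X\<close>:
  linearity in \<open>X\<close> is then immediate.\<close>

definition ad :: "'a \<Rightarrow> 'a \<Rightarrow> 'a" where
  "ad X Y = frechet_derivative (\<lambda>g. dconj g Y) (at 0) X"

lemma dconj_line_has_vector_derivative_0: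
  "((\<lambda>s. dconj (s *\<^sub>R X) Y) has_vector_derivative ad X Y) (at 0)"
proof -
  have d: "((\<lambda>g. dconj g Y) has_derivative frechet_derivative (\<lambda>g. dconj g Y) (at 0)) (at (0 *\<^sub>R X))"
    using frechet_derivative_works[THEN iffD1, OF dconj_differentiable[of Y 0]] by simp
  have "((\<lambda>s. dconj (s *\<^sub>R X) Y) has_derivative (\<lambda>s. frechet_derivative (\<lambda>g. dconj g Y) (at 0) (s *\<^sub>R X))) (at 0)"
    by (rule has_derivative_compose[of "\<lambda>s. s *\<^sub>R X" _ 0 UNIV "\<lambda>g. dconj g Y", OF _ d]) (auto intro!: derivative_eq_intros)
  then show ?thesis
    by (simp add: has_vector_derivative_def ad_def linear_scale[OF has_derivative_linear[OF d]])
qed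

lemma lie_bracket_eq_ad: "lie_bracket mul X Y = ad X Y"
  unfolding lie_bracket_def Ad_eq_dconj
  by (rule vector_derivative_at[OF dconj_line_has_vector_derivative_0])

lemma linear_ad_left: "linear (\<lambda>X. ad X Y)"
  unfolding ad_def
  using has_derivative_linear[OF frechet_derivative_works[THEN iffD1, OF dconj_differentiable[of Y 0]]] .

lemma linear_ad_right: "linear (ad X)"
proof (rule linearI)
  fix Y Z
  have "((\<lambda>s. dconj (s *\<^sub>R X) Y + dconj (s *\<^sub>R X) Z) has_vector_derivative ad X Y + ad X Z) (at 0)"
    by (intro has_vector_derivative_add dconj_line_has_vector_derivative_0)
  then show "ad X (Y + Z) = ad X Y + ad X Z"
    using vector_derivative_unique_at[OF dconj_line_has_vector_derivative_0[of X "Y + Z"]]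
    by (simp add: linear_add[OF linear_dconj])
next
  fix c Y
  have "((\<lambda>s. c *\<^sub>R dconj (s *\<^sub>R X) Y) has_vector_derivative c *\<^sub>R ad X Y) (at 0)"
    by (intro bounded_linear.has_vector_derivative[OF bounded_linear_scaleR_right] dconj_line_has_vector_derivative_0)
  then show "ad X (c *\<^sub>R Y) = c *\<^sub>R ad X Y"
    using vector_derivative_unique_at[OF dconj_line_has_vector_derivative_0[of X "c *\<^sub>R Y"]]
    by (simp add: linear_scale[OF linear_dconj])
qed

text \<open>Only components of \<open>Y\<close> of weight at least k contribute, and bracketing with
  any component of \<open>X\<close> adds a weight of at least 1.\<close>

lemma ad_filtration:
  assumes Y: "Y \<in> filtration k"
  shows "ad X Y \<in> filtration (Suc k)"
proof -
  let ?J = "{j. V j \<noteq> {0}}"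
  have "ad X Y = ad (\<Sum>i\<in>?J. component V X i) (\<Sum>j\<in>?J. component V Y j)"
    by (simp only: component_sum[symmetric])
  also have "\<dots> = (\<Sum>j\<in>?J. \<Sum>i\<in>?J. ad (component V X i) (component V Y j))"
    by (simp only: linear_sum[OF linear_ad_left] linear_sum[OF linear_ad_right])
  also have "\<dots> \<in> filtration (Suc k)"
  proof (intro subspace_sum subspace_filtration)
    fix i j assume "i \<in> ?J"
    then have i: "1 \<le> i" using V_0 by (cases i) auto
    show "ad (component V X i) (component V Y j) \<in> filtration (Suc k)"
    proof (cases "j < k")
      case True
      then have "component V Y j = 0" using Y by (simp add: filtration_def)
      then show ?thesis
        by (simp add: linear_0[OF linear_ad_right] subspace_0[OF subspace_filtration])
    next
      case False
      have "ad (component V X i) (component V Y j) \<in> V (i + j)"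
        unfolding lie_bracket_eq_ad[symmetric] by (intro lie_bracket_grading component_in)
      then show ?thesis using V_subset_filtration[of "Suc k" "i + j"] i False by auto
    qed
  qed
  finally show ?thesis .
qed

text \<open>Ad(exp rX) factors as Ad(exp sX) Ad(exp (r-s)X), so the derivative at 0 determines the
  one at every s.\<close>

lemma dconj_line_has_vector_derivative:
  "((\<lambda>s. dconj (s *\<^sub>R X) Y) has_vector_derivative dconj (s *\<^sub>R X) (ad X Y)) (at s)"
proof -
  have "((\<lambda>r. r - s) has_vector_derivative 1) (at s)"
    by (auto intro!: derivative_eq_intros simp: has_real_derivative_iff_has_vector_derivative[symmetric])
  from vector_diff_chain_at[OF this, of "\<lambda>h. dconj (h *\<^sub>R X) Y" "ad X Y"]
  have "((\<lambda>r. dconj ((r - s) *\<^sub>R X) Y) has_vector_derivative ad X Y) (at s)"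
    using dconj_line_has_vector_derivative_0[of X Y] by (simp add: o_def)
  then have "((\<lambda>r. dconj (s *\<^sub>R X) (dconj ((r - s) *\<^sub>R X) Y)) has_vector_derivative dconj (s *\<^sub>R X) (ad X Y)) (at s)"
    using bounded_linear.has_vector_derivative linear_conv_bounded_linear[THEN iffD1, OF linear_dconj] by blast
  moreover have "dconj (s *\<^sub>R X) (dconj ((r - s) *\<^sub>R X) Y) = dconj (r *\<^sub>R X) Y" for r
    unfolding dconj_mul[symmetric] mul_line by simp
  ultimately show ?thesis by simp
qed

text \<open>The derivative in s is Ad(exp sX) ad X Y. As ad X Y is one step deeper in the
  filtration, the induction hypothesis keeps the derivative there, so the components of weight at
  most k do not depend on s. This takes the place of the exponential series of ad X.\<close>

lemma dconj_unipotent: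
  assumes "Y \<in> filtration k"
  shows "dconj (s *\<^sub>R X) Y - Y \<in> filtration (Suc k)"
proof -
  obtain N where N: "\<And>k. N \<le> k \<Longrightarrow> filtration k = {0}"
    using filtration_trivial by blast
  \<comment> \<open>\<open>d\<close> counts the steps from k to the index \<open>N\<close> where the
    filtration has become trivial, so the induction descends from the top weight.\<close>
  have "\<forall>s. dconj (s *\<^sub>R X) Y - Y \<in> filtration (Suc k)" if "N \<le> k + d" "Y \<in> filtration k" for d k Y
    using that
  proof (induction d arbitrary: k Y)
    case 0
    then have "Y = 0" using N[of k] by simp
    then show ?case by (simp add: linear_0[OF linear_dconj] subspace_0[OF subspace_filtration])
  next
    case (Suc d)
    have adY: "ad X Y \<in> filtration (Suc k)"
      by (rule ad_filtration[OF Suc.prems(2)])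
    have *: "dconj (s *\<^sub>R X) (ad X Y) \<in> filtration (Suc k)" for s
    proof -
      have "dconj (s *\<^sub>R X) (ad X Y) - ad X Y \<in> filtration (Suc (Suc k))"
        using Suc.IH[OF _ adY] Suc.prems(1) by simp
      then have "dconj (s *\<^sub>R X) (ad X Y) - ad X Y + ad X Y \<in> filtration (Suc k)"
        by (intro subspace_add subspace_filtration adY) (use filtration_antimono[of "Suc k" "Suc (Suc k)"] in auto)
      then show ?thesis by simp
    qed
    have "component V (dconj (s *\<^sub>R X) Y - Y) j = 0" if j: "j < Suc k" for s j
    proof -
      have "((\<lambda>s. component V (dconj (s *\<^sub>R X) Y) j) has_vector_derivative 0) (at s within UNIV)" for s
      proof -
        have "((\<lambda>s. component V (dconj (s *\<^sub>R X) Y) j) has_vector_derivative component V (dconj (s *\<^sub>R X) (ad X Y)) j) (at s)"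
          using bounded_linear.has_vector_derivative[OF linear_conv_bounded_linear[THEN iffD1, OF linear_component] dconj_line_has_vector_derivative] .
        then show ?thesis using *[of s] j by (simp add: filtration_def)
      qed
      then obtain c where c: "\<And>s. component V (dconj (s *\<^sub>R X) Y) j = c"
        using has_vector_derivative_zero_constant[of UNIV "\<lambda>s. component V (dconj (s *\<^sub>R X) Y) j"] by auto
      show ?thesis
        using c[of s] c[of 0] by (simp add: linear_diff[OF linear_component] dconj_0)
    qed
    then show ?case by (simp add: filtration_def)
  qed
  from this[of k N Y] assms show ?thesis by simp
qed

text \<open>The left logarithmic derivative of \<open>exp\<close>: \<open>dexp X s Y\<close> is the velocity at \<open>t = 0\<close> of
  \<open>exp(-sX) exp(s(X + tY))\<close>, divided by \<open>s\<close>.\<close>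

definition dexp :: "'a \<Rightarrow> real \<Rightarrow> 'a \<Rightarrow> 'a" where
  "dexp X s Y = dmul (- (s *\<^sub>R X)) (s *\<^sub>R X) (0, Y)"

lemma linear_dexp: "linear (dexp X s)"
proof -
  have "linear (\<lambda>Y. (0::'a, Y::'a))" by (rule linearI) auto
  from linear_compose[OF this linear_dmul] show ?thesis
    unfolding dexp_def[abs_def] o_def .
qed

lemma curve_has_vector_derivative:
  "((\<lambda>t. mul (- (s *\<^sub>R X)) (s *\<^sub>R (X + t *\<^sub>R Y))) has_vector_derivative s *\<^sub>R dexp X s Y) (at 0)"
proof -
  have "((\<lambda>t. s *\<^sub>R (X + t *\<^sub>R Y)) has_vector_derivative s *\<^sub>R Y) (at 0)"
    by (auto intro!: derivative_eq_intros)
  from mul_has_vector_derivative[OF has_vector_derivative_const this, of "- (s *\<^sub>R X)"]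
  have "((\<lambda>t. mul (- (s *\<^sub>R X)) (s *\<^sub>R (X + t *\<^sub>R Y))) has_vector_derivative dmul (- (s *\<^sub>R X)) (s *\<^sub>R X) (s *\<^sub>R (0, Y))) (at 0)"
    by simp
  then show ?thesis by (simp only: linear_scale[OF linear_dmul] dexp_def)
qed

text \<open>The cocycle identity is differentiated along X + tY at t = 0. Both factors pass through
  the unit there, where by \<open>dmul_0_0\<close> the derivative of a product is the sum of the
  derivatives.\<close>

lemma dexp_cocycle:
  "(s + h) *\<^sub>R dexp X (s + h) Y = dconj (- (s *\<^sub>R X)) (h *\<^sub>R dexp X h Y) + s *\<^sub>R dexp X s Y"
proof -
  let ?k = "\<lambda>s t. mul (- (s *\<^sub>R X)) (s *\<^sub>R (X + t *\<^sub>R Y))"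
  have k: "?k (s + h) t = mul (conj_by (- (s *\<^sub>R X)) (?k h t)) (?k s t)" for t
  proof -
    have l: "(s + h) *\<^sub>R (X + t *\<^sub>R Y) = mul (h *\<^sub>R (X + t *\<^sub>R Y)) (s *\<^sub>R (X + t *\<^sub>R Y))"
      by (simp add: mul_line add.commute)
    have "- ((s + h) *\<^sub>R X) = mul ((- s) *\<^sub>R X) ((- h) *\<^sub>R X)"
      unfolding mul_line by (simp add: algebra_simps)
    then have m: "- ((s + h) *\<^sub>R X) = mul (- (s *\<^sub>R X)) (- (h *\<^sub>R X))" by simp
    have c: "mul (s *\<^sub>R X) (mul (- (s *\<^sub>R X)) y) = y" for y
      by (simp add: G.assoc[symmetric])
    show ?thesis
      unfolding l m conj_by_def by (simp add: G.assoc c)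
  qed
  have k0: "?k s 0 = 0" for s by simp
  have "((\<lambda>t. conj_by (- (s *\<^sub>R X)) (?k h t)) has_derivative (\<lambda>t. dconj (- (s *\<^sub>R X)) (t *\<^sub>R (h *\<^sub>R dexp X h Y)))) (at 0)"
    by (rule has_derivative_compose[OF curve_has_vector_derivative[unfolded has_vector_derivative_def]])
       (simp only: k0 conj_by_has_derivative)
  then have "((\<lambda>t. conj_by (- (s *\<^sub>R X)) (?k h t)) has_vector_derivative dconj (- (s *\<^sub>R X)) (h *\<^sub>R dexp X h Y)) (at 0)"
    by (simp only: has_vector_derivative_def linear_scale[OF linear_dconj])
  from mul_has_vector_derivative[OF this curve_has_vector_derivative[of s X Y]]
  have "((\<lambda>t. ?k (s + h) t) has_vector_derivative dconj (- (s *\<^sub>R X)) (h *\<^sub>R dexp X h Y) + s *\<^sub>R dexp X s Y) (at 0)"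
    unfolding k by (simp only: k0 conj_by_0 dmul_0_0)
  from vector_derivative_unique_at[OF curve_has_vector_derivative this] show ?thesis .
qed

lemma dexp_multiple:
  "(real k * h) *\<^sub>R dexp X (real k * h) Y = (\<Sum>i<k. dconj ((- (real i * h)) *\<^sub>R X) (h *\<^sub>R dexp X h Y))"
proof (induction k)
  case (Suc k)
  have e: "real (Suc k) * h = real k * h + h" by (simp add: algebra_simps)
  show ?case
    unfolding e dexp_cocycle[of "real k * h" h] Suc.IH by (simp add: add.commute)
qed simp

definition dconj_mean :: "'a \<Rightarrow> nat \<Rightarrow> 'a \<Rightarrow> 'a" where
  "dconj_mean X n Y = (1 / real n) *\<^sub>R (\<Sum>i<n. dconj ((- (real i / real n)) *\<^sub>R X) Y)"

lemma linear_dconj_mean: "linear (dconj_mean X n)"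
  unfolding dconj_mean_def[abs_def]
  by (intro linear_compose_scale_right linear_compose_sum ballI linear_dconj)

lemma dconj_mean_unipotent:
  assumes n: "0 < n" and Y: "Y \<in> filtration k"
  shows "dconj_mean X n Y - Y \<in> filtration (Suc k)"
proof -
  have "dconj_mean X n Y - Y = (1 / real n) *\<^sub>R (\<Sum>i<n. dconj ((- (real i / real n)) *\<^sub>R X) Y - Y)"
    using n by (simp add: dconj_mean_def sum_subtractf scaleR_diff_right sum_constant_scaleR)
  also have "\<dots> \<in> filtration (Suc k)"
    by (intro subspace_scale subspace_sum subspace_filtration dconj_unipotent Y)
  finally show ?thesis .
qed

lemma dexp_1_eq_mean:
  assumes n: "0 < n"
  shows "dexp X 1 Y = dconj_mean X n (dexp X (1 / real n) Y)"
  using dexp_multiple[of n "1 / real n" X Y] n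
  by (simp add: dconj_mean_def linear_scale[OF linear_dconj] scaleR_sum_right)

text \<open>Both base points of \<open>dmul\<close> tend to the unit, where multiplication is
  addition to first order. Convergence at each vector is all that \<open>ldet_tendsto\<close> asks
  for.\<close>

lemma dexp_tendsto: "(\<lambda>n. dexp X (1 / real (Suc n)) Y) \<longlonglongrightarrow> Y"
proof -
  have inv: "(\<lambda>n. 1 / real (Suc n)) \<longlonglongrightarrow> 0"
    using LIMSEQ_inverse_real_of_nat by (simp add: divide_inverse)
  have "(\<lambda>n. (- ((1 / real (Suc n)) *\<^sub>R X), (1 / real (Suc n)) *\<^sub>R X)) \<longlonglongrightarrow> (- (0 *\<^sub>R X), 0 *\<^sub>R X)"
    by (intro tendsto_Pair tendsto_minus tendsto_scaleR inv tendsto_const)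
  from isCont_tendsto_compose[OF continuous_dmul[where h="(0, Y)"] this]
  show ?thesis by (simp add: dexp_def dmul_0_0)
qed

end

section \<open>Change of variables and mollification\<close>

text \<open>The change of variables theorem of the library needs a wellordered index type.\<close>

typedef 'a ordered = "UNIV :: 'a set" ..

definition ordered_index :: "'a::finite ordered \<Rightarrow> nat" where
  "ordered_index = (SOME f. inj f)"

lemma bij_Rep_ordered: "bij Rep_ordered"
  using Rep_ordered_inject Abs_ordered_inverse by (metis UNIV_I bij_def inj_def surj_def)

instance ordered :: (finite) finite
proof
  have "finite (Rep_ordered -` (UNIV :: 'a set))"
    by (rule finite_vimageI) (auto simp: bij_is_inj[OF bij_Rep_ordered])
  then show "finite (UNIV :: 'a ordered set)" by simp
qed

lemma inj_ordered_index: "inj (ordered_index :: 'a::finite ordered \<Rightarrow> nat)"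
proof -
  obtain f :: "'a ordered \<Rightarrow> nat" where "inj f"
    using finite_imp_inj_to_nat_seg[OF finite_class.finite_UNIV] by blast
  then show ?thesis
    unfolding ordered_index_def by (rule someI[of inj])
qed

instantiation ordered :: (finite) wellorder
begin

definition "x \<le> y \<longleftrightarrow> ordered_index x \<le> ordered_index y"
definition "x < y \<longleftrightarrow> ordered_index x < ordered_index y"

instance
proof
  fix P :: "'a ordered \<Rightarrow> bool" and a
  assume step: "\<And>x. (\<And>y. y < x \<Longrightarrow> P y) \<Longrightarrow> P x"
  show "P a"
    by (induction a rule: measure_induct_rule[of ordered_index]) (auto intro: step simp: less_ordered_def)
qed (auto simp: less_eq_ordered_def less_ordered_def injD[OF inj_ordered_index])

end

section \<open>Lebesgue measure and determinants under a renaming of coordinates\<close>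

definition reindex :: "real ^ 'n \<Rightarrow> real ^ 'n ordered" where
  "reindex x = (\<chi> i. x $ Rep_ordered i)"

definition unreindex :: "real ^ 'n ordered \<Rightarrow> real ^ 'n" where
  "unreindex y = (\<chi> j. y $ Abs_ordered j)"

lemma reindex_unreindex [simp]: "reindex (unreindex y) = y"
  by (simp add: reindex_def unreindex_def vec_eq_iff Rep_ordered_inverse)

lemma unreindex_reindex [simp]: "unreindex (reindex x) = x"
  by (simp add: reindex_def unreindex_def vec_eq_iff Abs_ordered_inverse)

lemma linear_reindex: "linear reindex"
  by (rule linearI) (auto simp: reindex_def vec_eq_iff)

lemma linear_unreindex: "linear unreindex"
  by (rule linearI) (auto simp: unreindex_def vec_eq_iff)

lemma borel_measurable_linear_finite:
  fixes f :: "'a::euclidean_space \<Rightarrow> 'b::euclidean_space"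
  shows "linear f \<Longrightarrow> f \<in> borel_measurable borel"
  by (intro borel_measurable_continuous_onI linear_continuous_on) (simp add: linear_conv_bounded_linear)

lemma prod_Basis_vec: "(\<Prod>b\<in>Basis. (x :: real ^ 'n) \<bullet> b) = (\<Prod>i\<in>UNIV. x $ i)"
proof -
  have B: "(Basis :: (real ^ 'n) set) = range (\<lambda>i. axis i 1)"
    by (auto simp: Basis_vec_def)
  have "inj (\<lambda>i::'n. axis i (1::real))"
    by (auto simp: inj_def axis_eq_axis)
  then show ?thesis
    unfolding B by (subst prod.reindex) (auto simp: inner_axis)
qed

text \<open>It suffices to compare boxes: renaming coordinates takes a box to a box and permutes its
  side lengths.\<close>

lemma distr_reindex: "distr lborel borel (reindex :: real ^ 'n \<Rightarrow> _) = lborel"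
proof (rule lborel_eqI[symmetric])
  fix l u :: "real ^ 'n ordered"
  assume le: "\<And>b. b \<in> Basis \<Longrightarrow> l \<bullet> b \<le> u \<bullet> b"
  have m: "reindex \<in> borel_measurable borel"
    by (rule borel_measurable_linear_finite[OF linear_reindex])
  have le': "l $ i \<le> u $ i" for i
    using le[of "axis i 1"] by (simp add: inner_axis axis_in_Basis_iff)
  have box: "reindex -` box l u = box (unreindex l) (unreindex u)"
  proof (intro set_eqI)
    fix x :: "real ^ 'n"
    have "(\<forall>i. l $ i < x $ Rep_ordered i \<and> x $ Rep_ordered i < u $ i)
       \<longleftrightarrow> (\<forall>j. l $ Abs_ordered j < x $ j \<and> x $ j < u $ Abs_ordered j)"
      by (metis Abs_ordered_inverse Rep_ordered_inverse UNIV_I)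
    then show "x \<in> reindex -` box l u \<longleftrightarrow> x \<in> box (unreindex l) (unreindex u)"
      by (simp add: mem_box_cart reindex_def unreindex_def)
  qed
  have "emeasure (distr lborel borel reindex) (box l u) = emeasure lborel (box (unreindex l) (unreindex u))"
    using m by (subst emeasure_distr) (auto simp: box)
  also have "\<dots> = (\<Prod>b\<in>Basis. (unreindex u - unreindex l) \<bullet> b)"
  proof (subst emeasure_lborel_box)
    fix b :: "real ^ 'n" assume "b \<in> Basis"
    then show "unreindex l \<bullet> b \<le> unreindex u \<bullet> b"
      by (auto simp: Basis_vec_def inner_axis unreindex_def le')
  qed simp
  also have "(\<Prod>b\<in>Basis. (unreindex u - unreindex l) \<bullet> b) = (\<Prod>j\<in>UNIV. (u - l) $ Abs_ordered j)"
    unfolding prod_Basis_vec by (simp add: unreindex_def)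
  also have "\<dots> = (\<Prod>i\<in>UNIV. (u - l) $ i)"
  proof (rule prod.reindex_bij_betw)
    show "bij_betw Abs_ordered UNIV UNIV"
      by (rule bij_betwI[where g=Rep_ordered]) (auto simp: Abs_ordered_inverse Rep_ordered_inverse)
  qed
  also have "\<dots> = (\<Prod>b\<in>Basis. (u - l) \<bullet> b)"
    by (rule prod_Basis_vec[symmetric])
  finally show "emeasure (distr lborel borel reindex) (box l u) = (\<Prod>b\<in>Basis. (u - l) \<bullet> b)" .
qed simp

text \<open>The absolute determinant of a linear map, taken after the renaming of coordinates so
  that it matches the factor in the change of variables formula.\<close>

definition ldet :: "(real ^ 'n \<Rightarrow> real ^ 'n) \<Rightarrow> real" where
  "ldet f = \<bar>det (matrix (reindex \<circ> f \<circ> unreindex))\<bar>"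

lemma linear_reindex_conj: "linear f \<Longrightarrow> linear (reindex \<circ> f \<circ> unreindex)"
  by (intro linear_compose linear_reindex linear_unreindex)

lemma ldet_compose:
  assumes "linear f" "linear g"
  shows "ldet (\<lambda>x. f (g x)) = ldet f * ldet g"
proof -
  have "reindex \<circ> (\<lambda>x. f (g x)) \<circ> unreindex = (reindex \<circ> f \<circ> unreindex) \<circ> (reindex \<circ> g \<circ> unreindex)"
    by (simp add: fun_eq_iff)
  then show ?thesis
    using assms unfolding ldet_def
    by (simp only: matrix_compose linear_reindex_conj det_mul abs_mult)
qed

lemma ldet_id: "ldet (\<lambda>x::real^'n. x) = 1"
proof -
  have "reindex \<circ> (\<lambda>x::real^'n. x) \<circ> unreindex = id"
    by (simp add: fun_eq_iff)
  then show ?thesis unfolding ldet_def by (simp only: matrix_id_mat_1) simp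
qed

text \<open>The determinant is a polynomial in finitely many entries, so convergence at each vector
  is enough.\<close>

lemma ldet_tendsto:
  assumes "\<And>x. ((\<lambda>k. f k x) \<longlongrightarrow> g x) F"
  shows "((\<lambda>k. ldet (f k)) \<longlongrightarrow> ldet g) F"
proof -
  have "((\<lambda>k. matrix (reindex \<circ> f k \<circ> unreindex) $ i $ j) \<longlongrightarrow> matrix (reindex \<circ> g \<circ> unreindex) $ i $ j) F" for i j
    unfolding matrix_def by (auto simp: reindex_def intro!: tendsto_vec_nth assms)
  then show ?thesis
    unfolding ldet_def det_def by (intro tendsto_rabs tendsto_sum tendsto_mult tendsto_prod tendsto_const)
qed

text \<open>The map is an involution, so its value squares to 1, and an absolute value is
  nonnegative.\<close>

lemma ldet_uminus: "ldet (\<lambda>x::real^'n. - x) = 1"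
proof -
  have l: "linear (\<lambda>x::real^'n. - x)" by (rule linearI) auto
  have "ldet (\<lambda>x::real^'n. - (- x)) = ldet (\<lambda>x::real^'n. - x) * ldet (\<lambda>x::real^'n. - x)"
    by (rule ldet_compose[OF l l])
  then have "(ldet (\<lambda>x::real^'n. - x))\<^sup>2 = 1"
    by (simp add: ldet_id power2_eq_square)
  then show ?thesis
    by (auto simp: power2_eq_1_iff ldet_def)
qed

lemma change_of_variables_wellorder:
  fixes f :: "real ^ 'm::{finite,wellorder} \<Rightarrow> real"
  assumes f: "f \<in> borel_measurable borel"
    and d: "\<And>x. (g has_derivative g' x) (at x)" and "bij g"
    and c: "\<And>x. \<bar>det (matrix (g' x))\<bar> = c"
    and i: "integrable lborel (\<lambda>x. f (g x))"
  shows "(LINT x|lborel. f x) = c * (LINT x|lborel. f (g x))"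
proof -
  \<comment> \<open>The change of variables formula is for functions with values in a Cartesian
    space; \<open>v\<close> views a real number as a vector with one coordinate.\<close>
  define v :: "real \<Rightarrow> real ^ 1" where "v r = (\<chi> i. r)" for r
  have g: "inj g" "range g = UNIV"
    using \<open>bij g\<close> by (auto simp: bij_def)
  have gm: "g \<in> borel_measurable borel"
    by (intro borel_measurable_continuous_onI) (auto simp: continuous_on_eq_continuous_at intro: has_derivative_continuous d)
  have ic: "integrable lborel (\<lambda>x. c * f (g x))"
    using i by simp
  \<comment> \<open>The formula is an equivalence that includes integrability, so integrability of
    the pulled back function is enough and that of \<open>f\<close> comes out as a
    conclusion.\<close>
  then have abs1: "(\<lambda>x. c * f (g x)) absolutely_integrable_on UNIV"
    using f gm by (simp add: set_integrable_def integrable_completion)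
  have "(\<lambda>x. \<bar>det (matrix (g' x))\<bar> *\<^sub>R v (f (g x))) absolutely_integrable_on UNIV \<and>
        integral UNIV (\<lambda>x. \<bar>det (matrix (g' x))\<bar> *\<^sub>R v (f (g x))) = v (LINT x|lborel. c * f (g x))
      \<longleftrightarrow> (\<lambda>x. v (f x)) absolutely_integrable_on g ` UNIV \<and> integral (g ` UNIV) (\<lambda>x. v (f x)) = v (LINT x|lborel. c * f (g x))"
    by (rule has_absolute_integral_change_of_variables[of UNIV g g' "\<lambda>x. v (f x)"]) (use d g in auto)
  moreover have a: "(\<lambda>x. \<bar>det (matrix (g' x))\<bar> *\<^sub>R v (f (g x))) absolutely_integrable_on UNIV"
    unfolding absolutely_integrable_on_1_iff using abs1 by (simp add: c v_def)
  moreover have "integral UNIV (\<lambda>x. \<bar>det (matrix (g' x))\<bar> *\<^sub>R v (f (g x))) = v (LINT x|lborel. c * f (g x))"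
    using integral_lborel[OF ic] a
    by (subst integral_on_1_eq) (simp add: c v_def vec_eq_iff)
  ultimately have vf: "(\<lambda>x. v (f x)) absolutely_integrable_on UNIV" "integral UNIV (\<lambda>x. v (f x)) = v (LINT x|lborel. c * f (g x))"
    by (auto simp: g)
  have "f absolutely_integrable_on UNIV"
    using vf(1) unfolding absolutely_integrable_on_1_iff by (simp add: v_def)
  then have "integrable lborel f"
    using f by (simp add: set_integrable_def integrable_completion)
  then have "(LINT x|lborel. f x) = integral UNIV f"
    by (rule integral_lborel[symmetric])
  also have "\<dots> = (LINT x|lborel. c * f (g x))"
    using vf(2) by (subst (asm) integral_on_1_eq) (simp add: v_def vec_eq_iff)
  finally show ?thesis by simp
qed

text \<open>Conjugating \<open>g\<close> with the renaming gives the previous lemma for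
  \<open>G\<close>; by \<open>distr_reindex\<close> the integrals on both sides are the original
  ones.\<close>

lemma change_of_variables_ldet:
  fixes f :: "real ^ 'n \<Rightarrow> real" and g :: "real ^ 'n \<Rightarrow> real ^ 'n"
  assumes f: "f \<in> borel_measurable borel"
    and d: "\<And>x. (g has_derivative g' x) (at x)" and bij: "bij g"
    and c: "\<And>x. ldet (g' x) = c"
    and i: "integrable lborel (\<lambda>x. f (g x))"
  shows "(LINT x|lborel. f x) = c * (LINT x|lborel. f (g x))"
proof -
  have rm: "reindex \<in> borel_measurable lborel" and um: "unreindex \<in> borel_measurable borel"
    by (simp_all add: borel_measurable_linear_finite linear_reindex linear_unreindex)
  have gm: "g \<in> borel_measurable borel"
    by (intro borel_measurable_continuous_onI) (auto simp: continuous_on_eq_continuous_at intro: has_derivative_continuous d)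
  have tr: "(LINT y|lborel. h (unreindex y)) = (LINT x|lborel. h x)" if h: "h \<in> borel_measurable borel" for h :: "real ^ 'n \<Rightarrow> real"
  proof -
    have "(LINT y|lborel. h (unreindex y)) = (LINT y|distr lborel borel (reindex :: real ^ 'n \<Rightarrow> _). h (unreindex y))"
      by (simp add: distr_reindex)
    also have "\<dots> = (LINT x|lborel. h (unreindex (reindex x)))"
      by (rule integral_distr[OF rm]) (rule measurable_compose[OF um h])
    finally show ?thesis by simp
  qed
  have tri: "integrable lborel (\<lambda>y. h (unreindex y)) \<longleftrightarrow> integrable lborel h" if h: "h \<in> borel_measurable borel" for h :: "real ^ 'n \<Rightarrow> real"
  proof -
    have "integrable lborel (\<lambda>y. h (unreindex y)) \<longleftrightarrow> integrable (distr lborel borel (reindex :: real ^ 'n \<Rightarrow> _)) (\<lambda>y. h (unreindex y))"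
      by (simp add: distr_reindex)
    also have "\<dots> \<longleftrightarrow> integrable lborel (\<lambda>x. h (unreindex (reindex x)))"
      by (rule integrable_distr_eq[OF rm]) (rule measurable_compose[OF um h])
    finally show ?thesis by simp
  qed
  define G where "G = reindex \<circ> g \<circ> unreindex"
  have "(LINT y|lborel. f (unreindex y)) = c * (LINT y|lborel. f (unreindex (G y)))"
  proof (rule change_of_variables_wellorder)
    show "(\<lambda>y. f (unreindex y)) \<in> borel_measurable borel"
      by (rule measurable_compose[OF um f])
    show "(G has_derivative (reindex \<circ> g' (unreindex y) \<circ> unreindex)) (at y)" for y
      unfolding G_def
      by (intro diff_chain_at linear_imp_has_derivative linear_reindex linear_unreindex d)
    have "bij (reindex :: real ^ 'n \<Rightarrow> _)" "bij (unreindex :: _ \<Rightarrow> real ^ 'n)"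
      by (auto intro!: o_bij[of unreindex reindex] o_bij[of reindex unreindex] simp: fun_eq_iff)
    then show "bij G"
      unfolding G_def by (intro bij_comp bij)
    show "\<bar>det (matrix (reindex \<circ> g' (unreindex y) \<circ> unreindex))\<bar> = c" for y
      using c[of "unreindex y"] by (simp add: ldet_def)
    show "integrable lborel (\<lambda>y. f (unreindex (G y)))"
      using tri[of "\<lambda>x. f (g x)"] measurable_compose[OF gm f] i by (simp add: G_def)
  qed
  then show ?thesis
    using tr[OF f] tr[OF measurable_compose[OF gm f]] by (simp add: G_def)
qed

lemma (in graded_space) adapted_basis:
  obtains B w where "independent B" "card B = DIM('a)" "span B = UNIV" "\<And>b. b \<in> B \<Longrightarrow> b \<in> V (w b)"
    "(\<Sum>b\<in>B. w b) = hom_dim V"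
proof -
  let ?J = "{j. V j \<noteq> {0}}"
  have "\<exists>C. C \<subseteq> V j \<and> independent C \<and> V j \<subseteq> span C \<and> card C = dim (V j)" for j
    by (rule basis_exists) auto
  then obtain C where C: "\<And>j. C j \<subseteq> V j" "\<And>j. independent (C j)" "\<And>j. V j \<subseteq> span (C j)" "\<And>j. card (C j) = dim (V j)"
    by metis
  have finC: "finite (C j)" for j
    by (rule independent_imp_finite[OF C(2)])
  \<comment> \<open>The weight is well defined because a nonzero vector lies in only one
    \<open>V j\<close>, and basis vectors are nonzero.\<close>
  define w where "w b = (THE j. b \<in> C j)" for b
  have nz: "b \<noteq> 0" if "b \<in> C j" for b j
    using C(2)[of j] that dependent_zero by blast
  have w: "w b = j" if b: "b \<in> C j" for b j
    unfolding w_def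
  proof (rule the_equality, rule b)
    fix i assume "b \<in> C i"
    then have "b \<in> V i" "b \<in> V j" using C(1) b by auto
    then show "i = j"
      using component_of_V[of b i] component_of_V[of b j] nz[OF b] by (metis (full_types))
  qed
  have disj: "C i \<inter> C j = {}" if "i \<noteq> j" for i j
    using w[of _ i] w[of _ j] that by blast
  define B where "B = (\<Union>j\<in>?J. C j)"
  have finB: "finite B" unfolding B_def using finite_weights finC by blast
  have sumB: "(\<Sum>b\<in>B. h b) = (\<Sum>j\<in>?J. \<Sum>b\<in>C j. h b)" for h :: "'a \<Rightarrow> 'c::comm_monoid_add"
    unfolding B_def by (rule sum.UNION_disjoint) (use finite_weights finC disj in auto)
  have "independent B"
  proof (rule independent_if_scalars_zero[OF finB])
    fix u b assume u: "(\<Sum>b\<in>B. u b *\<^sub>R b) = 0" and b: "b \<in> B"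
    \<comment> \<open>The partial sums over the blocks \<open>C j\<close> decompose the vector 0, so
      by uniqueness each of them vanishes; independence inside one block does the rest.\<close>
    have "component V 0 = (\<lambda>j. if j \<in> ?J then (\<Sum>b\<in>C j. u b *\<^sub>R b) else 0)"
    proof (rule component_unique)
      show "(if j \<in> ?J then (\<Sum>b\<in>C j. u b *\<^sub>R b) else 0) \<in> V j" for j
        using C(1)[of j] by (auto intro!: subspace_sum subspace_scale V_subspace subspace_0[OF V_subspace])
      show "0 = (\<Sum>j\<in>?J. if j \<in> ?J then (\<Sum>b\<in>C j. u b *\<^sub>R b) else 0)"
        using u sumB[of "\<lambda>b. u b *\<^sub>R b"] by simp
    qed
    moreover obtain j where j: "j \<in> ?J" "b \<in> C j" using b unfolding B_def by blast
    ultimately have "(\<Sum>b\<in>C j. u b *\<^sub>R b) = 0"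
      using linear_0[OF linear_component, of j] by (metis (no_types, lifting))
    then show "u b = 0"
      using independentD[OF C(2)[of j] finC subset_refl _ j(2), of u] by simp
  qed
  moreover have spanB: "span B = UNIV"
  proof -
    have "x \<in> span B" for x
    proof -
      have "component V x j \<in> span B" if "j \<in> ?J" for j
      proof -
        have "component V x j \<in> span (C j)" using C(3)[of j] component_in by blast
        moreover have "C j \<subseteq> B" using that by (auto simp: B_def)
        ultimately show ?thesis using span_mono by blast
      qed
      then have "(\<Sum>j\<in>?J. component V x j) \<in> span B" by (rule span_sum)
      then show ?thesis by (simp only: component_sum[symmetric])
    qed
    then show ?thesis by blast
  qed
  moreover have "card B = DIM('a)"
    using dim_eq_card_independent[OF \<open>independent B\<close>] dim_span[of B] spanB by simp
  moreover have "b \<in> V (w b)" if "b \<in> B" for b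
    using that w C(1) unfolding B_def by blast
  moreover have "(\<Sum>b\<in>B. w b) = hom_dim V"
  proof -
    have "(\<Sum>b\<in>B. w b) = (\<Sum>j\<in>?J. \<Sum>b\<in>C j. j)"
      unfolding sumB by (intro sum.cong refl) (simp add: w)
    then show ?thesis by (simp add: C(4) hom_dim_def mult.commute)
  qed
  ultimately show ?thesis using that by blast
qed

text \<open>In a basis adapted to the grading the dilation is the diagonal map \<open>D\<close>. The
  change of basis \<open>\<Phi>\<close> occurs on both sides of the product rule and
  cancels.\<close>

lemma ldet_dilation:
  fixes V :: "nat \<Rightarrow> (real ^ 'n) set"
  assumes V: "gradation V" and r: "0 < r"
  shows "ldet (dilation V r) = r ^ hom_dim V"
proof -
  interpret graded_space V by unfold_locales (rule V)
  obtain B w where B: "independent B" "card B = DIM(real ^ 'n)" "span B = UNIV" "\<And>b. b \<in> B \<Longrightarrow> b \<in> V (w b)"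
    and wsum: "(\<Sum>b\<in>B. w b) = hom_dim V"
    using adapted_basis by blast
  have finB: "finite B" by (rule independent_imp_finite[OF B(1)])
  have "card (UNIV :: 'n set) = card B" using B(2) by simp
  then obtain \<beta> :: "'n \<Rightarrow> real ^ 'n" where \<beta>: "bij_betw \<beta> UNIV B"
    using finite_same_card_bij[OF finite_class.finite_UNIV finB] by blast
  define \<Phi> where "\<Phi> x = (\<Sum>i\<in>UNIV. (x $ i) *\<^sub>R \<beta> i)" for x :: "real ^ 'n"
  define D where "D x = (\<chi> i. r ^ w (\<beta> i) * x $ i)" for x :: "real ^ 'n"
  have lin\<Phi>: "linear \<Phi>"
    by (rule linearI) (auto simp: \<Phi>_def scaleR_add_left sum.distrib scaleR_sum_right)
  have linD: "linear D"
    by (rule linearI) (auto simp: D_def vec_eq_iff algebra_simps)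
  have "(\<lambda>x. dilation V r (\<Phi> x)) = (\<lambda>x. \<Phi> (D x))"
  proof
    fix x
    have "dilation V r (\<beta> i) = r ^ w (\<beta> i) *\<^sub>R \<beta> i" for i
      using \<beta> by (intro dilation_of_V B(4)) (auto simp: bij_betw_def)
    then show "dilation V r (\<Phi> x) = \<Phi> (D x)"
      by (simp add: \<Phi>_def D_def linear_sum[OF linear_dilation] linear_scale[OF linear_dilation] mult.commute)
  qed
  then have eq: "ldet (dilation V r) * ldet \<Phi> = ldet \<Phi> * ldet D"
    using ldet_compose[OF linear_dilation lin\<Phi>, of r] ldet_compose[OF lin\<Phi> linD] by metis
  have "inj \<Phi>"
  proof (subst linear_injective_0[OF lin\<Phi>], intro allI impI)
    fix x assume "\<Phi> x = 0"
    then have "(\<Sum>b\<in>B. (x $ the_inv \<beta> b) *\<^sub>R b) = 0"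
      unfolding \<Phi>_def using sum.reindex_bij_betw[OF \<beta>, of "\<lambda>b. (x $ the_inv \<beta> b) *\<^sub>R b"] \<beta>
      by (simp add: the_inv_f_f bij_betw_def)
    then have "x $ the_inv \<beta> b = 0" if "b \<in> B" for b
      using independentD[OF B(1) finB subset_refl _ that, of "\<lambda>b. x $ the_inv \<beta> b"] by blast
    then have "x $ i = 0" for i
      using \<beta> the_inv_f_f[of \<beta> i] by (metis bij_betw_def rangeI)
    then show "x = 0" by (simp add: vec_eq_iff)
  qed
  \<comment> \<open>A left inverse shows that \<open>\<Phi>\<close> has nonzero determinant, which
    permits the cancellation.\<close>
  then obtain \<Psi> where \<Psi>: "linear \<Psi>" "\<And>x. \<Psi> (\<Phi> x) = x"
    using linear_injective_left_inverse[OF lin\<Phi>] by (metis comp_apply id_apply)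
  then have "ldet \<Psi> * ldet \<Phi> = 1"
    using ldet_compose[OF \<Psi>(1) lin\<Phi>] by (simp add: ldet_id)
  then have "ldet \<Phi> \<noteq> 0" by auto
  with eq have "ldet (dilation V r) = ldet D" by simp
  also have "ldet D = (\<Prod>i\<in>UNIV. r ^ w (\<beta> (Rep_ordered i)))"
  proof -
    have m: "matrix (reindex \<circ> D \<circ> unreindex) $ i $ j = (if i = j then r ^ w (\<beta> (Rep_ordered i)) else 0)" for i j
      by (simp add: matrix_def reindex_def D_def unreindex_def axis_def Rep_ordered_inverse)
    have "det (matrix (reindex \<circ> D \<circ> unreindex)) = (\<Prod>i\<in>UNIV. matrix (reindex \<circ> D \<circ> unreindex) $ i $ i)"
      by (rule det_diagonal) (simp add: m)
    then show ?thesis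
      using r by (simp add: ldet_def m prod_nonneg)
  qed
  also have "\<dots> = (\<Prod>i\<in>UNIV. r ^ w (\<beta> i))"
    by (rule prod.reindex_bij_betw[OF bij_Rep_ordered, of "\<lambda>i. r ^ w (\<beta> i)"])
  also have "\<dots> = (\<Prod>b\<in>B. r ^ w b)"
    by (rule prod.reindex_bij_betw[OF \<beta>])
  also have "\<dots> = r ^ hom_dim V"
    by (simp add: power_sum[symmetric] wsum)
  finally show ?thesis .
qed

section \<open>The Jacobian of left translations\<close>

locale graded_group_vec = graded_group V mul for V :: "nat \<Rightarrow> (real ^ 'n) set" and mul
begin

text \<open>The dilations by r and 1/r contribute reciprocal determinants, so the conjugated map has
  the determinant of \<open>N\<close> for every r > 0, while it tends to the identity as r
  grows.\<close>

lemma ldet_unipotent: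
  assumes N: "linear N" and uni: "\<And>k y. y \<in> filtration k \<Longrightarrow> N y - y \<in> filtration (Suc k)"
  shows "ldet N = 1"
proof -
  have "((\<lambda>r. ldet (\<lambda>y. dilation V (1 / r) (N (dilation V r y)))) \<longlongrightarrow> ldet (\<lambda>y::real^'n. y)) at_top"
    by (rule ldet_tendsto) (rule dilation_conj_tendsto[OF N uni])
  moreover have "\<forall>\<^sub>F r in at_top. ldet (\<lambda>y. dilation V (1 / r) (N (dilation V r y))) = ldet N"
    using eventually_gt_at_top[of 0]
  proof eventually_elim
    case (elim r)
    have "ldet (\<lambda>y. dilation V (1 / r) (N (dilation V r y))) = ldet (dilation V (1 / r)) * (ldet N * ldet (dilation V r))"
      using ldet_compose[OF linear_dilation linear_compose[OF linear_dilation N, unfolded o_def], of "1 / r" r]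
        ldet_compose[OF N linear_dilation, of r] by simp
    also have "\<dots> = ldet N"
      using elim by (simp add: ldet_dilation[OF grad] power_one_over)
    finally show ?case .
  qed
  ultimately have "((\<lambda>r::real. ldet N) \<longlongrightarrow> ldet (\<lambda>y::real^'n. y)) at_top"
    by (rule Lim_transform_eventually)
  then show ?thesis by (simp add: tendsto_const_iff ldet_id)
qed

lemma ldet_dexp_1: "ldet (dexp X 1) = 1"
proof -
  have eq: "ldet (dexp X 1) = ldet (dexp X (1 / real (Suc n)))" for n
  proof -
    have "dexp X 1 = (\<lambda>Y. dconj_mean X (Suc n) (dexp X (1 / real (Suc n)) Y))"
      by (rule ext, rule dexp_1_eq_mean) simp
    then have "ldet (dexp X 1) = ldet (dconj_mean X (Suc n)) * ldet (dexp X (1 / real (Suc n)))"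
      using ldet_compose[OF linear_dconj_mean linear_dexp] by metis
    also have "ldet (dconj_mean X (Suc n)) = 1"
      by (intro ldet_unipotent linear_dconj_mean dconj_mean_unipotent) auto
    finally show ?thesis by simp
  qed
  have "(\<lambda>n. ldet (dexp X (1 / real (Suc n)))) \<longlonglongrightarrow> ldet (\<lambda>y::real^'n. y)"
    by (rule ldet_tendsto) (rule dexp_tendsto)
  then have "(\<lambda>n::nat. ldet (dexp X 1)) \<longlonglongrightarrow> ldet (\<lambda>y::real^'n. y)"
    by (simp only: eq[symmetric])
  then show ?thesis by (simp add: LIMSEQ_const_iff ldet_id)
qed

lemma left_translation_has_derivative: "(mul x has_derivative (\<lambda>h. dmul x y (0, h))) (at y)"
  using mul_has_derivative[OF has_derivative_const[of x] has_derivative_ident[of "at y"]] by simp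

lemma linear_left: "linear (\<lambda>h. dmul x y (0, h))"
  using has_derivative_linear[OF left_translation_has_derivative] .

text \<open>For the translation by -y at the point y the differential is \<open>dexp y 1\<close>.
  The general case follows from the chain rule at y for the factorisation of translation by -y into
  translation by x followed by translation by -(xy): two of the three determinants are already known
  to be 1.\<close>

lemma ldet_left_translation: "ldet (\<lambda>h. dmul x y (0, h)) = 1"
proof -
  have inv: "ldet (\<lambda>h. dmul (- y) y (0, h)) = 1" for y
    using ldet_dexp_1[of y] by (simp add: dexp_def[abs_def])
  have "mul (- y) z = mul (- mul x y) (mul x z)" for z
    by (simp add: G.inverse_distrib_swap G.assoc) (simp add: G.assoc[symmetric])
  then have "mul (- y) = (\<lambda>z. mul (- mul x y) (mul x z))" by blast
  moreover have "((\<lambda>z. mul (- mul x y) (mul x z)) has_derivative (\<lambda>h. dmul (- mul x y) (mul x y) (0, dmul x y (0, h)))) (at y)"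
    by (rule has_derivative_compose[OF left_translation_has_derivative left_translation_has_derivative])
  ultimately have "(\<lambda>h. dmul (- y) y (0, h)) = (\<lambda>h. dmul (- mul x y) (mul x y) (0, dmul x y (0, h)))"
    using has_derivative_unique[OF left_translation_has_derivative] by metis
  then have "ldet (\<lambda>h. dmul (- y) y (0, h)) = ldet (\<lambda>h. dmul (- mul x y) (mul x y) (0, h)) * ldet (\<lambda>h. dmul x y (0, h))"
    using ldet_compose[OF linear_left[of "- mul x y" "mul x y"] linear_left[of x y]] by simp
  then show ?thesis by (simp add: inv)
qed

section \<open>Convolution and uniform convergence of mollifications\<close>

lemma continuous_mul:
  assumes "continuous_on S f" "continuous_on S g"
  shows "continuous_on S (\<lambda>p. mul (f p) (g p))"
proof -
  have "continuous_on UNIV mulp" using Ck_mulp[of 0] by simp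
  from continuous_on_compose2[OF this continuous_on_Pair[OF assms]] show ?thesis by simp
qed

lemma continuous_dilation: "continuous_on S f \<Longrightarrow> continuous_on S (\<lambda>p. dilation V r (f p))"
  using linear_continuous_on[OF linear_conv_bounded_linear[THEN iffD1, OF linear_dilation[of r]], of "f ` S"]
  by (rule continuous_on_compose2) auto

text \<open>Substitute y = x (D_\<epsilon> z)^(-1), so that y^(-1) x = D_\<epsilon> z. Translation
  and inversion have Jacobian 1, and the factor \<epsilon>^Q of the dilation cancels the one in
  \<open>mollify\<close>. Afterwards \<epsilon> occurs only in the argument of
  \<open>m\<close>.\<close>

lemma convolution_mollify_eq:
  fixes m \<psi> :: "real ^ 'n \<Rightarrow> real"
  assumes m: "continuous_on UNIV m" and mb: "\<And>x. \<bar>m x\<bar> \<le> M"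
    and \<psi>: "continuous_on UNIV \<psi>" and i: "integrable lborel \<psi>" and e: "0 < \<epsilon>"
  shows "convolution mul m (mollify V \<psi> \<epsilon>) x = (LINT z|lborel. m (mul x (- dilation V \<epsilon> z)) * \<psi> z)"
    and "integrable lborel (\<lambda>z. m (mul x (- dilation V \<epsilon> z)) * \<psi> z)"
proof -
  define g where "g z = mul x (- dilation V \<epsilon> z)" for z
  define f where "f y = m y * mollify V \<psi> \<epsilon> (mul (- y) x)" for y
  have gc: "continuous_on UNIV g"
    unfolding g_def by (intro continuous_mul continuous_intros continuous_dilation)
  have mg: "(\<lambda>z. m (g z)) \<in> borel_measurable borel"
    by (intro borel_measurable_continuous_onI continuous_on_compose2[OF m gc]) auto
  have i': "integrable lborel (\<lambda>z. m (g z) * \<psi> z)"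
  proof (rule Bochner_Integration.integrable_bound)
    show "integrable lborel (\<lambda>z. M * \<psi> z)" using i by simp
    show "(\<lambda>z. m (g z) * \<psi> z) \<in> borel_measurable lborel"
      using mg borel_measurable_continuous_onI[OF \<psi>] by simp
    have "0 \<le> M" using mb[of 0] by linarith
    then show "AE z in lborel. norm (m (g z) * \<psi> z) \<le> norm (M * \<psi> z)"
      using mb by (intro AE_I2) (auto simp: abs_mult intro!: mult_right_mono)
  qed
  then show "integrable lborel (\<lambda>z. m (mul x (- dilation V \<epsilon> z)) * \<psi> z)"
    by (simp add: g_def)
  have fg: "f (g z) = (1 / \<epsilon>) ^ hom_dim V * (m (g z) * \<psi> z)" for z
  proof -
    have "mul (- g z) x = dilation V \<epsilon> z"
      by (simp add: g_def G.inverse_distrib_swap G.assoc)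
    then show ?thesis
      using e by (simp add: f_def mollify_def dilation_dilation dilation_1)
  qed
  have fc: "continuous_on UNIV f"
    unfolding f_def mollify_def
    by (intro continuous_intros m continuous_on_compose2[OF \<psi>] continuous_dilation continuous_mul) auto
  have "(LINT y|lborel. f y) = \<epsilon> ^ hom_dim V * (LINT z|lborel. f (g z))"
  proof (rule change_of_variables_ldet)
    show "f \<in> borel_measurable borel"
      by (rule borel_measurable_continuous_onI[OF fc])
    have dd: "((\<lambda>z. - dilation V \<epsilon> z) has_derivative (\<lambda>h. - dilation V \<epsilon> h)) (at z)" for z
      by (intro has_derivative_minus linear_imp_has_derivative linear_dilation)
    show "(g has_derivative (\<lambda>h. dmul x (- dilation V \<epsilon> z) (0, - dilation V \<epsilon> h))) (at z)" for z
      unfolding g_def[abs_def] by (rule has_derivative_compose[OF dd left_translation_has_derivative])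
    show "ldet (\<lambda>h. dmul x (- dilation V \<epsilon> z) (0, - dilation V \<epsilon> h)) = \<epsilon> ^ hom_dim V" for z
    proof -
      have l1: "linear (\<lambda>h::real^'n. - h)" by (rule linearI) auto
      have l2: "linear (\<lambda>h. - dilation V \<epsilon> h)"
        using linear_compose[OF linear_dilation l1] by (simp add: o_def)
      have "ldet (\<lambda>h. dmul x (- dilation V \<epsilon> z) (0, - dilation V \<epsilon> h)) = ldet (\<lambda>h. - dilation V \<epsilon> h)"
        using ldet_compose[OF linear_left l2, of x "- dilation V \<epsilon> z"] by (simp add: ldet_left_translation)
      also have "\<dots> = ldet (dilation V \<epsilon>)"
        using ldet_compose[OF l1 linear_dilation, of \<epsilon>] by (simp add: ldet_uminus)
      finally show ?thesis by (simp add: ldet_dilation[OF grad e])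
    qed
    show "bij g"
    proof (rule o_bij[of "\<lambda>y. dilation V (1 / \<epsilon>) (- mul (- x) y)"])
      show "(\<lambda>y. dilation V (1 / \<epsilon>) (- mul (- x) y)) \<circ> g = id"
        using e by (simp add: fun_eq_iff g_def G.assoc[symmetric] dilation_dilation dilation_1)
      show "g \<circ> (\<lambda>y. dilation V (1 / \<epsilon>) (- mul (- x) y)) = id"
        using e by (simp add: fun_eq_iff g_def dilation_dilation dilation_1 G.assoc[symmetric])
    qed
    show "integrable lborel (\<lambda>z. f (g z))"
      unfolding fg using i' by simp
  qed
  also have "\<dots> = (LINT z|lborel. m (g z) * \<psi> z)"
    using e by (simp add: fg power_one_over)
  finally show "convolution mul m (mollify V \<psi> \<epsilon>) x = (LINT z|lborel. m (mul x (- dilation V \<epsilon> z)) * \<psi> z)"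
    by (simp add: convolution_def f_def g_def)
qed

text \<open>The compact set where \<open>m\<close> may be large is thickened to K' = K W by the unit
  ball W. For x outside K', neither x nor x w^(-1) lies in \<open>K\<close>, so both values are
  below e/2; on the compact set K' x W uniform continuity applies.\<close>

lemma uniformly_continuous_translation:
  fixes m :: "real ^ 'n \<Rightarrow> real"
  assumes m: "continuous_on UNIV m" and v: "vanishes_at_infinity m" and e: "0 < e"
  shows "\<exists>r>0. \<forall>x w. norm w < r \<longrightarrow> \<bar>m (mul x (- w)) - m x\<bar> \<le> e"
proof -
  obtain K where K: "compact K" "\<And>x. x \<notin> K \<Longrightarrow> \<bar>m x\<bar> < e / 2"
    using v e unfolding vanishes_at_infinity_def by (metis half_gt_zero)
  define W :: "(real ^ 'n) set" where "W = cball 0 1"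
  define K' where "K' = (\<lambda>p. mul (fst p) (snd p)) ` (K \<times> W)"
  have cW: "compact W" by (simp add: W_def)
  have "compact K'"
    unfolding K'_def by (intro compact_continuous_image continuous_mul continuous_intros compact_Times K(1) cW)
  then have cKW: "compact (K' \<times> W)" by (intro compact_Times cW)
  have "continuous_on (K' \<times> W) (\<lambda>p. m (mul (fst p) (- snd p)))"
    by (intro continuous_on_compose2[OF m] continuous_mul continuous_intros) auto
  then have "uniformly_continuous_on (K' \<times> W) (\<lambda>p. m (mul (fst p) (- snd p)))"
    by (rule compact_uniformly_continuous[OF _ cKW])
  then obtain r where r: "0 < r" and rr: "\<And>p q. p \<in> K' \<times> W \<Longrightarrow> q \<in> K' \<times> W \<Longrightarrow> dist q p < r \<Longrightarrow>
      dist (m (mul (fst q) (- snd q))) (m (mul (fst p) (- snd p))) < e"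
    using e unfolding uniformly_continuous_on_def by metis
  have "\<bar>m (mul x (- w)) - m x\<bar> \<le> e" if w: "norm w < min r 1" for x w
  proof (cases "x \<in> K'")
    case True
    have "(x, 0) \<in> K' \<times> W" "(x, w) \<in> K' \<times> W" "dist (x, w) (x, 0) < r"
      using True w by (auto simp: W_def dist_Pair_Pair)
    from rr[OF this] have "dist (m (mul x (- w))) (m x) < e" by simp
    then show ?thesis by (simp add: dist_real_def)
  next
    case False
    have "0 \<in> W" "w \<in> W" using w by (auto simp: W_def)
    have "x \<notin> K"
    proof
      assume "x \<in> K"
      then have "mul x 0 \<in> K'"
        unfolding K'_def using \<open>0 \<in> W\<close> by (intro image_eqI[of _ _ "(x, 0)"]) auto
      then show False using False by simp
    qed
    moreover have "mul x (- w) \<notin> K"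
    proof
      assume "mul x (- w) \<in> K"
      then have "mul (mul x (- w)) w \<in> K'"
        unfolding K'_def using \<open>w \<in> W\<close> by (intro image_eqI[of _ _ "(mul x (- w), w)"]) auto
      then show False using False by (simp add: G.assoc)
    qed
    ultimately show ?thesis using K(2)[of x] K(2)[of "mul x (- w)"] by linarith
  qed
  then show ?thesis using r by (intro exI[of _ "min r 1"]) auto
qed

lemma mollification_uniform_limit:
  fixes m \<psi> :: "real ^ 'n \<Rightarrow> real"
  assumes m: "continuous_on UNIV m" and v: "vanishes_at_infinity m" and mb: "\<And>x. \<bar>m x\<bar> \<le> M"
    and \<psi>: "\<psi> \<in> test_functions UNIV" and nn: "\<And>x. 0 \<le> \<psi> x" and int: "(LINT x|lborel. \<psi> x) = 1" and e: "0 < e"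
  shows "\<forall>\<^sub>F \<epsilon> in at_right 0. \<forall>x. \<bar>convolution mul m (mollify V \<psi> \<epsilon>) x - m x\<bar> \<le> e"
proof -
  have \<psi>c: "continuous_on UNIV \<psi>" using test_functions_smooth[OF \<psi>, of 0] by simp
  \<comment> \<open>The integral of a function that is not integrable is 0 by default, so the value
    1 forces integrability.\<close>
  have i: "integrable lborel \<psi>"
    using int not_integrable_integral_eq by fastforce
  obtain r where r: "0 < r" "\<And>x w. norm w < r \<Longrightarrow> \<bar>m (mul x (- w)) - m x\<bar> \<le> e"
    using uniformly_continuous_translation[OF m v e] by blast
  obtain R where R: "\<And>x. R < norm x \<Longrightarrow> \<psi> x = 0"
    using test_functions_bounded_support[OF \<psi>] by blast
  obtain c where c: "0 \<le> c" "\<And>r x. 0 \<le> r \<Longrightarrow> r \<le> 1 \<Longrightarrow> norm (dilation V r x) \<le> r * c * norm x"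
    using dilation_small by blast
  \<comment> \<open>For \<epsilon> below \<open>d\<close> the dilated support of
    \<open>\<psi>\<close> lies in the ball of radius \<open>r\<close>; the summand 1 in the
    denominator excludes division by 0.\<close>
  define d where "d = min 1 (r / (c * \<bar>R\<bar> + 1))"
  have pos: "0 < c * \<bar>R\<bar> + 1" using c(1) by (simp add: add_nonneg_pos)
  have d: "0 < d" using r pos by (simp add: d_def)
  have "\<forall>x. \<bar>convolution mul m (mollify V \<psi> \<epsilon>) x - m x\<bar> \<le> e" if \<epsilon>: "0 < \<epsilon>" "\<epsilon> < d" for \<epsilon>
  proof
    fix x
    note conv = convolution_mollify_eq[OF m mb \<psi>c i \<epsilon>(1)]
    have small: "norm (dilation V \<epsilon> z) < r" if "\<psi> z \<noteq> 0" for z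
    proof -
      have z: "norm z \<le> \<bar>R\<bar>" using R[of z] that by fastforce
      have "norm (dilation V \<epsilon> z) \<le> \<epsilon> * c * norm z"
        using \<epsilon> by (intro c) (auto simp: d_def)
      also have "\<dots> \<le> \<epsilon> * c * \<bar>R\<bar>"
        using \<epsilon> c(1) z by (intro mult_left_mono) auto
      also have "\<dots> < \<epsilon> * (c * \<bar>R\<bar> + 1)"
        using \<epsilon> by (simp add: algebra_simps)
      also have "\<dots> \<le> r"
        using \<epsilon> pos by (simp add: d_def pos_less_divide_eq less_imp_le)
      finally show ?thesis .
    qed
    have i1: "integrable lborel (\<lambda>z. (m (mul x (- dilation V \<epsilon> z)) - m x) * \<psi> z)"
      using Bochner_Integration.integrable_diff[OF conv(2)[of x] integrable_mult_right[OF i, of "m x"]] by (simp add: left_diff_distrib)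
    have "convolution mul m (mollify V \<psi> \<epsilon>) x - m x = (LINT z|lborel. m (mul x (- dilation V \<epsilon> z)) * \<psi> z) - (LINT z|lborel. m x * \<psi> z)"
      by (simp add: conv int)
    also have "\<dots> = (LINT z|lborel. (m (mul x (- dilation V \<epsilon> z)) - m x) * \<psi> z)"
      using conv(2)[of x] i by (simp add: left_diff_distrib)
    also have "\<bar>\<dots>\<bar> \<le> (LINT z|lborel. e * \<psi> z)"
    proof (rule integral_abs_bound_integral[OF i1])
      fix z
      show "\<bar>(m (mul x (- dilation V \<epsilon> z)) - m x) * \<psi> z\<bar> \<le> e * \<psi> z"
        using r(2)[OF small, of z x] nn[of z] by (cases "\<psi> z = 0") (auto simp: abs_mult intro!: mult_right_mono)
    qed (use i in simp)
    also have "\<dots> = e" by (simp add: int)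
    finally show "\<bar>convolution mul m (mollify V \<psi> \<epsilon>) x - m x\<bar> \<le> e" .
  qed
  then show ?thesis
    unfolding eventually_at_right_field using d by blast
qed

text \<open>The integrand is continuous in both variables together, hence jointly measurable, and an
  integral over one variable is measurable in the other. The stability estimate asks this of its
  coefficients.\<close>

lemma convolution_borel_measurable:
  fixes m \<psi> :: "real ^ 'n \<Rightarrow> real"
  assumes m: "continuous_on UNIV m" and \<psi>: "continuous_on UNIV \<psi>"
  shows "convolution mul m (mollify V \<psi> \<epsilon>) \<in> borel_measurable borel"
proof -
  have "continuous_on UNIV (\<lambda>p. m (snd p) * ((1 / \<epsilon>) ^ hom_dim V * \<psi> (dilation V (1 / \<epsilon>) (mul (- snd p) (fst p)))))"
    by (intro continuous_intros continuous_on_compose2[OF m] continuous_on_compose2[OF \<psi>] continuous_dilation continuous_mul) auto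
  then have "(\<lambda>p. m (snd p) * mollify V \<psi> \<epsilon> (mul (- snd p) (fst p))) \<in> borel_measurable (borel :: ((real^'n) \<times> (real^'n)) measure)"
    unfolding mollify_def by (rule borel_measurable_continuous_onI)
  then have "(\<lambda>(x, y). m y * mollify V \<psi> \<epsilon> (mul (- y) x)) \<in> borel_measurable (borel \<Otimes>\<^sub>M lborel)"
    by (simp add: case_prod_beta' borel_prod[symmetric] cong: measurable_cong_sets)
  then show ?thesis
    unfolding convolution_def[abs_def] by (rule lborel.borel_measurable_lebesgue_integral)
qed

end

section \<open>Convergence of the regularised solutions\<close>

lemma vanishes_at_infinity_bounded:
  fixes m :: "'a::topological_space \<Rightarrow> real"
  assumes "continuous_on UNIV m" "vanishes_at_infinity m"
  obtains M where "\<And>x. \<bar>m x\<bar> \<le> M"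
proof -
  obtain K where K: "compact K" "\<And>x. x \<notin> K \<Longrightarrow> \<bar>m x\<bar> < 1"
    using assms(2) unfolding vanishes_at_infinity_def by (metis zero_less_one)
  have "bounded (m ` K)"
    by (intro compact_imp_bounded compact_continuous_image continuous_on_subset[OF assms(1)] K) simp
  then obtain b where b: "\<And>x. x \<in> K \<Longrightarrow> \<bar>m x\<bar> \<le> b"
    unfolding bounded_iff by auto
  have "\<bar>m x\<bar> \<le> max b 1" for x
    using b[of x] K(2)[of x] by (cases "x \<in> K") auto
  then show ?thesis by (rule that)
qed

theorem theorem5p2:
  fixes mul :: "real ^ 'n \<Rightarrow> real ^ 'n \<Rightarrow> real ^ 'n"
    and V :: "nat \<Rightarrow> (real ^ 'n) set"
    and R :: "(real ^ 'n \<Rightarrow> complex) \<Rightarrow> real ^ 'n \<Rightarrow> complex"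
    and A :: "(real ^ 'n) operator"
    and E :: "real set \<Rightarrow> (real ^ 'n \<Rightarrow> complex) \<Rightarrow> real ^ 'n \<Rightarrow> complex"
    and \<nu> s T :: real
    and u0 u1 :: "real ^ 'n \<Rightarrow> complex"
    and m \<psi> :: "real ^ 'n \<Rightarrow> real"
    and u :: "real \<Rightarrow> real ^ 'n \<Rightarrow> complex"
    and u\<epsilon> :: "real \<Rightarrow> real \<Rightarrow> real ^ 'n \<Rightarrow> complex"
  assumes "graded_lie_group mul V"
    and "rockland_operator mul V \<nu> R"
    and "positive_operator R"
    and "self_adjoint_extension R A"
    and "spectral_resolution A E"
    and "s > 0"
    and "T > 0"
    and "u0 \<in> Domain (operator_power E (s / 2))"
    and "u1 \<in> L2"
    and "continuous_on UNIV m"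
    and "vanishes_at_infinity m"
    and "\<And>x. m x \<ge> 0"
    and "\<psi> \<in> test_functions UNIV"
    and "\<And>x. \<psi> x \<ge> 0"
    and "(LINT x|lborel. \<psi> x) = 1"
    and "weak_solution (operator_power E (s / 2)) T m u0 u1 u"
    and "\<And>\<epsilon>. \<epsilon> \<in> {0<..1} \<Longrightarrow>
           weak_solution (operator_power E (s / 2)) T (convolution mul m (mollify V \<psi> \<epsilon>)) u0 u1 (u\<epsilon> \<epsilon>)"
  shows "\<forall>t\<in>{0..T}. ((\<lambda>\<epsilon>. l2_norm (\<lambda>x. u\<epsilon> \<epsilon> t x - u t x)) \<longlongrightarrow> 0) (at_right 0)"
proof
  fix t assume t: "t \<in> {0..T}"
  note \<open>T > 0\<close>[simp] and sol = assms(16) and sol' = assms(17)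
  have psi: "\<psi> \<in> test_functions UNIV" "\<And>x. 0 \<le> \<psi> x" by fact+
  have m: "continuous_on UNIV m" "vanishes_at_infinity m" by fact+
  interpret graded_group_vec V mul
    by unfold_locales (use assms(1) in \<open>auto simp: graded_lie_group_def\<close>)
  interpret spectral_truncation E "\<lambda>l. l powr (s / 2)"
    by unfold_locales (use assms(5) in \<open>auto simp: spectral_resolution_def\<close>)
  \<comment> \<open>The bump in time for the stability estimate is built from \<open>\<psi>\<close>
    along a line through this point.\<close>
  obtain x0 where x0: "\<psi> x0 \<noteq> 0"
    using assms(15) by (cases "\<forall>x. \<psi> x = 0") auto
  obtain M where M: "\<And>x. \<bar>m x\<bar> \<le> M"
    using vanishes_at_infinity_bounded[OF m] by blast
  \<comment> \<open>One bound has to serve for \<open>m\<close> and all its regularisations. These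
    differ from \<open>m\<close> by at most \<delta> <= 1, hence M + 1.\<close>
  have mM: "m \<in> borel_measurable borel" "\<And>x. \<bar>m x\<bar> \<le> M + 1"
  proof -
    show "m \<in> borel_measurable borel" by (rule borel_measurable_continuous_onI[OF m(1)])
    show "\<bar>m x\<bar> \<le> M + 1" for x using M[of x] by linarith
  qed
  obtain v where uL: "\<And>t. t \<in> {0..T} \<Longrightarrow> u t \<in> L2" and vL: "\<And>t. t \<in> {0..T} \<Longrightarrow> v t \<in> L2"
    and ud: "has_l2_time_derivative u v {0..T}"
    by (rule weak_solution_truncated[OF psi x0 \<open>T > 0\<close> mM sol[unfolded operator_power_def]]) (rule that; blast)
  have "continuous_on {0..T} (\<lambda>t. l2_norm (u t))"
    by (intro continuous_wrt_l2_norm has_l2_time_derivative_imp_continuous[OF ud] uL vL)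
  then have "bounded ((\<lambda>t. l2_norm (u t)) ` {0..T})"
    by (intro compact_imp_bounded compact_continuous_image) auto
  then obtain U where "\<forall>t\<in>{0..T}. \<bar>l2_norm (u t)\<bar> \<le> U"
    unfolding bounded_iff by auto
  then have U: "l2_norm (u t) \<le> U" if "t \<in> {0..T}" for t
    using that by (auto intro: order_trans[OF abs_ge_self])
  have U0: "0 \<le> U" using U[OF t] l2_norm_nonneg[of "u t"] by linarith
  \<comment> \<open>Chosen so that the stability estimate with the bound M + 1 reads: the squared
    norm is at most (\<delta> L)^2.\<close>
  define L where "L = sqrt (U\<^sup>2 / (M + 1 + 2) * exp ((M + 1 + 2) * T))"
  have M0: "0 \<le> M" using M[of 0] by linarith
  have L0: "0 \<le> L" unfolding L_def using M0 by simp
  show "((\<lambda>\<epsilon>. l2_norm (\<lambda>x. u\<epsilon> \<epsilon> t x - u t x)) \<longlongrightarrow> 0) (at_right 0)"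
  proof (rule tendstoI)
    fix e :: real assume e: "0 < e"
    \<comment> \<open>The cap 1 keeps the regularised coefficient below M + 1; dividing by L + 1
      gives \<delta> L < e even when L is 0.\<close>
    define \<delta> where "\<delta> = min 1 (e / (L + 1))"
    have \<delta>: "0 < \<delta>" "\<delta> \<le> 1" using e L0 by (auto simp: \<delta>_def)
    have "\<delta> * L < e"
    proof -
      have "\<delta> * L \<le> e / (L + 1) * L" using L0 by (intro mult_right_mono) (simp_all add: \<delta>_def)
      also have "\<dots> < e" using e L0 by (simp add: field_simps)
      finally show ?thesis .
    qed
    have "\<forall>\<^sub>F \<epsilon> in at_right 0. \<epsilon> \<in> {0<..1::real}"
      unfolding eventually_at_right_field by (intro exI[of _ 1]) auto
    moreover have "\<forall>\<^sub>F \<epsilon> in at_right 0. \<forall>x. \<bar>convolution mul m (mollify V \<psi> \<epsilon>) x - m x\<bar> \<le> \<delta>"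
      by (rule mollification_uniform_limit[OF m M psi assms(15) \<delta>(1)])
    ultimately show "\<forall>\<^sub>F \<epsilon> in at_right 0. dist (l2_norm (\<lambda>x. u\<epsilon> \<epsilon> t x - u t x)) 0 < e"
    proof eventually_elim
      case (elim \<epsilon>)
      define m\<epsilon> where "m\<epsilon> = convolution mul m (mollify V \<psi> \<epsilon>)"
      have close: "\<bar>m\<epsilon> x - m x\<bar> \<le> \<delta>" for x using elim(2) by (simp add: m\<epsilon>_def)
      have m\<epsilon>: "m\<epsilon> \<in> borel_measurable borel" "\<And>x. \<bar>m\<epsilon> x\<bar> \<le> M + 1"
      proof -
        show "m\<epsilon> \<in> borel_measurable borel"
          unfolding m\<epsilon>_def using test_functions_smooth[OF psi(1), of 0]
          by (intro convolution_borel_measurable m) simp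
        show "\<bar>m\<epsilon> x\<bar> \<le> M + 1" for x
          using close[of x] M[of x] \<delta>(2) by linarith
      qed
      have "(l2_norm (\<lambda>x. u\<epsilon> \<epsilon> t x - u t x))\<^sup>2 \<le> (\<delta> * U)\<^sup>2 / (M + 1 + 2) * exp ((M + 1 + 2) * T)"
        by (rule weak_solution_stability[OF psi x0 \<open>T > 0\<close> mM m\<epsilon> close sol[unfolded operator_power_def] _ U t])
           (use sol'[OF elim(1)] in \<open>simp add: operator_power_def m\<epsilon>_def\<close>)
      also have "\<dots> = (\<delta> * L)\<^sup>2"
        using M0 by (simp add: L_def power_mult_distrib)
      finally have "l2_norm (\<lambda>x. u\<epsilon> \<epsilon> t x - u t x) \<le> \<delta> * L"
        by (rule power2_le_imp_le) (use \<delta> L0 in simp)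
      then show ?case
        using \<open>\<delta> * L < e\<close> by (simp add: l2_norm_nonneg)
    qed
  qed
qed

end
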